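(* Consider the system of $N\ge2$ interacting reinforced stochastic processes described in the context, under assumptions (A1)–(A4) listed there. Let $\widetilde N_n:=N^{-1/2}\,\mathbf{v}_1^\top\mathbf{N}_n$, let $\gamma_0:=\max\{1/2,2\gamma-1\}$, $\widetilde\sigma_\gamma^2:=\frac{\|\mathbf{v}_1\|^2c^2}{N(2\gamma-1)}$, and $$\widetilde\sigma^2:=\frac{\|\mathbf{v}_1\|^2}{N}\times\begin{cases}\dfrac q2&\text{if }\nu<\gamma_0\text{ or }\nu=\gamma_0<1,\\[4pt] \dfrac{(q-c)^2}{2q-1}&\text{if }\nu=\gamma_0=1\ (\text{that is }\nu=\gamma=1),\\[4pt] \dfrac{c^2}{2q-(2\gamma-1)}&\text{if }\gamma_0<\nu=1.\end{cases}$$ The following hold. (a) If $\nu<\gamma_0$, then $n^{\nu/2}(\widetilde N_n-Z_\infty)\longrightarrow\mathcal{N}\left(0,\,Z_\infty(1-Z_\infty)\widetilde\sigma^2\right)$ stably. (b) If $\gamma_0<\nu<1$, then $n^{\gamma-\frac12}(\widetilde N_n-Z_\infty)\longrightarrow\mathcal{N}\left(0,\,Z_\infty(1-Z_\infty)\widetilde\sigma_\gamma^2\right)$ stably. (c) If $\nu=\gamma_0$ or $\nu=1$ (i.e. $\nu=\gamma_0<1$ or $\nu=\gamma_0=1$ or $\gamma_0<\nu=1$), then $n^{\gamma-\frac12}(\widetilde N_n-Z_\infty)\longrightarrow\mathcal{N}\left(0,\,Z_\infty(1-Z_\infty)(\widetilde\sigma_\gamma^2+\widetilde\sigma^2)\right)$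 stably.
   Context: Model. Let $N\ge 2$, $V=\{1,\dots,N\}$, and let $W=[w_{h,j}]_{h,j\in V}$ be a deterministic matrix with $w_{h,j}\ge 0$ and $\sum_{h=1}^N w_{h,j}=1$ for each $j\in V$ (i.e. $W^\top\mathbf{1}=\mathbf{1}$). Let $(r_n)_{n\ge 0}$ be a sequence of real numbers in $(0,1)$ and $(a_k)_{k\ge1}$ a sequence of strictly positive real numbers; set $q_{n,k}:=a_k/\sum_{l=1}^n a_l$ for $1\le k\le n$. On a probability space $(\Omega,\mathcal{A},P)$, let $Z_{0,j}$ ($j\in V$) be random variables with values in $[0,1]$, let $X_{n,j}$ ($n\ge1$, $j\in V$) be random variables with values in $\{0,1\}$, and let $\mathcal{F}_n:=\sigma(Z_{0,h}:h\in V)\vee\sigma(X_{k,j}:1\le k\le n,\,j\in V)$. For every $n\ge 0$ the variables $\{X_{n+1,j}:j\in V\}$ are conditionally independent given $\mathcal{F}_n$ with $P(X_{n+1,j}=1\mid\mathcal{F}_n)=\sum_{h=1}^N w_{h,j}Z_{n,h}$, where, for $n\ge1$, $Z_{n,h}=(1-r_{n-1})Z_{n-1,h}+r_{n-1}X_{n,h}$. The weighted empirical means are $N_{0,j}:=0$ and $N_{n,j}:=\sum_{k=1}^n q_{n,k}X_{k,j}$ for $n\ge 1$. Set $\mathbf{Z}_n=(Z_{n,1},\dots,Z_{n,N})^\top$, $\mathbf{N}_n=(N_{n,1},\dots,N_{n,N})^\top$. Assumptions. (A1) $W$ is irreducible and diagonalizable over $\mathbb{C}$. (A2) There are $\gamma,\nu\in(1/2,1]$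 and $c,q>0$ with $r_{n-1}=cn^{-\gamma}+O(n^{-2\gamma})$ and $q_{n,n}=qn^{-\nu}+O(n^{-2\nu})$. (A3) Let $\lambda^*$ be an eigenvalue of maximal real part among the eigenvalues of $W$ other than $1$. When $\gamma=1$, assume $c>1/[2(1-\mathrm{Re}(\lambda^* ))]$; when $\nu=1$, assume $q>1/2$. (A4) When $\nu=\gamma$, assume $q\ne c\alpha_j$ for all $j\ge 2$, where $\lambda_1=1,\lambda_2,\dots,\lambda_N$ are the eigenvalues of $W$ with multiplicity ($\lambda_1=1$ is simple) and $\alpha_j:=1-\lambda_j$. $\mathbf{v}_1$ is the right eigenvector of $W$ for the eigenvalue $1$, normalized by $N^{-1/2}\mathbf{1}^\top\mathbf{v}_1=1$ (its entries are strictly positive). $\|\cdot\|$ is the Euclidean norm and $\mathbf{1}$ a vector of ones. $Z_\infty$ is the $[0,1]$-valued random variable such that $\mathbf{Z}_n\to Z_\infty\mathbf{1}$ almost surely (its existence is known under these assumptions). Stable convergence. A random sequence $Y_n$ in $\mathbb{R}^d$ converges stably to a kernel (random probability measure) $K$ on $\mathbb{R}^d$ if, for every $H\in\mathcal{A}$ with $P(H)>0$, $P(Y_n\in\cdot\mid H)\to E[K(\cdot)\mid H]$ weakly. For a nonnegative random variable $\Sigma$, $\mathcal{N}(0,\Sigma)$ denotes the kernel $\omega\mapsto\mathcal{N}(0,\Sigma(\omega))$. *)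

theory Defs
  imports
    "HOL-Probability.Probability"
    "HOL-Library.Landau_Symbols"
    "Jordan_Normal_Form.Char_Poly"
begin

text \<open>
  The vertex set is \<open>{0,\<dots>,N - 1}\<close>, because matrices of type \<open>mat\<close> are indexed from 0.
  The infix \<open>$\<close> of the finite Cartesian products is switched off in favour of the one of \<open>mat\<close>.
\<close>

unbundle no vec_syntax

subsection \<open>The interaction matrix\<close>

abbreviation complex_mat :: "real mat \<Rightarrow> complex mat" where
  "complex_mat W \<equiv> map_mat complex_of_real W"

text \<open>Irreducibility: the directed graph of the nonzero entries is strongly connected.\<close>

definition irreducible_mat :: "real mat \<Rightarrow> bool" where
  "irreducible_mat W \<longleftrightarrow>
     (\<forall>h<dim_row W. \<forall>j<dim_row W.
        (h, j) \<in> {(i, k). i < dim_row W \<and> k < dim_row W \<and> W $$ (i, k) \<noteq> 0}\<^sup>*)"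

definition diagonalizable_mat :: "complex mat \<Rightarrow> bool" where
  "diagonalizable_mat A \<longleftrightarrow> (\<exists>D. diagonal_mat D \<and> similar_mat A D)"

subsection \<open>Conditioning on a sub-\<open>\<sigma>\<close>-algebra\<close>

text \<open>As in the library, sub-\<open>\<sigma>\<close>-algebras are represented by measures of which only the
  measurable sets matter.\<close>

definition sigma_cond_prob :: "'a measure \<Rightarrow> 'a measure \<Rightarrow> 'a set \<Rightarrow> 'a \<Rightarrow> real" where
  "sigma_cond_prob M F E = real_cond_exp M F (indicator E)"

definition cond_indep_vars ::
  "'a measure \<Rightarrow> 'a measure \<Rightarrow> ('i \<Rightarrow> 'a \<Rightarrow> real) \<Rightarrow> 'i set \<Rightarrow> bool" where
  "cond_indep_vars M F Y I \<longleftrightarrow>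
     (\<forall>J B. J \<subseteq> I \<and> finite J \<and> J \<noteq> {} \<and> (\<forall>j\<in>J. B j \<in> sets borel) \<longrightarrow>
        (AE \<omega> in M.
           sigma_cond_prob M F {\<omega> \<in> space M. \<forall>j\<in>J. Y j \<omega> \<in> B j} \<omega> =
           (\<Prod>j\<in>J. sigma_cond_prob M F {\<omega> \<in> space M. Y j \<omega> \<in> B j} \<omega>)))"

text \<open>\<open>\<F>\<^sub>n\<close>, generated by \<open>Z\<^sub>0\<^sub>,\<^sub>h\<close> and \<open>X\<^sub>k\<^sub>,\<^sub>j\<close> for \<open>1 \<le> k \<le> n\<close>; the argument \<open>Z0\<close> is the family
  of initial inclinations.\<close>

definition rsp_filtration ::
  "'a measure \<Rightarrow> nat \<Rightarrow> (nat \<Rightarrow> 'a \<Rightarrow> real) \<Rightarrow> (nat \<Rightarrow> nat \<Rightarrow> 'a \<Rightarrow> real) \<Rightarrow> nat \<Rightarrow> 'a measure" where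
  "rsp_filtration M N Z0 X n = sigma (space M)
     ({Z0 h -` B \<inter> space M | h B. h < N \<and> B \<in> sets borel} \<union>
      {X k j -` B \<inter> space M | k j B. 1 \<le> k \<and> k \<le> n \<and> j < N \<and> B \<in> sets borel})"

subsection \<open>Weighted empirical means\<close>

definition emp_weight :: "(nat \<Rightarrow> real) \<Rightarrow> nat \<Rightarrow> nat \<Rightarrow> real" where
  "emp_weight a n k = a k / (\<Sum>l=1..n. a l)"

text \<open>For \<open>n = 0\<close> the sum is empty, which gives the convention \<open>N\<^sub>0\<^sub>,\<^sub>j = 0\<close>.\<close>

definition emp_mean ::
  "(nat \<Rightarrow> real) \<Rightarrow> (nat \<Rightarrow> nat \<Rightarrow> 'a \<Rightarrow> real) \<Rightarrow> nat \<Rightarrow> nat \<Rightarrow> 'a \<Rightarrow> real" where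
  "emp_mean a X n j \<omega> = (\<Sum>k=1..n. emp_weight a n k * X k j \<omega>)"

definition emp_mean_tilde ::
  "nat \<Rightarrow> real Matrix.vec \<Rightarrow> (nat \<Rightarrow> real) \<Rightarrow> (nat \<Rightarrow> nat \<Rightarrow> 'a \<Rightarrow> real) \<Rightarrow> nat \<Rightarrow> 'a \<Rightarrow> real" where
  "emp_mean_tilde N v a X n \<omega> = (\<Sum>j<N. v $ j * emp_mean a X n j \<omega>) / sqrt (real N)"

subsection \<open>Asymptotic variances\<close>

definition gamma0 :: "real \<Rightarrow> real" where
  "gamma0 \<gamma> = max (1/2) (2 * \<gamma> - 1)"

text \<open>\<open>L2_set (($) v) {..<N}\<close> is the Euclidean norm of \<open>v\<close>.\<close>

definition sigma2_gamma :: "nat \<Rightarrow> real Matrix.vec \<Rightarrow> real \<Rightarrow> real \<Rightarrow> real" where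
  "sigma2_gamma N v c \<gamma> =
     (L2_set (($) v) {..<N})\<^sup>2 * c\<^sup>2 / (real N * (2 * \<gamma> - 1))"

text \<open>The remaining case \<open>gamma0 \<gamma> < \<nu> < 1\<close> has no associated value.\<close>

definition sigma2 :: "nat \<Rightarrow> real Matrix.vec \<Rightarrow> real \<Rightarrow> real \<Rightarrow> real \<Rightarrow> real \<Rightarrow> real" where
  "sigma2 N v c q \<gamma> \<nu> =
     (L2_set (($) v) {..<N})\<^sup>2 / real N *
     (if \<nu> < gamma0 \<gamma> \<or> (\<nu> = gamma0 \<gamma> \<and> gamma0 \<gamma> < 1) then q / 2
      else if \<nu> = gamma0 \<gamma> \<and> gamma0 \<gamma> = 1 then (q - c)\<^sup>2 / (2 * q - 1)
      else if gamma0 \<gamma> < \<nu> \<and> \<nu> = 1 then c\<^sup>2 / (2 * q - (2 * \<gamma> - 1))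
      else undefined)"

subsection \<open>Stable convergence\<close>

text \<open>The centred normal law with variance \<open>s \<ge> 0\<close>, where variance 0 means the Dirac mass at 0.\<close>

definition centred_normal :: "real \<Rightarrow> real measure" where
  "centred_normal s =
     (if s = 0 then return borel 0
      else density lborel (\<lambda>x. ennreal (normal_density 0 (sqrt s) x)))"

text \<open>
  Stable convergence of real random variables to a kernel \<open>K\<close> on the real line.
  The measure \<open>uniform_measure M H\<close> is the conditional probability given the event \<open>H\<close>, and
  \<open>uniform_measure M H \<bind> K\<close> is the mixture \<open>B \<mapsto> E[K(B) | H]\<close>.
\<close>

definition stable_conv ::
  "'a measure \<Rightarrow> (nat \<Rightarrow> 'a \<Rightarrow> real) \<Rightarrow> ('a \<Rightarrow> real measure) \<Rightarrow> bool" where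
  "stable_conv M Y K \<longleftrightarrow>
     (\<forall>n. Y n \<in> borel_measurable M) \<and>
     K \<in> measurable M (prob_algebra borel) \<and>
     (\<forall>H\<in>sets M. measure M H > 0 \<longrightarrow>
        weak_conv_m (\<lambda>n. distr (uniform_measure M H) borel (Y n))
                    (uniform_measure M H \<bind> K))"

end

theory Submission
  imports Defs "HOL-Real_Asymp.Real_Asymp"
begin

text \<open>
  Since \<open>v\<^sub>1\<close> is a right eigenvector of \<open>W\<close> for the eigenvalue \<open>1\<close>, the weighted average
  \<open>N\<^bsup>-1/2\<^esup> v\<^sub>1\<^bsup>T\<^esup> Z\<^sub>n\<close> is a bounded martingale with increments \<open>r\<^sub>n D\<^sub>n\<close>, where
  \<open>D\<^sub>n = N\<^bsup>-1/2\<^esup> v\<^sub>1\<^bsup>T\<^esup> (X\<^sub>n\<^sub>+\<^sub>1 - W\<^bsup>T\<^esup> Z\<^sub>n)\<close>, and the weighted empirical mean satisfies a scalar recursion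
  driven by the same differences. Hence the rescaled error is a series \<open>\<Sum>\<^sub>k b\<^sub>n\<^sub>k D\<^sub>k\<close> with deterministic
  weights. Conditional independence makes the conditional variance of \<open>D\<^sub>n\<close> converge to
  \<open>\<parallel>v\<^sub>1\<parallel>\<^sup>2 N\<^bsup>-1\<^esup> Z\<^sub>\<infinity> (1 - Z\<^sub>\<infinity>)\<close>, so only \<open>\<Sum>\<^sub>k b\<^sub>n\<^sub>k\<^sup>2 \<rightarrow> \<sigma>\<^sup>2\<close> and \<open>\<Sum>\<^sub>k \<bar>b\<^sub>n\<^sub>k\<bar>\<^sup>3 \<rightarrow> 0\<close> are needed.

  For the central limit theorem, fix an event \<open>A\<close> known at time \<open>m\<close> and replace the increments after
  \<open>m\<close> one at a time by Gaussian ones whose variance is frozen at time \<open>m\<close>; the total error is at most a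
  multiple of \<open>sup\<^bsub>k \<ge> m\<^esub> E \<bar>V\<^sub>k - V\<^sub>m\<bar>\<close>, which vanishes as \<open>m\<close> grows. Arbitrary events are reached by
  a Dynkin argument and by conditioning on the \<open>\<sigma>\<close>-algebra generated by the whole process.
  The sums of powers of the weights satisfy \<open>x\<^sub>n\<^sub>+\<^sub>1 = (1 - \<delta>\<^sub>n) x\<^sub>n + \<delta>\<^sub>n L\<^sub>n\<close> with \<open>\<Sum>\<^sub>n \<delta>\<^sub>n = \<infinity>\<close>, so they converge to
  the limit of \<open>L\<^sub>n\<close>.
\<close>

subsection \<open>A stable central limit theorem for weighted martingale differences\<close>

lemma (in finite_measure) integrable_bounded:
  fixes f :: "'a \<Rightarrow> 'b::{banach, second_countable_topology}"
  assumes "f \<in> borel_measurable M" "\<And>x. x \<in> space M \<Longrightarrow> norm (f x) \<le> B"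
  shows "integrable M f"
  using assms by (intro integrable_const_bound[where B = B]) auto

lemma (in prob_space) norm_integral_le_bound:
  fixes f :: "'a \<Rightarrow> 'b::{banach, second_countable_topology}"
  assumes "\<And>x. x \<in> space M \<Longrightarrow> norm (f x) \<le> B" "0 \<le> B"
  shows "norm (\<integral>x. f x \<partial>M) \<le> B"
proof (cases "integrable M f")
  case True
  have "norm (\<integral>x. f x \<partial>M) \<le> (\<integral>x. norm (f x) \<partial>M)"
    by (rule integral_norm_bound)
  also have "\<dots> \<le> (\<integral>x. B \<partial>M)"
    using True assms(1) by (intro integral_mono) auto
  finally show ?thesis by (simp add: prob_space)
qed (use assms in \<open>simp add: not_integrable_integral_eq\<close>)

text \<open>The pull-out rule for a factor that is known at the time of conditioning. Since
  \<open>real_cond_exp\<close> is real-valued, the rule is applied to the real and the imaginary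
  part of \<open>G\<close> separately.\<close>

lemma (in finite_measure_subalgebra) integral_mult_cond_exp_zero:
  fixes G :: "'a \<Rightarrow> complex"
  assumes [measurable]: "G \<in> borel_measurable F" "f \<in> borel_measurable M"
    and G: "\<And>x. x \<in> space M \<Longrightarrow> cmod (G x) \<le> B"
    and f: "integrable M f"
    and zero: "AE x in M. real_cond_exp M F f x = 0"
  shows "(\<integral>x. G x * of_real (f x) \<partial>M) = 0"
proof -
  have [measurable]: "G \<in> borel_measurable M"
    by (rule measurable_from_subalg[OF subalg assms(1)])
  have int: "integrable M (\<lambda>x. G x * of_real (f x))"
  proof (rule Bochner_Integration.integrable_bound[where f = "\<lambda>x. B * f x"])
    show "AE x in M. norm (G x * of_real (f x)) \<le> norm (B * f x)"
      using G by (intro AE_I2) (auto simp: norm_mult abs_mult intro!: mult_right_mono order_trans[OF G])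
  qed (use f in auto)
  have "(\<integral>x. Re (G x) * f x \<partial>M) = 0" "(\<integral>x. Im (G x) * f x \<partial>M) = 0"
  proof -
    \<comment> \<open>\<open>h\<close> stands for \<open>Re\<close> or \<open>Im\<close>; being
      dominated by the modulus, it inherits integrability from the complex product.\<close>
    have "(\<integral>x. h (G x) * f x \<partial>M) = 0"
      if h[measurable]: "h \<in> borel_measurable borel" and "\<And>z. \<bar>h z\<bar> \<le> cmod z" for h :: "complex \<Rightarrow> real"
    proof -
      have "integrable M (\<lambda>x. h (G x) * f x)"
        by (rule Bochner_Integration.integrable_bound[OF int])
           (auto simp: norm_mult abs_mult intro!: AE_I2 mult_right_mono that)
      then have "(\<integral>x. h (G x) * f x \<partial>M) = (\<integral>x. h (G x) * real_cond_exp M F f x \<partial>M)"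
        by (subst real_cond_exp_intg(2)) auto
      also have "\<dots> = (\<integral>x. 0 \<partial>M)"
        using zero by (intro integral_cong_AE) auto
      finally show ?thesis by simp
    qed
    from this[of Re] this[of Im] show "(\<integral>x. Re (G x) * f x \<partial>M) = 0" "(\<integral>x. Im (G x) * f x \<partial>M) = 0"
      by (auto simp: abs_Re_le_cmod abs_Im_le_cmod)
  qed
  then show ?thesis
    using int by (auto simp: complex_eq_iff simp flip: integral_Re integral_Im)
qed

lemma iexp_taylor2_bound:
  "cmod (iexp x - (1 + \<i> * x - x\<^sup>2 / 2)) \<le> \<bar>x\<bar> ^ 3 / 6"
proof -
  have "(\<Sum>k\<le>2. (\<i> * x) ^ k / fact k) = 1 + \<i> * x - x\<^sup>2 / 2"
    by (simp add: numeral_2_eq_2 power_mult_distrib)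
  then show ?thesis
    using iexp_approx1[of x 2] by (simp add: fact_numeral numeral_3_eq_3 eval_nat_numeral)
qed

text \<open>Written in y rather than y^2, so that the Gaussian factor has an error of third order,
  just as in \<open>iexp_taylor2_bound\<close>. For y \<le> 1 the error is at most y^4 and hence
  y^3; for larger y the crude bound y^2 suffices.\<close>

lemma exp_taylor1_bound:
  fixes y :: real
  assumes "0 \<le> y"
  shows "\<bar>1 - y\<^sup>2 - exp (- y\<^sup>2)\<bar> \<le> y ^ 3"
proof -
  have 1: "1 - y\<^sup>2 \<le> exp (- y\<^sup>2)"
    using exp_ge_add_one_self[of "- y\<^sup>2"] by simp
  have "exp (- y\<^sup>2) - (1 - y\<^sup>2) \<le> y ^ 3"
  proof (cases "y \<le> 1")
    case True
    have "exp (- y\<^sup>2) \<le> 1 - y\<^sup>2 + (y\<^sup>2)\<^sup>2"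
    proof -
      have "exp (- y\<^sup>2) = inverse (exp (y\<^sup>2))" by (simp add: exp_minus)
      also have "\<dots> \<le> inverse (1 + y\<^sup>2)"
        by (intro le_imp_inverse_le) (auto intro: add_pos_nonneg)
      also have "\<dots> \<le> 1 - y\<^sup>2 + (y\<^sup>2)\<^sup>2"
      proof -
        \<comment> \<open>The product on the right equals 1 + y^6.\<close>
        have "1 \<le> (1 - y\<^sup>2 + (y\<^sup>2)\<^sup>2) * (1 + y\<^sup>2)"
          using zero_le_power[OF assms, of 6] by (simp add: algebra_simps eval_nat_numeral)
        moreover have "0 < 1 + y\<^sup>2" by (auto intro: add_pos_nonneg)
        ultimately show ?thesis by (simp add: inverse_eq_divide pos_divide_le_eq)
      qed
      finally show ?thesis .
    qed
    moreover have "y ^ 4 \<le> y ^ 3"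
      using assms True by (intro power_decreasing) auto
    ultimately show ?thesis by (simp flip: power_mult)
  next
    case False
    have "exp (- y\<^sup>2) \<le> 1" by simp
    moreover have "y ^ 2 \<le> y ^ 3"
      using False by (intro power_increasing) auto
    ultimately show ?thesis by linarith
  qed
  with 1 show ?thesis by linarith
qed

section \<open>Gaussian replacement of martingale differences\<close>

locale bounded_martingale_differences = prob_space +
  fixes F :: "nat \<Rightarrow> 'a measure" and D V :: "nat \<Rightarrow> 'a \<Rightarrow> real" and C :: real
  assumes subalg: "\<And>n. subalgebra M (F n)"
    and F_Suc: "\<And>n. sets (F n) \<subseteq> sets (F (Suc n))"
    and D_measurable: "\<And>n. D n \<in> borel_measurable (F (Suc n))"
    and D_bound: "\<And>n \<omega>. \<omega> \<in> space M \<Longrightarrow> \<bar>D n \<omega>\<bar> \<le> C"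
    and V_measurable: "\<And>n. V n \<in> borel_measurable (F n)"
    and V_bound: "\<And>n \<omega>. \<omega> \<in> space M \<Longrightarrow> 0 \<le> V n \<omega> \<and> V n \<omega> \<le> C\<^sup>2"
    and D_mean: "\<And>n. AE \<omega> in M. real_cond_exp M (F n) (D n) \<omega> = 0"
    and D_variance: "\<And>n. AE \<omega> in M. real_cond_exp M (F n) (\<lambda>\<omega>. (D n \<omega>)\<^sup>2) \<omega> = V n \<omega>"
begin

lemma F_mono: "m \<le> n \<Longrightarrow> sets (F m) \<subseteq> sets (F n)"
  using F_Suc by (rule lift_Suc_mono_le)

lemma space_F [simp]: "space (F n) = space M"
  using subalg[of n] by (simp add: subalgebra_def)

lemma measurable_F_mono: "m \<le> n \<Longrightarrow> f \<in> borel_measurable (F m) \<Longrightarrow> f \<in> borel_measurable (F n)"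
  using F_mono[of m n] by (auto simp: measurable_def)

lemma measurable_F_M: "f \<in> borel_measurable (F m) \<Longrightarrow> f \<in> borel_measurable M"
  by (rule measurable_from_subalg[OF subalg])

lemma finite_measure_subalgebra_F: "finite_measure_subalgebra M (F n)"
  by unfold_locales (rule subalg)

lemma D_measurable_M [measurable]: "D n \<in> borel_measurable M"
  using D_measurable measurable_F_M by blast

lemma V_measurable_M [measurable]: "V n \<in> borel_measurable M"
  using V_measurable measurable_F_M by blast

lemma C_nonneg: "0 \<le> C"
proof -
  obtain \<omega> where "\<omega> \<in> space M" using not_empty by blast
  from D_bound[OF this, of 0] show ?thesis by linarith
qed

text \<open>Lindeberg's replacement of one increment by a Gaussian one with variance
  \<open>U\<close>. In the expansion to second order the linear term integrates to 0 because
  \<open>D n\<close> is conditionally centred, and \<open>(D n \<omega>)\<^sup>2\<close> may be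
  exchanged for \<open>V n \<omega>\<close>. What remains is the mismatch of \<open>V n\<close> and
  \<open>U\<close> and two third-order remainders.\<close>

lemma one_step:
  fixes G :: "'a \<Rightarrow> complex"
  assumes [measurable]: "G \<in> borel_measurable (F n)" "U \<in> borel_measurable (F n)"
    and G: "\<And>\<omega>. \<omega> \<in> space M \<Longrightarrow> cmod (G \<omega>) \<le> 1"
    and U: "\<And>\<omega>. \<omega> \<in> space M \<Longrightarrow> 0 \<le> U \<omega> \<and> U \<omega> \<le> C\<^sup>2"
  shows "cmod (\<integral>\<omega>. G \<omega> * (iexp (\<theta> * D n \<omega>) - exp (- (\<theta>\<^sup>2 * U \<omega> / 2))) \<partial>M)
    \<le> \<theta>\<^sup>2 / 2 * (\<integral>\<omega>. \<bar>V n \<omega> - U \<omega>\<bar> \<partial>M) + 2 * (\<bar>\<theta>\<bar> * C) ^ 3"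
proof -
  interpret F: finite_measure_subalgebra M "F n"
    by (rule finite_measure_subalgebra_F)
  have [measurable]: "G \<in> borel_measurable M" "U \<in> borel_measurable M"
    using assms measurable_F_M by blast+
  have [measurable]: "V n \<in> borel_measurable (F n)" by (rule V_measurable)
  have D2: "(D n \<omega>)\<^sup>2 \<le> C\<^sup>2" if "\<omega> \<in> space M" for \<omega>
    using D_bound[OF that, of n] C_nonneg by (simp add: abs_le_square_iff[symmetric])
  have iD: "integrable M (D n)"
    by (rule integrable_bounded[where B = C]) (auto simp: D_bound)
  have iD2: "integrable M (\<lambda>\<omega>. (D n \<omega>)\<^sup>2)"
    by (rule integrable_bounded[where B = "C\<^sup>2"]) (auto simp: D2)
  have iV: "integrable M (V n)"
    by (rule integrable_bounded[where B = "C\<^sup>2"]) (auto simp: V_bound)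
  have DV: "AE \<omega> in M. real_cond_exp M (F n) (\<lambda>\<omega>. (D n \<omega>)\<^sup>2 - V n \<omega>) \<omega> = 0"
    using F.real_cond_exp_diff[OF iD2 iV] F.real_cond_exp_F_meas[OF iV V_measurable] D_variance[of n]
    by eventually_elim simp
  have z1: "(\<integral>\<omega>. G \<omega> * of_real (D n \<omega>) \<partial>M) = 0"
    by (rule F.integral_mult_cond_exp_zero[where B = 1]) (auto intro: G iD D_mean)
  have z2: "(\<integral>\<omega>. G \<omega> * of_real ((D n \<omega>)\<^sup>2 - V n \<omega>) \<partial>M) = 0"
    by (rule F.integral_mult_cond_exp_zero[where B = 1]) (auto intro: G iD2 iV DV)
  \<comment> \<open>\<open>R\<close> collects the third-order remainders of the two expansions,
    \<open>S\<close> the second-order mismatch between \<open>V n\<close> and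
    \<open>U\<close>.\<close>
  define R where "R \<omega> = G \<omega> * (iexp (\<theta> * D n \<omega>) - (1 + \<i> * (\<theta> * D n \<omega>) - (\<theta> * D n \<omega>)\<^sup>2 / 2))
     + G \<omega> * of_real (1 - \<theta>\<^sup>2 * U \<omega> / 2 - exp (- (\<theta>\<^sup>2 * U \<omega> / 2)))" for \<omega>
  define S where "S \<omega> = \<theta>\<^sup>2 / 2 * (G \<omega> * of_real (V n \<omega> - U \<omega>))" for \<omega>
  have [measurable]: "R \<in> borel_measurable M" "S \<in> borel_measurable M"
    unfolding R_def S_def by measurable
  have R_bound: "cmod (R \<omega>) \<le> 2 * (\<bar>\<theta>\<bar> * C) ^ 3" if w: "\<omega> \<in> space M" for \<omega>
  proof -
    have tD: "\<bar>\<theta> * D n \<omega>\<bar> \<le> \<bar>\<theta>\<bar> * C"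
      using D_bound[OF w, of n] by (simp add: abs_mult mult_left_mono)
    have "cmod (iexp (\<theta> * D n \<omega>) - (1 + \<i> * (\<theta> * D n \<omega>) - (\<theta> * D n \<omega>)\<^sup>2 / 2)) \<le> \<bar>\<theta> * D n \<omega>\<bar> ^ 3 / 6"
      using iexp_taylor2_bound[of "\<theta> * D n \<omega>"] by simp
    also have "\<dots> \<le> (\<bar>\<theta>\<bar> * C) ^ 3"
    proof -
      have "\<bar>\<theta> * D n \<omega>\<bar> ^ 3 \<le> (\<bar>\<theta>\<bar> * C) ^ 3"
        using tD by (intro power_mono) auto
      moreover have "0 \<le> \<bar>\<theta> * D n \<omega>\<bar> ^ 3" by simp
      ultimately show ?thesis by linarith
    qed
    finally have 1: "cmod (iexp (\<theta> * D n \<omega>) - (1 + \<i> * (\<theta> * D n \<omega>) - (\<theta> * D n \<omega>)\<^sup>2 / 2)) \<le> (\<bar>\<theta>\<bar> * C) ^ 3" .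
    \<comment> \<open>Chosen so that y^2 is minus the exponent of the Gaussian factor, as
      \<open>exp_taylor1_bound\<close> requires.\<close>
    define y where "y = \<bar>\<theta>\<bar> * sqrt (U \<omega> / 2)"
    have y2: "y\<^sup>2 = \<theta>\<^sup>2 * U \<omega> / 2" and y0: "0 \<le> y"
      using U[OF w] by (auto simp: y_def power_mult_distrib)
    have "sqrt (U \<omega> / 2) \<le> C"
      using U[OF w] C_nonneg by (intro real_le_lsqrt) auto
    then have "y \<le> \<bar>\<theta>\<bar> * C"
      by (simp add: y_def mult_left_mono)
    then have 2: "\<bar>1 - \<theta>\<^sup>2 * U \<omega> / 2 - exp (- (\<theta>\<^sup>2 * U \<omega> / 2))\<bar> \<le> (\<bar>\<theta>\<bar> * C) ^ 3"
      using order_trans[OF exp_taylor1_bound[OF y0] power_mono[of y "\<bar>\<theta>\<bar> * C" 3]] y0 by (simp add: y2)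
    have "cmod (R \<omega>) \<le> 1 * (\<bar>\<theta>\<bar> * C) ^ 3 + 1 * (\<bar>\<theta>\<bar> * C) ^ 3"
      unfolding R_def
      by (intro norm_triangle_mono)
         (auto simp only: norm_mult norm_of_real intro!: mult_mono G w 1 2, auto)
    then show ?thesis by simp
  qed
  have iR: "integrable M R"
    by (rule integrable_bounded[OF _ R_bound]) auto
  have S_le: "cmod (S \<omega>) \<le> \<theta>\<^sup>2 / 2 * \<bar>V n \<omega> - U \<omega>\<bar>" if "\<omega> \<in> space M" for \<omega>
    using mult_right_mono[OF G[OF that], of "\<bar>V n \<omega> - U \<omega>\<bar>"]
    by (auto simp: S_def norm_mult norm_power norm_divide simp flip: of_real_diff intro!: mult_left_mono)
  have VU: "\<bar>V n \<omega> - U \<omega>\<bar> \<le> C\<^sup>2" if "\<omega> \<in> space M" for \<omega>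
    using V_bound[OF that, of n] U[OF that] by auto
  have iVU: "integrable M (\<lambda>\<omega>. \<bar>V n \<omega> - U \<omega>\<bar>)"
    by (rule integrable_bounded[where B = "C\<^sup>2"]) (auto simp: VU)
  have iS: "integrable M S"
    by (rule Bochner_Integration.integrable_bound[where f = "\<lambda>\<omega>. \<theta>\<^sup>2 / 2 * \<bar>V n \<omega> - U \<omega>\<bar>"])
       (use iVU S_le in \<open>auto intro!: AE_I2\<close>)
  have iGD: "integrable M (\<lambda>\<omega>. G \<omega> * of_real (D n \<omega>))"
    by (intro integrable_bounded[where B = "1 * C"])
       (simp_all only: norm_mult norm_of_real, measurable, intro mult_mono, auto simp: G D_bound)
  have iGV: "integrable M (\<lambda>\<omega>. G \<omega> * of_real ((D n \<omega>)\<^sup>2 - V n \<omega>))"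
  proof (intro integrable_bounded[where B = "1 * (C\<^sup>2)"])
    fix \<omega> assume w: "\<omega> \<in> space M"
    have "\<bar>(D n \<omega>)\<^sup>2 - V n \<omega>\<bar> \<le> C\<^sup>2"
      using V_bound[OF w, of n] D2[OF w] zero_le_power2[of "D n \<omega>"] by linarith
    then show "cmod (G \<omega> * of_real ((D n \<omega>)\<^sup>2 - V n \<omega>)) \<le> 1 * C\<^sup>2"
      unfolding norm_mult norm_of_real using G[OF w] by (intro mult_mono) auto
  qed auto
  \<comment> \<open>Adding and subtracting \<open>V n\<close> in the quadratic term produces the
    integrals of \<open>z1\<close> and \<open>z2\<close>, which vanish.\<close>
  have "(\<integral>\<omega>. G \<omega> * (iexp (\<theta> * D n \<omega>) - exp (- (\<theta>\<^sup>2 * U \<omega> / 2))) \<partial>M) =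
     (\<integral>\<omega>. R \<omega> + \<i> * \<theta> * (G \<omega> * of_real (D n \<omega>))
        - \<theta>\<^sup>2 / 2 * (G \<omega> * of_real ((D n \<omega>)\<^sup>2 - V n \<omega>)) - S \<omega> \<partial>M)"
    by (intro Bochner_Integration.integral_cong)
       (auto simp: R_def S_def algebra_simps add_divide_distrib diff_divide_distrib power2_eq_square)
  also have "\<dots> = (\<integral>\<omega>. R \<omega> \<partial>M) - (\<integral>\<omega>. S \<omega> \<partial>M)"
    using iR iS iGD iGV z1 z2 by simp
  also have "cmod \<dots> \<le> 2 * (\<bar>\<theta>\<bar> * C) ^ 3 + \<theta>\<^sup>2 / 2 * (\<integral>\<omega>. \<bar>V n \<omega> - U \<omega>\<bar> \<partial>M)"
  proof (rule norm_triangle_le_diff, rule add_mono)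
    show "cmod (\<integral>\<omega>. R \<omega> \<partial>M) \<le> 2 * (\<bar>\<theta>\<bar> * C) ^ 3"
      using C_nonneg by (intro norm_integral_le_bound R_bound) auto
    have "cmod (\<integral>\<omega>. S \<omega> \<partial>M) \<le> (\<integral>\<omega>. cmod (S \<omega>) \<partial>M)"
      by (rule integral_norm_bound)
    also have "\<dots> \<le> (\<integral>\<omega>. \<theta>\<^sup>2 / 2 * \<bar>V n \<omega> - U \<omega>\<bar> \<partial>M)"
      using iS iVU S_le by (intro integral_mono) auto
    finally show "cmod (\<integral>\<omega>. S \<omega> \<partial>M) \<le> \<theta>\<^sup>2 / 2 * (\<integral>\<omega>. \<bar>V n \<omega> - U \<omega>\<bar> \<partial>M)"
      using iVU by simp
  qed
  finally show ?thesis by simp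
qed

text \<open>The last increment is replaced first. Its Gaussian factor is a function of
  \<open>U\<close>, hence known at time \<open>m\<close>, and is absorbed into the test factor. This
  is why the induction runs over all \<open>G\<close> and why the variance is frozen at time
  \<open>m\<close>.\<close>

lemma telescope:
  fixes G :: "'a \<Rightarrow> complex"
  assumes U_meas: "U \<in> borel_measurable (F m)"
    and U: "\<And>\<omega>. \<omega> \<in> space M \<Longrightarrow> 0 \<le> U \<omega> \<and> U \<omega> \<le> C\<^sup>2"
  assumes "m \<le> K" "G \<in> borel_measurable (F m)" "\<And>\<omega>. \<omega> \<in> space M \<Longrightarrow> cmod (G \<omega>) \<le> 1"
  shows "cmod ((\<integral>\<omega>. G \<omega> * iexp (u * (\<Sum>k=m..<K. b k * D k \<omega>)) \<partial>M)
      - (\<integral>\<omega>. G \<omega> * exp (- (u\<^sup>2 * (\<Sum>k=m..<K. (b k)\<^sup>2) * U \<omega> / 2)) \<partial>M))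
    \<le> (\<Sum>k=m..<K. (u * b k)\<^sup>2 / 2 * (\<integral>\<omega>. \<bar>V k \<omega> - U \<omega>\<bar> \<partial>M) + 2 * (\<bar>u * b k\<bar> * C) ^ 3)"
  using assms(3-)
proof (induction K arbitrary: G rule: dec_induct)
  case (step K)
  have [measurable]: "G \<in> borel_measurable (F m)" "U \<in> borel_measurable (F m)"
    using step U_meas by auto
  have [measurable]: "G \<in> borel_measurable M" "U \<in> borel_measurable M"
    using step U_meas measurable_F_M by blast+
  have [measurable]: "G \<in> borel_measurable (F K)" "U \<in> borel_measurable (F K)"
    using step.prems(1) U_meas measurable_F_mono[OF step.hyps(1)] by blast+
  have D_meas: "D k \<in> borel_measurable (F K)" if "k < K" for k
    using measurable_F_mono[OF _ D_measurable, of k K] that by simp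
  define S where "S \<omega> = (\<Sum>k=m..<K. b k * D k \<omega>)" for \<omega>
  have [measurable]: "S \<in> borel_measurable (F K)"
    unfolding S_def by (intro borel_measurable_sum borel_measurable_times borel_measurable_const D_meas) auto
  have [measurable]: "S \<in> borel_measurable M" by (rule measurable_F_M) measurable
  define Q where "Q = (\<Sum>k=m..<K. (b k)\<^sup>2)"
  \<comment> \<open>The Gaussian factor of increment \<open>K\<close>. It is measurable at time
    \<open>m\<close> and of modulus at most 1, so \<open>G \<omega> * E \<omega>\<close> is again
    admissible in the induction hypothesis.\<close>
  define E where "E \<omega> = complex_of_real (exp (- (u\<^sup>2 * (b K)\<^sup>2 * U \<omega> / 2)))" for \<omega>
  have [measurable]: "E \<in> borel_measurable M" "E \<in> borel_measurable (F m)"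
    unfolding E_def by measurable
  have E_le: "cmod (E \<omega>) \<le> 1" if "\<omega> \<in> space M" for \<omega>
    using U[OF that] by (simp add: E_def)
  have GE: "cmod (G \<omega> * E \<omega>) \<le> 1" if "\<omega> \<in> space M" for \<omega>
    using mult_mono[OF step.prems(2)[OF that] E_le[OF that]] by (simp add: norm_mult)
  have Q0: "0 \<le> Q" by (simp add: Q_def sum_nonneg)
  let ?e = "\<lambda>k. (u * b k)\<^sup>2 / 2 * (\<integral>\<omega>. \<bar>V k \<omega> - U \<omega>\<bar> \<partial>M) + 2 * (\<bar>u * b k\<bar> * C) ^ 3"
  have IH: "cmod ((\<integral>\<omega>. (G \<omega> * E \<omega>) * iexp (u * S \<omega>) \<partial>M)
      - (\<integral>\<omega>. (G \<omega> * E \<omega>) * exp (- (u\<^sup>2 * Q * U \<omega> / 2)) \<partial>M)) \<le> (\<Sum>k=m..<K. ?e k)"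
    using step.IH[of "\<lambda>\<omega>. G \<omega> * E \<omega>"] GE by (simp add: S_def Q_def)
  have one: "cmod (\<integral>\<omega>. (G \<omega> * iexp (u * S \<omega>)) *
      (iexp (u * b K * D K \<omega>) - exp (- ((u * b K)\<^sup>2 * U \<omega> / 2))) \<partial>M) \<le> ?e K"
    by (rule one_step) (use step.prems U in \<open>auto simp: norm_mult\<close>)
  have i1: "integrable M (\<lambda>\<omega>. G \<omega> * iexp (u * (S \<omega> + b K * D K \<omega>)))"
    by (rule integrable_bounded[where B = 1]) (use step.prems in \<open>auto simp: norm_mult\<close>)
  have i2: "integrable M (\<lambda>\<omega>. (G \<omega> * E \<omega>) * iexp (u * S \<omega>))"
    by (rule integrable_bounded[where B = 1]) (use GE in \<open>auto simp: norm_mult\<close>)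
  \<comment> \<open>The inserted intermediate integral has a Gaussian last increment and the
    original earlier ones.\<close>
  have "(\<integral>\<omega>. G \<omega> * iexp (u * (S \<omega> + b K * D K \<omega>)) \<partial>M)
      - (\<integral>\<omega>. G \<omega> * exp (- (u\<^sup>2 * (Q + (b K)\<^sup>2) * U \<omega> / 2)) \<partial>M)
    = (\<integral>\<omega>. (G \<omega> * iexp (u * S \<omega>)) *
        (iexp (u * b K * D K \<omega>) - exp (- ((u * b K)\<^sup>2 * U \<omega> / 2))) \<partial>M)
      + ((\<integral>\<omega>. (G \<omega> * E \<omega>) * iexp (u * S \<omega>) \<partial>M)
        - (\<integral>\<omega>. (G \<omega> * E \<omega>) * exp (- (u\<^sup>2 * Q * U \<omega> / 2)) \<partial>M))"
  proof -
    have "(\<integral>\<omega>. (G \<omega> * iexp (u * S \<omega>)) *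
        (iexp (u * b K * D K \<omega>) - exp (- ((u * b K)\<^sup>2 * U \<omega> / 2))) \<partial>M)
      = (\<integral>\<omega>. G \<omega> * iexp (u * (S \<omega> + b K * D K \<omega>)) - (G \<omega> * E \<omega>) * iexp (u * S \<omega>) \<partial>M)"
      by (intro Bochner_Integration.integral_cong)
         (auto simp: E_def algebra_simps exp_add power_mult_distrib simp del: of_real_exp)
    also have "\<dots> = (\<integral>\<omega>. G \<omega> * iexp (u * (S \<omega> + b K * D K \<omega>)) \<partial>M)
        - (\<integral>\<omega>. (G \<omega> * E \<omega>) * iexp (u * S \<omega>) \<partial>M)"
      using i1 i2 by (rule Bochner_Integration.integral_diff)
    moreover have "exp (- (u\<^sup>2 * (Q + (b K)\<^sup>2) * x / 2))
        = exp (- (u\<^sup>2 * (b K)\<^sup>2 * x / 2)) * exp (- (u\<^sup>2 * Q * x / 2))" for x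
      by (simp add: field_simps flip: exp_add)
    then have "(\<integral>\<omega>. G \<omega> * exp (- (u\<^sup>2 * (Q + (b K)\<^sup>2) * U \<omega> / 2)) \<partial>M)
        = (\<integral>\<omega>. (G \<omega> * E \<omega>) * exp (- (u\<^sup>2 * Q * U \<omega> / 2)) \<partial>M)"
      by (simp add: E_def mult.assoc)
    ultimately show ?thesis by simp
  qed
  then show ?case
    using norm_triangle_mono[OF one IH] step.hyps
    by (simp add: S_def Q_def add.commute)
qed simp

end

section \<open>Convergence on events of the past\<close>

lemma norm_iexp_diff_le: "cmod (iexp x - iexp y) \<le> \<bar>x - y\<bar>"
proof -
  have "iexp x - iexp y = iexp y * (iexp (x - y) - 1)"
    by (simp add: algebra_simps flip: exp_add)
  then show ?thesis
    using iexp_approx1[of "x - y" 0] by (simp add: norm_mult)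
qed

lemma abs_exp_minus_diff_le:
  fixes x y :: real
  assumes "0 \<le> x" "0 \<le> y"
  shows "\<bar>exp (- x) - exp (- y)\<bar> \<le> \<bar>x - y\<bar>"
proof -
  have *: "\<bar>exp (- x) - exp (- y)\<bar> \<le> \<bar>x - y\<bar>" if "0 \<le> x" "x \<le> y" for x y :: real
  proof -
    have "exp (- y) = exp (- x) * exp (- (y - x))"
      by (simp flip: exp_add)
    then have "exp (- x) - exp (- y) = exp (- x) * (1 - exp (- (y - x)))"
      by (simp add: algebra_simps)
    also have "\<dots> \<le> 1 * (y - x)"
      using that exp_ge_add_one_self[of "x - y"] by (intro mult_mono) (auto simp: algebra_simps)
    finally show ?thesis using that by auto
  qed
  show ?thesis
    using *[of x y] *[of y x] assms by (cases "x \<le> y") auto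
qed

text \<open>The epsilon form of a double limit: the bound \<open>h\<close> may depend on
  \<open>e\<close> through an auxiliary index and only has to have a limit below \<open>e\<close>
  for that choice.\<close>

lemma tendsto_zero_if_arbitrarily_small_bounds:
  fixes f :: "nat \<Rightarrow> 'b::real_normed_vector"
  assumes "\<And>e::real. 0 < e \<Longrightarrow> \<exists>h l. (\<forall>\<^sub>F n in sequentially. norm (f n) \<le> h n) \<and> h \<longlonglongrightarrow> l \<and> l < e"
  shows "f \<longlonglongrightarrow> 0"
proof (rule tendstoI)
  fix e :: real
  assume "0 < e"
  from assms[OF this] obtain h l
    where *: "\<forall>\<^sub>F n in sequentially. norm (f n) \<le> h n" "h \<longlonglongrightarrow> l" "l < e" by blast
  from order_tendstoD(2)[OF *(2,3)] *(1) show "\<forall>\<^sub>F n in sequentially. dist (f n) 0 < e"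
    by eventually_elim auto
qed

text \<open>An array with infinite rows: in the application the tail of a row carries the distance
  of a martingale to its limit, so \<open>Y n\<close> is only almost surely the sum of its row. The
  vanishing sums of cubes are a Lyapunov condition.\<close>

locale weighted_martingale_series = bounded_martingale_differences +
  fixes b :: "nat \<Rightarrow> nat \<Rightarrow> real" and s :: real and Y :: "nat \<Rightarrow> 'a \<Rightarrow> real" and V_lim :: "'a \<Rightarrow> real"
  assumes summable_square: "\<And>n. summable (\<lambda>k. (b n k)\<^sup>2)"
    and summable_cube: "\<And>n. summable (\<lambda>k. \<bar>b n k\<bar> ^ 3)"
    and square_limit: "(\<lambda>n. \<Sum>k. (b n k)\<^sup>2) \<longlonglongrightarrow> s"
    and cube_limit: "(\<lambda>n. \<Sum>k. \<bar>b n k\<bar> ^ 3) \<longlonglongrightarrow> 0"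
    and Y_measurable [measurable]: "\<And>n. Y n \<in> borel_measurable M"
    and Y_sums: "\<And>n. AE \<omega> in M. (\<lambda>k. b n k * D k \<omega>) sums Y n \<omega>"
    and Vinf_measurable [measurable]: "V_lim \<in> borel_measurable M"
    and V_tendsto: "AE \<omega> in M. (\<lambda>n. V n \<omega>) \<longlonglongrightarrow> V_lim \<omega>"
begin

lemma s_nonneg: "0 \<le> s"
  by (rule LIMSEQ_le_const[OF square_limit]) (intro exI allI impI suminf_nonneg summable_square zero_le_power2)

lemma AE_Vinf_bound: "AE \<omega> in M. 0 \<le> V_lim \<omega> \<and> V_lim \<omega> \<le> C\<^sup>2"
  using V_tendsto AE_space
proof eventually_elim
  case (elim \<omega>)
  then show ?case
    using V_bound[of \<omega>] by (auto intro: LIMSEQ_le_const LIMSEQ_le_const2)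
qed

text \<open>A single entry is dominated by the cube root of the sum of cubes of its row. Hence any
  fixed number of initial increments is asymptotically negligible.\<close>

lemma weight_tendsto_zero: "(\<lambda>n. b n k) \<longlonglongrightarrow> 0"
proof -
  have "(\<lambda>n. \<bar>b n k\<bar> ^ 3) \<longlonglongrightarrow> 0"
  proof (rule tendsto_sandwich[OF _ _ tendsto_const cube_limit])
    show "\<forall>\<^sub>F n in sequentially. \<bar>b n k\<bar> ^ 3 \<le> (\<Sum>k. \<bar>b n k\<bar> ^ 3)"
      using sum_le_suminf[OF summable_cube, of "{k}"] by (intro always_eventually) auto
  qed auto
  then have "(\<lambda>n. root 3 (\<bar>b n k\<bar> ^ 3)) \<longlonglongrightarrow> root 3 0"
    by (rule tendsto_real_root)
  then show ?thesis
    by (simp add: real_root_power_cancel tendsto_rabs_zero_iff)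
qed

lemma V_tendsto_L1: "(\<lambda>n. \<integral>\<omega>. \<bar>V n \<omega> - V_lim \<omega>\<bar> \<partial>M) \<longlonglongrightarrow> 0"
proof -
  have "(\<lambda>n. \<integral>\<omega>. \<bar>V n \<omega> - V_lim \<omega>\<bar> \<partial>M) \<longlonglongrightarrow> (\<integral>\<omega>. 0 \<partial>M)"
  proof (rule integral_dominated_convergence[where w = "\<lambda>_. C\<^sup>2"])
    show "AE \<omega> in M. (\<lambda>n. \<bar>V n \<omega> - V_lim \<omega>\<bar>) \<longlonglongrightarrow> 0"
      using V_tendsto by eventually_elim (simp add: tendsto_rabs_zero LIM_zero)
    show "AE \<omega> in M. norm \<bar>V n \<omega> - V_lim \<omega>\<bar> \<le> C\<^sup>2" for n
      using AE_Vinf_bound AE_space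
    proof eventually_elim
      case (elim \<omega>)
      then show ?case using V_bound[of \<omega> n] by auto
    qed
  qed auto
  then show ?thesis by simp
qed

lemma integrable_V_diff: "integrable M (\<lambda>\<omega>. \<bar>V n \<omega> - V_lim \<omega>\<bar>)"
proof (rule integrable_const_bound[where B = "C\<^sup>2"])
  show "AE \<omega> in M. norm \<bar>V n \<omega> - V_lim \<omega>\<bar> \<le> C\<^sup>2"
    using AE_Vinf_bound AE_space
  proof eventually_elim
    case (elim \<omega>)
    then show ?case using V_bound[of \<omega> n] by auto
  qed
qed auto

text \<open>The characteristic function at \<open>u\<close> of the centred normal law with variance
  \<open>s * V_lim \<omega>\<close>.\<close>

abbreviation gauss :: "real \<Rightarrow> 'a \<Rightarrow> complex" where
  "gauss u \<omega> \<equiv> complex_of_real (exp (- (u\<^sup>2 * s * V_lim \<omega> / 2)))"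

lemma AE_norm_gauss_le: "AE \<omega> in M. cmod (gauss u \<omega>) \<le> 1"
  using AE_Vinf_bound by eventually_elim (use s_nonneg in auto)

text \<open>\<open>telescope\<close> with \<open>K\<close> tending to infinity: both integrands have
  modulus at most 1, so dominated convergence applies, and the partial error sums are bounded by the
  full series.\<close>

lemma limit_comparison:
  assumes G_meas: "G \<in> borel_measurable (F m)"
    and G: "\<And>\<omega>. \<omega> \<in> space M \<Longrightarrow> cmod (G \<omega>) \<le> 1"
    and \<delta>: "\<And>k. m \<le> k \<Longrightarrow> (\<integral>\<omega>. \<bar>V k \<omega> - V m \<omega>\<bar> \<partial>M) \<le> \<delta>"
  shows "cmod ((\<integral>\<omega>. G \<omega> * iexp (u * (Y n \<omega> - (\<Sum>k<m. b n k * D k \<omega>))) \<partial>M)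
      - (\<integral>\<omega>. G \<omega> * exp (- (u\<^sup>2 * ((\<Sum>k. (b n k)\<^sup>2) - (\<Sum>k<m. (b n k)\<^sup>2)) * V m \<omega> / 2)) \<partial>M))
    \<le> u\<^sup>2 / 2 * (\<Sum>k. (b n k)\<^sup>2) * \<delta> + 2 * (\<bar>u\<bar> * C) ^ 3 * (\<Sum>k. \<bar>b n k\<bar> ^ 3)"
    (is "cmod (?A - ?B) \<le> ?R")
proof (rule LIMSEQ_le_const2)
  have [measurable]: "G \<in> borel_measurable M"
    using assms measurable_F_M by blast
  have tail: "(\<Sum>k=m..<K. f k) = (\<Sum>k<K. f k) - (\<Sum>k<m. f k)" if "m \<le> K" for K and f :: "nat \<Rightarrow> real"
    using that by (simp add: sum_diff_nat_ivl lessThan_atLeast0)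
  let ?a = "\<lambda>K. \<integral>\<omega>. G \<omega> * iexp (u * (\<Sum>k=m..<K. b n k * D k \<omega>)) \<partial>M"
  let ?b = "\<lambda>K. \<integral>\<omega>. G \<omega> * exp (- (u\<^sup>2 * (\<Sum>k=m..<K. (b n k)\<^sup>2) * V m \<omega> / 2)) \<partial>M"
  have "?a \<longlonglongrightarrow> ?A"
  proof (rule integral_dominated_convergence[where w = "\<lambda>_. 1"])
    show "AE \<omega> in M. (\<lambda>K. G \<omega> * iexp (u * (\<Sum>k=m..<K. b n k * D k \<omega>)))
        \<longlonglongrightarrow> G \<omega> * iexp (u * (Y n \<omega> - (\<Sum>k<m. b n k * D k \<omega>)))"
      using Y_sums[of n]
    proof eventually_elim
      case (elim \<omega>)
      have "(\<lambda>K. (\<Sum>k<K. b n k * D k \<omega>) - (\<Sum>k<m. b n k * D k \<omega>))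
          \<longlonglongrightarrow> Y n \<omega> - (\<Sum>k<m. b n k * D k \<omega>)"
        using elim by (intro tendsto_intros) (simp add: sums_def)
      then have "(\<lambda>K. \<Sum>k=m..<K. b n k * D k \<omega>) \<longlonglongrightarrow> Y n \<omega> - (\<Sum>k<m. b n k * D k \<omega>)"
        by (rule Lim_transform_eventually)
           (use eventually_ge_at_top[of m] in \<open>eventually_elim, simp add: tail\<close>)
      then show ?case
        by (intro tendsto_intros)
    qed
    show "AE \<omega> in M. cmod (G \<omega> * iexp (u * (\<Sum>k=m..<K. b n k * D k \<omega>))) \<le> 1" for K
      using G by (intro AE_I2) (simp add: norm_mult)
  qed auto
  moreover have "?b \<longlonglongrightarrow> ?B"
  proof (rule integral_dominated_convergence[where w = "\<lambda>_. 1"])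
    have "(\<lambda>K. (\<Sum>k<K. (b n k)\<^sup>2) - (\<Sum>k<m. (b n k)\<^sup>2)) \<longlonglongrightarrow> (\<Sum>k. (b n k)\<^sup>2) - (\<Sum>k<m. (b n k)\<^sup>2)"
      using summable_LIMSEQ[OF summable_square[of n]] by (intro tendsto_intros)
    then have lim: "(\<lambda>K. \<Sum>k=m..<K. (b n k)\<^sup>2) \<longlonglongrightarrow> (\<Sum>k. (b n k)\<^sup>2) - (\<Sum>k<m. (b n k)\<^sup>2)"
      by (rule Lim_transform_eventually)
         (use eventually_ge_at_top[of m] in \<open>eventually_elim, simp add: tail\<close>)
    show "AE \<omega> in M. (\<lambda>K. G \<omega> * exp (- (u\<^sup>2 * (\<Sum>k=m..<K. (b n k)\<^sup>2) * V m \<omega> / 2)))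
        \<longlonglongrightarrow> G \<omega> * exp (- (u\<^sup>2 * ((\<Sum>k. (b n k)\<^sup>2) - (\<Sum>k<m. (b n k)\<^sup>2)) * V m \<omega> / 2))"
      by (intro AE_I2 tendsto_intros lim) auto
    show "AE \<omega> in M. cmod (G \<omega> * exp (- (u\<^sup>2 * (\<Sum>k=m..<K. (b n k)\<^sup>2) * V m \<omega> / 2))) \<le> 1" for K
    proof (rule AE_I2)
      fix \<omega> assume w: "\<omega> \<in> space M"
      have "exp (- (u\<^sup>2 * (\<Sum>k=m..<K. (b n k)\<^sup>2) * V m \<omega> / 2)) \<le> 1"
        using V_bound[OF w] by (simp add: sum_nonneg)
      then show "cmod (G \<omega> * exp (- (u\<^sup>2 * (\<Sum>k=m..<K. (b n k)\<^sup>2) * V m \<omega> / 2))) \<le> 1"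
        using mult_mono[OF G[OF w]] by (fastforce simp: norm_mult)
    qed
  qed auto
  ultimately show "(\<lambda>K. cmod (?a K - ?b K)) \<longlonglongrightarrow> cmod (?A - ?B)"
    by (intro tendsto_intros)
  have "cmod (?a K - ?b K) \<le> ?R" if "m \<le> K" for K
  proof -
    have "cmod (?a K - ?b K) \<le> (\<Sum>k=m..<K. (u * b n k)\<^sup>2 / 2 * (\<integral>\<omega>. \<bar>V k \<omega> - V m \<omega>\<bar> \<partial>M)
        + 2 * (\<bar>u * b n k\<bar> * C) ^ 3)"
      by (rule telescope[OF V_measurable V_bound that G_meas G])
    also have "\<dots> \<le> (\<Sum>k=m..<K. (u * b n k)\<^sup>2 / 2 * \<delta> + 2 * (\<bar>u * b n k\<bar> * C) ^ 3)"
      by (intro sum_mono add_right_mono mult_left_mono \<delta>) auto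
    also have "\<dots> = u\<^sup>2 / 2 * (\<Sum>k=m..<K. (b n k)\<^sup>2) * \<delta> + 2 * (\<bar>u\<bar> * C) ^ 3 * (\<Sum>k=m..<K. \<bar>b n k\<bar> ^ 3)"
      by (simp add: sum.distrib sum_distrib_left sum_distrib_right sum_divide_distrib
            power_mult_distrib abs_mult mult_ac)
    also have "\<dots> \<le> ?R"
    proof -
      \<comment> \<open>The hypothesis on \<delta> at k = m shows that \<delta> is nonnegative, so
        that extending the sum of squares to the whole series only increases the bound.\<close>
      have "0 \<le> (\<integral>\<omega>. \<bar>V m \<omega> - V m \<omega>\<bar> \<partial>M)" by simp
      then have "0 \<le> \<delta>" using \<delta>[of m] by simp
      then show ?thesis
        by (intro add_mono mult_mono mult_nonneg_nonneg sum_le_suminf summable_square summable_cube)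
           (auto simp: C_nonneg sum_nonneg intro!: suminf_nonneg summable_square)
    qed
    finally show ?thesis .
  qed
  then show "\<exists>K0. \<forall>K\<ge>K0. cmod (?a K - ?b K) \<le> ?R" by blast
qed

text \<open>Three comparisons: the first \<open>p\<close> increments are dropped, the others are
  replaced by Gaussian ones with the variance frozen at time \<open>p\<close>, and then this
  variance and the row sums of squares are replaced by their limits. The index \<open>p\<close> is
  fixed first; n tends to infinity afterwards.\<close>

lemma convergence_on_past:
  assumes A: "A \<in> sets (F m)"
  shows "(\<lambda>n. (\<integral>\<omega>. indicator A \<omega> * iexp (u * Y n \<omega>) \<partial>M)
      - (\<integral>\<omega>. indicator A \<omega> * gauss u \<omega> \<partial>M)) \<longlonglongrightarrow> 0" (is "(\<lambda>n. ?I n - ?J) \<longlonglongrightarrow> 0")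
proof (rule tendsto_zero_if_arbitrarily_small_bounds)
  fix e :: real
  assume e: "0 < e"
  \<comment> \<open>The two errors that survive the limit add up to 3/2 times
    \<open>u\<^sup>2 * s * d\<close>, which is below \<open>e\<close>; the summand 1 keeps the
    denominator positive when \<open>u\<close> or \<open>s\<close> is 0.\<close>
  define d where "d = e / (2 * u\<^sup>2 * s + 1)"
  have den: "0 < 2 * u\<^sup>2 * s + 1"
    using s_nonneg by (intro add_nonneg_pos) auto
  have d: "0 < d" "u\<^sup>2 / 2 * s * (2 * d) + u\<^sup>2 / 2 * (s * d) < e"
  proof -
    show "0 < d" using e den by (simp add: d_def)
    have "u\<^sup>2 / 2 * s * (2 * d) + u\<^sup>2 / 2 * (s * d) = (3 / 2) * (u\<^sup>2 * s) * d" by (simp add: field_simps)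
    also have "\<dots> < (2 * u\<^sup>2 * s + 1) * d"
      using s_nonneg \<open>0 < d\<close> by (intro mult_strict_right_mono) (auto intro: add_nonneg_pos)
    also have "\<dots> = e" using den by (simp add: d_def)
    finally show "u\<^sup>2 / 2 * s * (2 * d) + u\<^sup>2 / 2 * (s * d) < e" .
  qed
  obtain m' where "\<And>k. m' \<le> k \<Longrightarrow> (\<integral>\<omega>. \<bar>V k \<omega> - V_lim \<omega>\<bar> \<partial>M) < d"
    using order_tendstoD(2)[OF V_tendsto_L1 d(1)] by (auto simp: eventually_sequentially)
  \<comment> \<open>Besides being late enough for the L1 bound, \<open>p\<close> is at least
    \<open>m\<close>, so \<open>A\<close> is also known at time \<open>p\<close>.\<close>
  then obtain p where p: "m \<le> p" and Vp: "\<And>k. p \<le> k \<Longrightarrow> (\<integral>\<omega>. \<bar>V k \<omega> - V_lim \<omega>\<bar> \<partial>M) < d"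
    by (meson le_trans max.cobounded1 max.cobounded2)
  have \<delta>: "(\<integral>\<omega>. \<bar>V k \<omega> - V p \<omega>\<bar> \<partial>M) \<le> 2 * d" if "p \<le> k" for k
  proof -
    have "(\<integral>\<omega>. \<bar>V k \<omega> - V p \<omega>\<bar> \<partial>M) \<le> (\<integral>\<omega>. \<bar>V k \<omega> - V_lim \<omega>\<bar> + \<bar>V p \<omega> - V_lim \<omega>\<bar> \<partial>M)"
    proof (rule integral_mono)
      have "\<bar>V k \<omega> - V p \<omega>\<bar> \<le> C\<^sup>2" if "\<omega> \<in> space M" for \<omega>
        using V_bound[OF that, of k] V_bound[OF that, of p] by auto
      then show "integrable M (\<lambda>\<omega>. \<bar>V k \<omega> - V p \<omega>\<bar>)"
        by (intro integrable_bounded[where B = "C\<^sup>2"]) auto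
    qed (use integrable_V_diff in auto)
    also have "\<dots> \<le> d + d"
      using Vp[of k] Vp[of p] that integrable_V_diff by simp
    finally show ?thesis by simp
  qed
  define Q where "Q n = (\<Sum>k. (b n k)\<^sup>2)" for n
  define Q' where "Q' n = Q n - (\<Sum>k<p. (b n k)\<^sup>2)" for n
  define R where "R n = (\<Sum>k. \<bar>b n k\<bar> ^ 3)" for n
  \<comment> \<open>The three summands belong to the facts 1, 2 and 3 below. As n grows, the first
    summand and the term with the cubes vanish and \<open>Q' n\<close> tends to \<open>s\<close>, so
    only multiples of \<open>d\<close> remain.\<close>
  define h where "h n = \<bar>u\<bar> * ((\<Sum>k<p. \<bar>b n k\<bar>) * C)
      + (u\<^sup>2 / 2 * Q n * (2 * d) + 2 * (\<bar>u\<bar> * C) ^ 3 * R n)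
      + u\<^sup>2 / 2 * (\<bar>Q' n - s\<bar> * C\<^sup>2 + s * d)" for n
  define G where "G = (indicator A :: 'a \<Rightarrow> complex)"
  have AF: "A \<in> sets (F p)" using A F_mono[OF p] by blast
  then have [measurable]: "G \<in> borel_measurable (F p)" unfolding G_def by measurable
  then have GM [measurable]: "G \<in> borel_measurable M" by (rule measurable_F_M)
  have G: "cmod (G \<omega>) \<le> 1" for \<omega> by (simp add: G_def indicator_def)
  have Q'0: "0 \<le> Q' n" for n
    using sum_le_suminf[OF summable_square, of "{..<p}" n] by (simp add: Q'_def Q_def)
  let ?I' = "\<lambda>n. \<integral>\<omega>. G \<omega> * iexp (u * (Y n \<omega> - (\<Sum>k<p. b n k * D k \<omega>))) \<partial>M"
  let ?J' = "\<lambda>n. \<integral>\<omega>. G \<omega> * exp (- (u\<^sup>2 * Q' n * V p \<omega> / 2)) \<partial>M"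
  have 1: "cmod (?I n - ?I' n) \<le> \<bar>u\<bar> * ((\<Sum>k<p. \<bar>b n k\<bar>) * C)" for n
  proof -
    have "?I n - ?I' n = (\<integral>\<omega>. G \<omega> * (iexp (u * Y n \<omega>) - iexp (u * (Y n \<omega> - (\<Sum>k<p. b n k * D k \<omega>)))) \<partial>M)"
      unfolding right_diff_distrib G_def[symmetric]
      by (rule Bochner_Integration.integral_diff[symmetric]; rule integrable_bounded[where B = 1])
         (use G in \<open>auto simp: norm_mult\<close>)
    also have "cmod \<dots> \<le> \<bar>u\<bar> * ((\<Sum>k<p. \<bar>b n k\<bar>) * C)"
    proof (rule norm_integral_le_bound)
      fix \<omega> assume w: "\<omega> \<in> space M"
      have "cmod (iexp (u * Y n \<omega>) - iexp (u * (Y n \<omega> - (\<Sum>k<p. b n k * D k \<omega>))))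
          \<le> \<bar>u * Y n \<omega> - u * (Y n \<omega> - (\<Sum>k<p. b n k * D k \<omega>))\<bar>"
        by (rule norm_iexp_diff_le)
      also have "\<dots> = \<bar>u\<bar> * \<bar>\<Sum>k<p. b n k * D k \<omega>\<bar>"
        by (simp add: right_diff_distrib abs_mult)
      also have "\<dots> \<le> \<bar>u\<bar> * ((\<Sum>k<p. \<bar>b n k\<bar>) * C)"
        unfolding sum_distrib_right
        by (intro mult_left_mono order_trans[OF sum_abs] sum_mono) (auto simp: abs_mult intro!: mult_left_mono D_bound w)
      finally show "cmod (G \<omega> * (iexp (u * Y n \<omega>) - iexp (u * (Y n \<omega> - (\<Sum>k<p. b n k * D k \<omega>)))))
          \<le> \<bar>u\<bar> * ((\<Sum>k<p. \<bar>b n k\<bar>) * C)"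
        using mult_mono[OF G[of \<omega>]] by (fastforce simp: norm_mult)
    qed (auto intro!: mult_nonneg_nonneg sum_nonneg C_nonneg)
    finally show ?thesis .
  qed
  have 2: "cmod (?I' n - ?J' n) \<le> u\<^sup>2 / 2 * Q n * (2 * d) + 2 * (\<bar>u\<bar> * C) ^ 3 * R n" for n
    unfolding Q_def R_def Q'_def by (rule limit_comparison) (auto intro: G \<delta>)
  have 3: "cmod (?J' n - ?J) \<le> u\<^sup>2 / 2 * (\<bar>Q' n - s\<bar> * C\<^sup>2 + s * d)" for n
  proof -
    have iJ': "integrable M (\<lambda>\<omega>. G \<omega> * exp (- (u\<^sup>2 * Q' n * V p \<omega> / 2)))"
    proof (rule integrable_bounded[where B = 1])
      fix \<omega> assume w: "\<omega> \<in> space M"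
      show "cmod (G \<omega> * exp (- (u\<^sup>2 * Q' n * V p \<omega> / 2))) \<le> 1"
        using V_bound[OF w, of p] Q'0[of n] by (simp add: G_def norm_mult indicator_def)
    qed auto
    have iJ: "integrable M (\<lambda>\<omega>. G \<omega> * gauss u \<omega>)"
    proof (rule integrable_const_bound[where B = 1])
      show "AE \<omega> in M. cmod (G \<omega> * gauss u \<omega>) \<le> 1"
        using AE_norm_gauss_le[of u] by eventually_elim (simp add: G_def norm_mult indicator_def)
    qed auto
    have "?J' n - ?J = (\<integral>\<omega>. G \<omega> * exp (- (u\<^sup>2 * Q' n * V p \<omega> / 2)) - G \<omega> * gauss u \<omega> \<partial>M)"
      using iJ' iJ by (simp add: G_def)
    then have "cmod (?J' n - ?J)
        \<le> (\<integral>\<omega>. cmod (G \<omega> * exp (- (u\<^sup>2 * Q' n * V p \<omega> / 2)) - G \<omega> * gauss u \<omega>) \<partial>M)"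
      by (simp only: integral_norm_bound)
    also have "\<dots> \<le> (\<integral>\<omega>. u\<^sup>2 / 2 * (\<bar>Q' n - s\<bar> * C\<^sup>2 + s * \<bar>V p \<omega> - V_lim \<omega>\<bar>) \<partial>M)"
    proof (rule integral_mono_AE)
      show "AE \<omega> in M. cmod (G \<omega> * exp (- (u\<^sup>2 * Q' n * V p \<omega> / 2)) - G \<omega> * gauss u \<omega>)
          \<le> u\<^sup>2 / 2 * (\<bar>Q' n - s\<bar> * C\<^sup>2 + s * \<bar>V p \<omega> - V_lim \<omega>\<bar>)"
        using AE_Vinf_bound AE_space
      proof eventually_elim
        case (elim \<omega>)
        note Vp0 = V_bound[OF elim(2), of p]
        have "cmod (G \<omega> * exp (- (u\<^sup>2 * Q' n * V p \<omega> / 2)) - G \<omega> * gauss u \<omega>)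
            \<le> \<bar>exp (- (u\<^sup>2 * Q' n * V p \<omega> / 2)) - exp (- (u\<^sup>2 * s * V_lim \<omega> / 2))\<bar>"
          by (simp add: G_def indicator_def flip: of_real_diff)
        also have "\<dots> \<le> \<bar>u\<^sup>2 * Q' n * V p \<omega> / 2 - u\<^sup>2 * s * V_lim \<omega> / 2\<bar>"
          using elim Vp0 Q'0[of n] s_nonneg by (intro abs_exp_minus_diff_le) auto
        also have "\<dots> = u\<^sup>2 / 2 * \<bar>(Q' n - s) * V p \<omega> + s * (V p \<omega> - V_lim \<omega>)\<bar>"
        proof -
          have "u\<^sup>2 * Q' n * V p \<omega> / 2 - u\<^sup>2 * s * V_lim \<omega> / 2
              = u\<^sup>2 / 2 * ((Q' n - s) * V p \<omega> + s * (V p \<omega> - V_lim \<omega>))"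
            by (simp add: algebra_simps diff_divide_distrib)
          then show ?thesis by (simp only: abs_mult) simp
        qed
        also have "\<dots> \<le> u\<^sup>2 / 2 * (\<bar>Q' n - s\<bar> * C\<^sup>2 + s * \<bar>V p \<omega> - V_lim \<omega>\<bar>)"
          using Vp0 s_nonneg by (intro mult_left_mono abs_triangle_ineq[THEN order_trans] add_mono)
            (auto simp: abs_mult intro!: mult_left_mono)
        finally show ?case .
      qed
    qed (use iJ iJ' integrable_V_diff in auto)
    also have "\<dots> = u\<^sup>2 / 2 * (\<bar>Q' n - s\<bar> * C\<^sup>2 + s * (\<integral>\<omega>. \<bar>V p \<omega> - V_lim \<omega>\<bar> \<partial>M))"
      using integrable_V_diff[of p] by (simp add: prob_space)
    also have "\<dots> \<le> u\<^sup>2 / 2 * (\<bar>Q' n - s\<bar> * C\<^sup>2 + s * d)"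
      using Vp[of p] s_nonneg by (intro mult_left_mono add_left_mono) auto
    finally show ?thesis .
  qed
  have "cmod (?I n - ?J) \<le> h n" for n
    using norm_triangle_mono[OF norm_triangle_mono[OF 1[of n] 2[of n]] 3[of n]] by (simp add: h_def)
  moreover have "h \<longlonglongrightarrow> u\<^sup>2 / 2 * s * (2 * d) + u\<^sup>2 / 2 * (s * d)"
  proof -
    have Q: "Q \<longlonglongrightarrow> s" and R: "R \<longlonglongrightarrow> 0"
      using square_limit cube_limit by (simp_all add: Q_def[abs_def] R_def[abs_def])
    have "(\<lambda>n. Q n - (\<Sum>k<p. (b n k)\<^sup>2)) \<longlonglongrightarrow> s - (\<Sum>k<p. 0\<^sup>2)"
      by (intro tendsto_intros Q weight_tendsto_zero)
    then have Q': "Q' \<longlonglongrightarrow> s" by (simp add: Q'_def[abs_def])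
    have "h \<longlonglongrightarrow> \<bar>u\<bar> * ((\<Sum>k<p. \<bar>0\<bar>) * C)
      + (u\<^sup>2 / 2 * s * (2 * d) + 2 * (\<bar>u\<bar> * C) ^ 3 * 0) + u\<^sup>2 / 2 * (\<bar>s - s\<bar> * C\<^sup>2 + s * d)"
      unfolding h_def by (intro tendsto_intros Q Q' R weight_tendsto_zero)
    then show ?thesis by simp
  qed
  ultimately show "\<exists>h l. (\<forall>\<^sub>F n in sequentially. cmod (?I n - ?J) \<le> h n) \<and> h \<longlonglongrightarrow> l \<and> l < e"
    using d(2) by (blast intro: always_eventually)
qed

end

section \<open>From events of the past to arbitrary events\<close>

context weighted_martingale_series
begin

definition F_limit :: "'a measure" where
  "F_limit = sigma (space M) (\<Union>n. sets (F n))"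

lemma sets_F_subset: "(\<Union>n. sets (F n)) \<subseteq> Pow (space M)"
  using subalg sets.space_closed by (fastforce simp: subalgebra_def)

lemma sets_F_limit: "sets F_limit = sigma_sets (space M) (\<Union>n. sets (F n))"
  unfolding F_limit_def by (intro sets_measure_of sets_F_subset)

lemma space_F_limit [simp]: "space F_limit = space M"
  by (simp add: F_limit_def space_measure_of_conv)

lemma subalgebra_F_limit: "subalgebra M F_limit"
  unfolding subalgebra_def sets_F_limit
  using subalg by (auto simp: subalgebra_def intro!: sets.sigma_sets_subset)

lemma measurable_F_limit:
  "f \<in> borel_measurable (F n) \<Longrightarrow> f \<in> borel_measurable F_limit"
  by (auto simp: measurable_def sets_F_limit intro: sigma_sets.Basic)

text \<open>
  For the indicator of an event \<open>H\<close> this is the convergence of characteristic functions under the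
  conditional probability given \<open>H\<close>.
\<close>

definition tests :: "real \<Rightarrow> ('a \<Rightarrow> real) \<Rightarrow> bool" where
  "tests u f \<longleftrightarrow> integrable M f \<and>
     (\<lambda>n. \<integral>\<omega>. f \<omega> *\<^sub>R (iexp (u * Y n \<omega>) - gauss u \<omega>) \<partial>M) \<longlonglongrightarrow> 0"

lemma AE_norm_diff_le: "AE \<omega> in M. cmod (iexp (u * Y n \<omega>) - gauss u \<omega>) \<le> 2"
  using AE_norm_gauss_le[of u]
proof eventually_elim
  case (elim \<omega>)
  then show ?case
    using norm_triangle_ineq4[of "iexp (u * Y n \<omega>)" "gauss u \<omega>"]
    by (simp only: norm_exp_i_times)
qed

lemma integrable_tested:
  assumes "integrable M f"
  shows "integrable M (\<lambda>\<omega>. f \<omega> *\<^sub>R (iexp (u * Y n \<omega>) - gauss u \<omega>))"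
proof (rule Bochner_Integration.integrable_bound[where f = "\<lambda>\<omega>. 2 * f \<omega>"])
  show "AE \<omega> in M. cmod (f \<omega> *\<^sub>R (iexp (u * Y n \<omega>) - gauss u \<omega>)) \<le> norm (2 * f \<omega>)"
    using AE_norm_diff_le[of u n]
  proof eventually_elim
    case (elim \<omega>)
    show ?case
      using mult_left_mono[OF elim, of "\<bar>f \<omega>\<bar>"] by (simp add: abs_mult mult.commute del: of_real_exp)
  qed
qed (use assms in auto)

lemma tests_add:
  assumes "tests u f" "tests u g"
  shows "tests u (\<lambda>\<omega>. f \<omega> + g \<omega>)"
proof -
  have *: "integrable M f" "integrable M g" using assms by (auto simp: tests_def)
  have "(\<integral>\<omega>. (f \<omega> + g \<omega>) *\<^sub>R (iexp (u * Y n \<omega>) - gauss u \<omega>) \<partial>M) =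
      (\<integral>\<omega>. f \<omega> *\<^sub>R (iexp (u * Y n \<omega>) - gauss u \<omega>) \<partial>M)
      + (\<integral>\<omega>. g \<omega> *\<^sub>R (iexp (u * Y n \<omega>) - gauss u \<omega>) \<partial>M)" for n
    unfolding scaleR_add_left
    by (rule Bochner_Integration.integral_add; rule integrable_tested[OF *(1)] integrable_tested[OF *(2)])
  then show ?thesis
    using assms unfolding tests_def by (simp only:) (auto intro!: tendsto_add_zero)
qed

lemma tests_scale:
  assumes "tests u f"
  shows "tests u (\<lambda>\<omega>. f \<omega> * a)"
proof -
  have "(\<integral>\<omega>. (f \<omega> * a) *\<^sub>R (iexp (u * Y n \<omega>) - gauss u \<omega>) \<partial>M) =
      a *\<^sub>R (\<integral>\<omega>. f \<omega> *\<^sub>R (iexp (u * Y n \<omega>) - gauss u \<omega>) \<partial>M)" for n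
    by (simp only: mult.commute[of _ a] integral_scaleR_right flip: scaleR_scaleR)
  moreover have "(\<lambda>n. a *\<^sub>R (\<integral>\<omega>. f \<omega> *\<^sub>R (iexp (u * Y n \<omega>) - gauss u \<omega>) \<partial>M)) \<longlonglongrightarrow> a *\<^sub>R 0"
    using assms unfolding tests_def by (intro tendsto_scaleR tendsto_const) blast
  ultimately show ?thesis
    using assms unfolding tests_def by simp
qed

lemma tests_sum:
  assumes "finite I" "\<And>i. i \<in> I \<Longrightarrow> tests u (f i)"
  shows "tests u (\<lambda>\<omega>. \<Sum>i\<in>I. f i \<omega>)"
  using assms
proof (induction I)
  case empty
  show ?case by (simp add: tests_def)
next
  case (insert i I)
  then show ?case using tests_add[of u "f i" "\<lambda>\<omega>. \<Sum>i\<in>I. f i \<omega>"] by simp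
qed

text \<open>The difference of exponentials has modulus at most 2 almost everywhere, so the tested
  integrals are Lipschitz in the L1 norm with a constant common to all n. This closes the class
  under L1 limits.\<close>

lemma tests_L1_limit:
  assumes f: "integrable M f" and g: "\<And>i. tests u (g i)"
    and lim: "(\<lambda>i. \<integral>\<omega>. \<bar>g i \<omega> - f \<omega>\<bar> \<partial>M) \<longlonglongrightarrow> 0"
  shows "tests u f"
  unfolding tests_def
proof (intro conjI f tendsto_zero_if_arbitrarily_small_bounds)
  fix e :: real assume "0 < e"
  then have "0 < e / 2" by simp
  from order_tendstoD(2)[OF lim this] obtain i where i: "(\<integral>\<omega>. \<bar>g i \<omega> - f \<omega>\<bar> \<partial>M) < e / 2"
    by (auto simp: eventually_sequentially)
  have ig: "integrable M (g i)" using g by (auto simp: tests_def)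
  let ?d = "\<lambda>n \<omega>. iexp (u * Y n \<omega>) - gauss u \<omega>"
  let ?h = "\<lambda>n. cmod (\<integral>\<omega>. g i \<omega> *\<^sub>R ?d n \<omega> \<partial>M) + 2 * (\<integral>\<omega>. \<bar>g i \<omega> - f \<omega>\<bar> \<partial>M)"
  have tri: "cmod y \<le> cmod x + c" if "x - y = z" "cmod z \<le> c" for x y z :: complex and c
    using norm_triangle_sub[of y x] that by (simp add: norm_minus_commute)
  have "cmod (\<integral>\<omega>. f \<omega> *\<^sub>R ?d n \<omega> \<partial>M) \<le> ?h n" for n
  proof -
    have "(\<integral>\<omega>. g i \<omega> *\<^sub>R ?d n \<omega> \<partial>M) - (\<integral>\<omega>. f \<omega> *\<^sub>R ?d n \<omega> \<partial>M)
        = (\<integral>\<omega>. (g i \<omega> - f \<omega>) *\<^sub>R ?d n \<omega> \<partial>M)"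
      unfolding scaleR_diff_left
      by (rule Bochner_Integration.integral_diff[symmetric]; rule integrable_tested[OF f] integrable_tested[OF ig])
    moreover have "cmod (\<integral>\<omega>. (g i \<omega> - f \<omega>) *\<^sub>R ?d n \<omega> \<partial>M) \<le> 2 * (\<integral>\<omega>. \<bar>g i \<omega> - f \<omega>\<bar> \<partial>M)"
    proof -
      have "cmod (\<integral>\<omega>. (g i \<omega> - f \<omega>) *\<^sub>R ?d n \<omega> \<partial>M) \<le> (\<integral>\<omega>. cmod ((g i \<omega> - f \<omega>) *\<^sub>R ?d n \<omega>) \<partial>M)"
        by (rule integral_norm_bound)
      also have "\<dots> \<le> (\<integral>\<omega>. 2 * \<bar>g i \<omega> - f \<omega>\<bar> \<partial>M)"
      proof (rule integral_mono_AE)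
        show "AE \<omega> in M. cmod ((g i \<omega> - f \<omega>) *\<^sub>R ?d n \<omega>) \<le> 2 * \<bar>g i \<omega> - f \<omega>\<bar>"
          using AE_norm_diff_le[of u n]
        proof eventually_elim
          case (elim \<omega>)
          show ?case
            using mult_left_mono[OF elim, of "\<bar>g i \<omega> - f \<omega>\<bar>"] by (simp add: mult.commute del: of_real_exp)
        qed
        show "integrable M (\<lambda>\<omega>. cmod ((g i \<omega> - f \<omega>) *\<^sub>R ?d n \<omega>))"
          using f ig by (intro integrable_norm integrable_tested) auto
      qed (use f ig in auto)
      also have "\<dots> = 2 * (\<integral>\<omega>. \<bar>g i \<omega> - f \<omega>\<bar> \<partial>M)" by simp
      finally show ?thesis .
    qed
    ultimately show ?thesis by (rule tri)
  qed
  moreover have "?h \<longlonglongrightarrow> cmod 0 + 2 * (\<integral>\<omega>. \<bar>g i \<omega> - f \<omega>\<bar> \<partial>M)"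
    using g[of i] by (intro tendsto_intros) (auto simp: tests_def)
  ultimately show "\<exists>h l. (\<forall>\<^sub>F n in sequentially. cmod (\<integral>\<omega>. f \<omega> *\<^sub>R ?d n \<omega> \<partial>M) \<le> h n) \<and> h \<longlonglongrightarrow> l \<and> l < e"
    using i by (intro exI[of _ ?h] exI[of _ "cmod 0 + 2 * (\<integral>\<omega>. \<bar>g i \<omega> - f \<omega>\<bar> \<partial>M)"])
      (auto intro: always_eventually)
qed

lemma tests_dominated_limit:
  assumes f: "f \<in> borel_measurable M" and g: "\<And>i. tests u (g i)"
    and lim: "\<And>\<omega>. \<omega> \<in> space M \<Longrightarrow> (\<lambda>i. g i \<omega>) \<longlonglongrightarrow> f \<omega>"
    and w: "integrable M w" "\<And>i \<omega>. \<omega> \<in> space M \<Longrightarrow> \<bar>g i \<omega>\<bar> \<le> w \<omega>"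
  shows "tests u f"
proof (rule tests_L1_limit[OF _ g])
  have gm: "g i \<in> borel_measurable M" for i using g[of i] by (auto simp: tests_def)
  show fi: "integrable M f"
    by (rule integrable_dominated_convergence[where s = g and w = w]) (use assms gm in auto)
  have "(\<lambda>i. \<integral>\<omega>. \<bar>g i \<omega> - f \<omega>\<bar> \<partial>M) \<longlonglongrightarrow> (\<integral>\<omega>. 0 \<partial>M)"
  proof (rule integral_dominated_convergence[where w = "\<lambda>\<omega>. w \<omega> + \<bar>f \<omega>\<bar>"])
    show "AE \<omega> in M. (\<lambda>i. \<bar>g i \<omega> - f \<omega>\<bar>) \<longlonglongrightarrow> 0"
      using lim by (intro AE_I2) (simp add: tendsto_rabs_zero LIM_zero)
    show "AE \<omega> in M. norm \<bar>g i \<omega> - f \<omega>\<bar> \<le> w \<omega> + \<bar>f \<omega>\<bar>" for i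
    proof (rule AE_I2)
      fix \<omega> assume "\<omega> \<in> space M"
      from w(2)[OF this, of i] show "norm \<bar>g i \<omega> - f \<omega>\<bar> \<le> w \<omega> + \<bar>f \<omega>\<bar>" by auto
    qed
  qed (use f w fi gm in auto)
  then show "(\<lambda>i. \<integral>\<omega>. \<bar>g i \<omega> - f \<omega>\<bar> \<partial>M) \<longlonglongrightarrow> 0" by simp
qed

lemma tests_indicator_past:
  assumes "A \<in> sets (F m)"
  shows "tests u (indicator A)"
proof -
  have A [measurable]: "A \<in> sets M" using assms subalg by (auto simp: subalgebra_def)
  have iA: "integrable M (indicator A :: 'a \<Rightarrow> real)" by (simp add: emeasure_eq_measure)
  have "(\<integral>\<omega>. indicat_real A \<omega> *\<^sub>R (iexp (u * Y n \<omega>) - gauss u \<omega>) \<partial>M)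
      = (\<integral>\<omega>. indicator A \<omega> * iexp (u * Y n \<omega>) \<partial>M) - (\<integral>\<omega>. indicator A \<omega> * gauss u \<omega> \<partial>M)" for n
  proof -
    have 1: "integrable M (\<lambda>\<omega>. indicator A \<omega> * iexp (u * Y n \<omega>))"
      by (rule integrable_bounded[where B = 1]) (auto simp: norm_mult indicator_def)
    have 2: "integrable M (\<lambda>\<omega>. indicator A \<omega> * gauss u \<omega>)"
    proof (rule integrable_const_bound[where B = 1])
      show "AE \<omega> in M. cmod (indicator A \<omega> * gauss u \<omega>) \<le> 1"
        using AE_norm_gauss_le[of u] by eventually_elim (simp add: norm_mult indicator_def)
    qed auto
    have "(\<integral>\<omega>. indicat_real A \<omega> *\<^sub>R (iexp (u * Y n \<omega>) - gauss u \<omega>) \<partial>M)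
        = (\<integral>\<omega>. indicator A \<omega> * iexp (u * Y n \<omega>) - indicator A \<omega> * gauss u \<omega> \<partial>M)"
      by (intro Bochner_Integration.integral_cong) (auto simp: indicator_def)
    then show ?thesis using Bochner_Integration.integral_diff[OF 1 2] by simp
  qed
  then show ?thesis
    using convergence_on_past[OF assms, of u] iA by (simp add: tests_def)
qed

text \<open>Dynkin's argument: the union of the \<open>F n\<close> is stable under intersection
  because the filtration increases, and the events that pass the test are closed under complements
  and countable disjoint unions.\<close>

lemma tests_indicator_F_limit:
  assumes "A \<in> sets F_limit"
  shows "tests u (indicator A)"
proof -
  have A: "A \<in> sigma_sets (space M) (\<Union>n. sets (F n))"
    using assms by (simp add: sets_F_limit)
  have int: "Int_stable (\<Union>n. sets (F n))"
  proof (rule Int_stableI)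
    fix A B assume "A \<in> (\<Union>n. sets (F n))" "B \<in> (\<Union>n. sets (F n))"
    then obtain m n where "A \<in> sets (F m)" "B \<in> sets (F n)" by blast
    then have "A \<inter> B \<in> sets (F (max m n))"
      using F_mono[of m "max m n"] F_mono[of n "max m n"] by auto
    then show "A \<inter> B \<in> (\<Union>n. sets (F n))" by blast
  qed
  from A show ?thesis
  proof (induction rule: sigma_sets_induct_disjoint[OF int sets_F_subset, consumes 1, case_names basic empty compl union])
    case (basic A)
    then show ?case using tests_indicator_past by blast
  next
    case empty
    have "{} \<in> sets (F 0)" by simp
    then show ?case by (rule tests_indicator_past)
  next
    case (compl A)
    have "tests u (\<lambda>\<omega>. indicator (space M) \<omega> + indicator A \<omega> * (- 1))"
    proof (rule tests_add)
      have "space M \<in> sets (F 0)" using sets.top[of "F 0"] by simp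
      then show "tests u (\<lambda>\<omega>. indicator (space M) \<omega>)" by (rule tests_indicator_past)
      show "tests u (\<lambda>\<omega>. indicator A \<omega> * (- 1))" using compl(2) by (rule tests_scale)
    qed
    also have "(\<lambda>\<omega>. indicator (space M) \<omega> + indicator A \<omega> * (- 1)) = indicat_real (space M - A)"
      using sigma_sets_into_sp[OF sets_F_subset compl(1)] by (auto simp: indicator_def fun_eq_iff)
    finally show ?case .
  next
    case (union A)
    have AM: "A i \<in> sets M" for i
      using union(2) subalgebra_F_limit by (auto simp: subalgebra_def sets_F_limit)
    show ?case
    proof (rule tests_dominated_limit[where g = "\<lambda>i. indicator (\<Union>j<i. A j)" and w = "\<lambda>_. 1"])
      show "tests u (indicator (\<Union>j<i. A j))" for i
      proof -
        \<comment> \<open>Disjointness turns the indicator of a finite union into a sum, to which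
          \<open>tests_sum\<close> applies.\<close>
        have "indicat_real (\<Union>j<i. A j) = (\<lambda>\<omega>. \<Sum>j<i. indicator (A j) \<omega>)"
          using indicator_UN_disjoint[of "{..<i}" A] union(1)
          by (intro ext) (auto simp: disjoint_family_on_def)
        then show ?thesis
          using tests_sum[of "{..<i}" u "\<lambda>j. indicator (A j)"] union(3) by simp
      qed
      show "(\<lambda>i. indicat_real (\<Union>j<i. A j) \<omega>) \<longlonglongrightarrow> indicat_real (\<Union> (range A)) \<omega>" for \<omega>
        by (rule LIMSEQ_indicator_UN)
    qed (use AM in \<open>auto simp: indicator_def\<close>)
  qed
qed

lemma tests_F_limit:
  assumes f: "f \<in> borel_measurable F_limit" and int: "integrable M f"
  shows "tests u f"
proof -
  \<comment> \<open>Running the induction on the restriction of \<open>M\<close> to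
    \<open>F_limit\<close> keeps all sets and approximating functions measurable with respect to
    \<open>F_limit\<close>.\<close>
  let ?R = "restr_to_subalg M F_limit"
  have "integrable ?R f"
    by (rule integrable_in_subalg[OF subalgebra_F_limit f int])
  then show ?thesis
  proof (induction rule: integrable_induct)
    case (base A c)
    then show ?case
      using tests_scale[OF tests_indicator_F_limit, of A u c]
      by (simp add: sets_restr_to_subalg[OF subalgebra_F_limit])
  next
    case (add f g)
    then show ?case by (intro tests_add)
  next
    case (lim f s)
    note M = integrable_from_subalg[OF subalgebra_F_limit]
    show ?case
      by (rule tests_dominated_limit[where g = s and w = "\<lambda>\<omega>. 2 * \<bar>f \<omega>\<bar>"])
         (use lim M[OF \<open>integrable ?R f\<close>] in \<open>auto simp: space_restr_to_subalg\<close>)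
  qed
qed

text \<open>Up to null sets, \<open>Y n\<close> and \<open>V_lim\<close> are measurable with respect
  to \<open>F_limit\<close>. Hence the indicator of \<open>H\<close> can be replaced by its
  conditional expectation given \<open>F_limit\<close>, to which \<open>tests_F_limit\<close>
  applies.\<close>

theorem stable_limit:
  assumes H [measurable]: "H \<in> sets M"
  shows "(\<lambda>n. \<integral>\<omega>. indicator H \<omega> *\<^sub>R iexp (u * Y n \<omega>) \<partial>M)
    \<longlonglongrightarrow> (\<integral>\<omega>. indicator H \<omega> *\<^sub>R gauss u \<omega> \<partial>M)"
proof -
  interpret F: finite_measure_subalgebra M F_limit
    by unfold_locales (rule subalgebra_F_limit)
  \<comment> \<open>\<open>Y n\<close> and \<open>V_lim\<close> agree with limits of adapted
    sequences only almost everywhere, and the exceptional null sets may lie outside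
    \<open>F_limit\<close>. The total operator \<open>lim\<close> gives versions that are measurable
    with respect to \<open>F_limit\<close> everywhere.\<close>
  define Y' where "Y' n \<omega> = lim (\<lambda>K. \<Sum>k<K. b n k * D k \<omega>)" for n \<omega>
  define V' where "V' \<omega> = lim (\<lambda>k. V k \<omega>)" for \<omega>
  have D_lim: "D k \<in> borel_measurable F_limit" for k
    by (rule measurable_F_limit[OF D_measurable])
  have V_lim_meas: "V k \<in> borel_measurable F_limit" for k
    by (rule measurable_F_limit[OF V_measurable])
  note [measurable] = D_lim V_lim_meas
  have [measurable]: "Y' n \<in> borel_measurable F_limit" for n
    unfolding Y'_def by measurable
  have [measurable]: "V' \<in> borel_measurable F_limit"
    unfolding V'_def by measurable
  have Y': "AE \<omega> in M. Y' n \<omega> = Y n \<omega>" for n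
    using Y_sums[of n] by eventually_elim (auto simp: Y'_def sums_def intro: limI)
  have V': "AE \<omega> in M. V' \<omega> = V_lim \<omega>"
    using V_tendsto by eventually_elim (auto simp: V'_def intro: limI)
  define f where "f = real_cond_exp M F_limit (indicator H)"
  have iH: "integrable M (indicat_real H)" by (simp add: emeasure_eq_measure)
  have [measurable]: "f \<in> borel_measurable F_limit" "f \<in> borel_measurable M"
    unfolding f_def by auto
  have fi: "integrable M f" unfolding f_def by (rule F.real_cond_exp_int(1)[OF iH])
  let ?d = "\<lambda>n \<omega>. iexp (u * Y n \<omega>) - gauss u \<omega>"
  let ?d' = "\<lambda>n \<omega>. iexp (u * Y' n \<omega>) - complex_of_real (exp (- (u\<^sup>2 * s * V' \<omega> / 2)))"
  have eq: "(\<integral>\<omega>. indicat_real H \<omega> *\<^sub>R ?d n \<omega> \<partial>M) = (\<integral>\<omega>. f \<omega> *\<^sub>R ?d n \<omega> \<partial>M)" for n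
  proof -
    define d' where "d' = ?d' n"
    have [measurable]: "d' \<in> borel_measurable F_limit" unfolding d'_def by measurable
    then have [measurable]: "d' \<in> borel_measurable M"
      by (rule measurable_from_subalg[OF subalgebra_F_limit])
    have ae: "AE \<omega> in M. d' \<omega> = ?d n \<omega>"
      using Y'[of n] V' by eventually_elim (simp add: d'_def)
    have i1: "integrable M (\<lambda>\<omega>. indicat_real H \<omega> *\<^sub>R ?d n \<omega>)" "integrable M (\<lambda>\<omega>. f \<omega> *\<^sub>R ?d n \<omega>)"
      by (intro integrable_tested iH fi)+
    \<comment> \<open>\<open>h\<close> is again \<open>Re\<close> or \<open>Im\<close>, because the
      conditional expectation pulls out real factors.\<close>
    have part: "(\<integral>\<omega>. h (indicat_real H \<omega> *\<^sub>R ?d n \<omega>) \<partial>M) = (\<integral>\<omega>. h (f \<omega> *\<^sub>R ?d n \<omega>) \<partial>M)"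
      if h: "bounded_linear h" for h :: "complex \<Rightarrow> real"
    proof -
      have [measurable]: "h \<in> borel_measurable borel"
        using h by (intro borel_measurable_continuous_onI linear_continuous_on)
      note hs = bounded_linear.linear[OF h, THEN linear_scale]
      have "(\<integral>\<omega>. h (indicat_real H \<omega> *\<^sub>R ?d n \<omega>) \<partial>M) = (\<integral>\<omega>. h (d' \<omega>) * indicat_real H \<omega> \<partial>M)"
        by (rule integral_cong_AE) (use ae in \<open>auto simp: hs mult.commute\<close>)
      also have "\<dots> = (\<integral>\<omega>. h (d' \<omega>) * f \<omega> \<partial>M)"
        unfolding f_def
      proof (rule F.real_cond_exp_intg(2)[symmetric])
        have "integrable M (\<lambda>\<omega>. h (indicat_real H \<omega> *\<^sub>R ?d n \<omega>))"
          by (rule integrable_bounded_linear[OF h i1(1)])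
        then show "integrable M (\<lambda>\<omega>. h (d' \<omega>) * indicat_real H \<omega>)"
          by (rule integrable_cong_AE_imp) (use ae in \<open>auto simp: hs mult.commute\<close>)
      qed auto
      also have "\<dots> = (\<integral>\<omega>. h (f \<omega> *\<^sub>R ?d n \<omega>) \<partial>M)"
        by (rule integral_cong_AE) (use ae in \<open>auto simp: hs mult.commute\<close>)
      finally show ?thesis .
    qed
    show ?thesis
      using part[OF bounded_linear_Re] part[OF bounded_linear_Im] i1
      by (auto simp: complex_eq_iff simp flip: integral_Re integral_Im simp del: scaleR_complex.sel)
  qed
  have lim: "(\<lambda>n. \<integral>\<omega>. indicat_real H \<omega> *\<^sub>R ?d n \<omega> \<partial>M) \<longlonglongrightarrow> 0"
    unfolding eq using tests_F_limit[OF \<open>f \<in> borel_measurable F_limit\<close> fi, of u] by (simp only: tests_def)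
  have "(\<integral>\<omega>. indicat_real H \<omega> *\<^sub>R ?d n \<omega> \<partial>M) =
      (\<integral>\<omega>. indicator H \<omega> *\<^sub>R iexp (u * Y n \<omega>) \<partial>M) - (\<integral>\<omega>. indicator H \<omega> *\<^sub>R gauss u \<omega> \<partial>M)" for n
    unfolding scaleR_diff_right
  proof (rule Bochner_Integration.integral_diff)
    show "integrable M (\<lambda>\<omega>. indicat_real H \<omega> *\<^sub>R iexp (u * Y n \<omega>))"
      by (rule integrable_bounded[where B = 1]) (auto simp: indicator_def)
    show "integrable M (\<lambda>\<omega>. indicat_real H \<omega> *\<^sub>R gauss u \<omega>)"
    proof (rule integrable_const_bound[where B = 1])
      show "AE \<omega> in M. cmod (indicat_real H \<omega> *\<^sub>R gauss u \<omega>) \<le> 1"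
        using AE_norm_gauss_le[of u] by eventually_elim (simp add: indicator_def)
    qed auto
  qed
  with lim show ?thesis by (simp add: LIM_zero_iff)
qed

end

subsection \<open>Stable convergence to centred normal kernels\<close>

lemma centred_normal_eq_distr:
  assumes "0 \<le> s"
  shows "centred_normal s = distr std_normal_distribution borel (\<lambda>x. sqrt s * x)"
proof -
  interpret std: prob_space std_normal_distribution
    by (rule prob_space_normal_density) simp
  show ?thesis
  proof (cases "s = 0")
    case True
    then show ?thesis
      using std.distr_const[of 0 borel] by (simp add: centred_normal_def)
  next
    case False
    have "distributed std_normal_distribution lborel (\<lambda>x. x) std_normal_density"
      by (simp add: distributed_def distr_id2)
    from std.normal_density_affine[OF this, of "sqrt s" 0] False assms
    have "distr std_normal_distribution lborel (\<lambda>x. sqrt s * x) = density lborel (normal_density 0 (sqrt s))"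
      by (simp add: distributed_def)
    moreover have "distr std_normal_distribution lborel (\<lambda>x. sqrt s * x)
        = distr std_normal_distribution borel (\<lambda>x. sqrt s * x)"
      by (rule distr_cong) auto
    ultimately show ?thesis using False by (simp add: centred_normal_def)
  qed
qed

lemma char_centred_normal:
  assumes "0 \<le> s"
  shows "char (centred_normal s) u = complex_of_real (exp (- (u\<^sup>2 * s / 2)))"
proof -
  have "char (centred_normal s) u = char std_normal_distribution (u * sqrt s)"
    unfolding centred_normal_eq_distr[OF assms] char_def
    by (subst integral_distr) (auto simp: mult_ac)
  then show ?thesis
    using assms by (simp add: char_std_normal_distribution power_mult_distrib)
qed

text \<open>By \<open>centred_normal_eq_distr\<close> the kernel is the image of one fixed law under
  a scaling that depends measurably on \<omega>. This treats variance 0, where the definition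
  switches to a Dirac mass, together with positive variances.\<close>

lemma measurable_centred_normal:
  assumes [measurable]: "v \<in> borel_measurable M" and v: "\<And>\<omega>. \<omega> \<in> space M \<Longrightarrow> 0 \<le> v \<omega>"
  shows "(\<lambda>\<omega>. centred_normal (v \<omega>)) \<in> measurable M (prob_algebra borel)"
proof -
  have [measurable]: "(\<lambda>_. std_normal_distribution) \<in> measurable M (prob_algebra borel)"
    by (auto simp: space_prob_algebra intro!: measurable_const prob_space_normal_density)
  have "(\<lambda>\<omega>. distr std_normal_distribution borel (\<lambda>x. sqrt (v \<omega>) * x)) \<in> measurable M (prob_algebra borel)"
    by measurable
  also have "?this \<longleftrightarrow> ?thesis"
    by (intro measurable_cong) (simp add: centred_normal_eq_distr v)
  finally show ?thesis .
qed

lemma (in prob_space) integral_uniform_measure: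
  fixes f :: "'a \<Rightarrow> 'b::{banach, second_countable_topology}"
  assumes [measurable]: "f \<in> borel_measurable M" "H \<in> sets M" and H: "0 < measure M H"
  shows "(\<integral>\<omega>. f \<omega> \<partial>uniform_measure M H) = (\<integral>\<omega>. indicator H \<omega> *\<^sub>R f \<omega> \<partial>M) /\<^sub>R measure M H"
proof -
  have "uniform_measure M H = density M (\<lambda>\<omega>. ennreal (indicator H \<omega> / measure M H))"
    unfolding uniform_measure_def
    using H by (intro arg_cong[where f = "density M"] ext)
      (auto simp: indicator_def emeasure_eq_measure divide_ennreal simp flip: ennreal_1)
  then have "(\<integral>\<omega>. f \<omega> \<partial>uniform_measure M H) = (\<integral>\<omega>. (indicator H \<omega> / measure M H) *\<^sub>R f \<omega> \<partial>M)"
    by (simp add: integral_density)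
  also have "\<dots> = (\<integral>\<omega>. inverse (measure M H) *\<^sub>R (indicator H \<omega> *\<^sub>R f \<omega>) \<partial>M)"
    by (simp add: divide_inverse mult.commute)
  finally show ?thesis
    by (simp only: integral_scaleR_right)
qed

text \<open>Fubini for the mixture. Cosine and sine are bounded real functions, so the real and the
  imaginary part follow from the rule for real integrals against \<open>bind\<close>.\<close>

lemma (in prob_space) char_bind:
  assumes K: "K \<in> measurable M (prob_algebra borel)"
  shows "char (M \<bind> K) u = (\<integral>\<omega>. char (K \<omega>) u \<partial>M)"
proof -
  have KS [measurable]: "K \<in> measurable M (subprob_algebra borel)"
    by (rule measurable_prob_algebraD[OF K])
  have Kp: "real_distribution (K \<omega>)" if "\<omega> \<in> space M" for \<omega>
    using measurable_space[OF K that]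
    by (auto simp: space_prob_algebra real_distribution_def real_distribution_axioms_def)
  have mass: "AE \<omega> in M. emeasure (K \<omega>) (space (K \<omega>)) \<le> ennreal 1"
    by (intro AE_I2) (use Kp in \<open>auto simp: real_distribution_def prob_space.emeasure_space_1\<close>)
  have bind: "(\<integral>x. f x \<partial>(M \<bind> K)) = (\<integral>\<omega>. \<integral>x. f x \<partial>K \<omega> \<partial>M)" "integrable (M \<bind> K) f"
    if [measurable]: "f \<in> borel_measurable borel" and "\<And>x. \<bar>f x\<bar> \<le> 1" for f :: "real \<Rightarrow> real"
    by (rule integral_bind[where K = borel and B = 1 and B' = 1] integrable_bind[where K = borel and B = 1 and B' = 1];
        use that KS mass finite_measure_axioms in simp)+
  have int: "complex_integrable N (\<lambda>x. iexp (u * x))" if "real_distribution N" for N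
  proof -
    interpret N: real_distribution N by fact
    show ?thesis by (rule N.integrable_iexp) auto
  qed
  have "prob_space (M \<bind> K)"
    by (rule prob_space_bind'[OF _ K]) (simp add: space_prob_algebra prob_space_axioms)
  then have "real_distribution (M \<bind> K)"
    using sets_bind'[OF _ K, of M] by (simp add: real_distribution_def real_distribution_axioms_def space_prob_algebra prob_space_axioms)
  note iB = int[OF this]
  have [measurable]: "(\<lambda>\<omega>. \<integral>x. cos (u * x) \<partial>K \<omega>) \<in> borel_measurable M" "(\<lambda>\<omega>. \<integral>x. sin (u * x) \<partial>K \<omega>) \<in> borel_measurable M"
    by (rule measurable_compose[OF KS integral_measurable_subprob_algebra]; measurable)+
  have iK: "complex_integrable M (\<lambda>\<omega>. char (K \<omega>) u)"
  proof (rule integrable_bounded[where B = 1])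
    have "(\<lambda>\<omega>. Complex (\<integral>x. cos (u * x) \<partial>K \<omega>) (\<integral>x. sin (u * x) \<partial>K \<omega>)) \<in> borel_measurable M"
      by (simp add: Complex_eq)
    also have "?this \<longleftrightarrow> (\<lambda>\<omega>. char (K \<omega>) u) \<in> borel_measurable M"
      by (intro measurable_cong)
         (use int[OF Kp] in \<open>auto simp: complex_eq_iff char_def Re_exp Im_exp simp flip: integral_Re integral_Im\<close>)
    finally show "(\<lambda>\<omega>. char (K \<omega>) u) \<in> borel_measurable M" .
  qed (use Kp real_distribution.cmod_char_le_1 in auto)
  show ?thesis
  proof (rule complex_eqI)
    have "Re (char (M \<bind> K) u) = (\<integral>x. cos (u * x) \<partial>(M \<bind> K))"
      unfolding char_def using iB by (simp add: Re_exp flip: integral_Re)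
    also have "\<dots> = (\<integral>\<omega>. \<integral>x. cos (u * x) \<partial>K \<omega> \<partial>M)"
      by (rule bind) auto
    also have "\<dots> = (\<integral>\<omega>. Re (char (K \<omega>) u) \<partial>M)"
      unfolding char_def by (intro Bochner_Integration.integral_cong)
        (use int[OF Kp] in \<open>auto simp: Re_exp simp flip: integral_Re\<close>)
    finally show "Re (char (M \<bind> K) u) = Re (\<integral>\<omega>. char (K \<omega>) u \<partial>M)"
      using iK by simp
    have "Im (char (M \<bind> K) u) = (\<integral>x. sin (u * x) \<partial>(M \<bind> K))"
      unfolding char_def using iB by (simp add: Im_exp flip: integral_Im)
    also have "\<dots> = (\<integral>\<omega>. \<integral>x. sin (u * x) \<partial>K \<omega> \<partial>M)"
      by (rule bind) auto
    also have "\<dots> = (\<integral>\<omega>. Im (char (K \<omega>) u) \<partial>M)"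
      unfolding char_def by (intro Bochner_Integration.integral_cong)
        (use int[OF Kp] in \<open>auto simp: Im_exp simp flip: integral_Im\<close>)
    finally show "Im (char (M \<bind> K) u) = Im (\<integral>\<omega>. char (K \<omega>) u \<partial>M)"
      using iK by simp
  qed
qed

text \<open>Levy's continuity theorem under the conditional probability given \<open>H\<close>: the
  characteristic functions there are the integrals over \<open>H\<close> divided by the measure of
  \<open>H\<close>.\<close>

lemma (in prob_space) stable_conv_centred_normalI:
  assumes Y [measurable]: "\<And>n. Y n \<in> borel_measurable M"
    and v [measurable]: "v \<in> borel_measurable M" and v0: "\<And>\<omega>. \<omega> \<in> space M \<Longrightarrow> 0 \<le> v \<omega>"
    and lim: "\<And>u H. H \<in> sets M \<Longrightarrow> (\<lambda>n. \<integral>\<omega>. indicator H \<omega> *\<^sub>R iexp (u * Y n \<omega>) \<partial>M)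
      \<longlonglongrightarrow> (\<integral>\<omega>. indicator H \<omega> *\<^sub>R complex_of_real (exp (- (u\<^sup>2 * v \<omega> / 2))) \<partial>M)"
  shows "stable_conv M Y (\<lambda>\<omega>. centred_normal (v \<omega>))"
  unfolding stable_conv_def
proof (intro conjI allI ballI impI)
  show K: "(\<lambda>\<omega>. centred_normal (v \<omega>)) \<in> measurable M (prob_algebra borel)"
    by (rule measurable_centred_normal[OF v v0])
  fix H
  assume H [measurable]: "H \<in> sets M" and pos: "0 < measure M H"
  define U where "U = uniform_measure M H"
  have [measurable_cong, simp]: "sets U = sets M" and [simp]: "space U = space M"
    by (simp_all add: U_def)
  interpret U: prob_space U
    unfolding U_def using pos by (intro prob_space_uniform_measure) (auto simp: emeasure_eq_measure)
  have K': "(\<lambda>\<omega>. centred_normal (v \<omega>)) \<in> measurable U (prob_algebra borel)"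
    using K by simp
  have "weak_conv_m (\<lambda>n. distr U borel (Y n)) (U \<bind> (\<lambda>\<omega>. centred_normal (v \<omega>)))"
  proof (rule levy_continuity)
    show "real_distribution (distr U borel (Y n))" for n
      by (rule U.real_distribution_distr) simp
    show "real_distribution (U \<bind> (\<lambda>\<omega>. centred_normal (v \<omega>)))"
      using sets_bind'[OF _ K', of U] prob_space_bind'[OF _ K', of U]
      by (simp add: real_distribution_def real_distribution_axioms_def space_prob_algebra U.prob_space_axioms)
    show "(\<lambda>n. char (distr U borel (Y n)) u) \<longlonglongrightarrow> char (U \<bind> (\<lambda>\<omega>. centred_normal (v \<omega>))) u" for u
    proof -
      have "char (distr U borel (Y n)) u = (\<integral>\<omega>. indicator H \<omega> *\<^sub>R iexp (u * Y n \<omega>) \<partial>M) /\<^sub>R measure M H" for n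
        unfolding char_def by (subst integral_distr) (auto simp: U_def integral_uniform_measure pos)
      moreover have "char (U \<bind> (\<lambda>\<omega>. centred_normal (v \<omega>))) u
          = (\<integral>\<omega>. indicator H \<omega> *\<^sub>R complex_of_real (exp (- (u\<^sup>2 * v \<omega> / 2))) \<partial>M) /\<^sub>R measure M H"
      proof -
        have "char (U \<bind> (\<lambda>\<omega>. centred_normal (v \<omega>))) u
            = (\<integral>\<omega>. complex_of_real (exp (- (u\<^sup>2 * v \<omega> / 2))) \<partial>U)"
          unfolding U.char_bind[OF K']
          by (intro Bochner_Integration.integral_cong) (auto simp: char_centred_normal v0)
        also have "\<dots> = (\<integral>\<omega>. indicator H \<omega> *\<^sub>R complex_of_real (exp (- (u\<^sup>2 * v \<omega> / 2))) \<partial>M) /\<^sub>R measure M H"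
          unfolding U_def by (rule integral_uniform_measure[OF _ H pos]) measurable
        finally show ?thesis .
      qed
      ultimately show ?thesis
        using tendsto_scaleR[OF tendsto_const lim[OF H, of u]] by simp
    qed
  qed
  then show "weak_conv_m (\<lambda>n. distr (uniform_measure M H) borel (Y n))
      (uniform_measure M H \<bind> (\<lambda>\<omega>. centred_normal (v \<omega>)))"
    by (simp add: U_def)
qed (rule Y)

subsection \<open>Asymptotics of the weights\<close>

lemma robbins_monro_contraction:
  fixes z \<delta> :: "nat \<Rightarrow> real"
  assumes step: "\<And>n. z (Suc n) \<le> (1 - \<delta> n) * z n" and nonneg: "\<And>n. 0 \<le> z n"
    and \<delta>: "\<And>n. 0 \<le> \<delta> n" and div: "\<not> summable \<delta>"
  shows "z \<longlonglongrightarrow> 0"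
proof -
  \<comment> \<open>Since 1 - t \<le> exp (- t), the product of the contraction factors is at most
    the exponential of minus the sum of the \<open>\<delta> i\<close>, and that sum
    diverges.\<close>
  have bound: "z n \<le> z 0 * exp (- (\<Sum>i<n. \<delta> i))" for n
  proof (induction n)
    case (Suc n)
    have "z (Suc n) \<le> exp (- \<delta> n) * z n"
      using step[of n] exp_ge_add_one_self[of "- \<delta> n"] nonneg[of n]
      by (intro order_trans[OF step] mult_right_mono) auto
    also have "\<dots> \<le> exp (- \<delta> n) * (z 0 * exp (- (\<Sum>i<n. \<delta> i)))"
      by (intro mult_left_mono Suc) auto
    finally show ?case by (simp add: exp_diff exp_minus field_simps)
  qed simp
  have "filterlim (\<lambda>n. \<Sum>i<n. \<delta> i) at_top sequentially"
  proof -
    have inc: "incseq (\<lambda>n. \<Sum>i<n. \<delta> i)"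
      by (intro incseq_SucI) (simp add: \<delta>)
    have "\<exists>n. B \<le> (\<Sum>i<n. \<delta> i)" for B
    proof (rule ccontr)
      assume "\<not> ?thesis"
      then have "\<And>n. (\<Sum>i<n. \<delta> i) \<le> B" by (meson linear)
      then have "summable \<delta>" by (intro bounded_imp_summable[of _ B] \<delta>) (metis lessThan_Suc_atMost)
      with div show False ..
    qed
    then show ?thesis
      using inc unfolding filterlim_at_top eventually_sequentially incseq_def by (meson order_trans)
  qed
  then have "(\<lambda>n. z 0 * exp (- (\<Sum>i<n. \<delta> i))) \<longlonglongrightarrow> z 0 * 0"
    by (intro tendsto_intros filterlim_compose[OF exp_at_bot]) (simp add: filterlim_uminus_at_top)
  then have lim: "(\<lambda>n. z 0 * exp (- (\<Sum>i<n. \<delta> i))) \<longlonglongrightarrow> 0" by simp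
  show ?thesis
    by (rule tendsto_sandwich[OF _ _ tendsto_const lim]) (use bound nonneg in \<open>auto intro: always_eventually\<close>)
qed

text \<open>Eventually \<open>x (Suc n)\<close> is a convex combination of \<open>x n\<close> and
  \<open>L n\<close>. So the distance of \<open>x n\<close> to \<open>l\<close> contracts towards
  every level below which the distance of \<open>L n\<close> to \<open>l\<close> eventually
  stays.\<close>

lemma robbins_monro_limit:
  fixes x \<delta> L :: "nat \<Rightarrow> real"
  assumes rec: "\<forall>\<^sub>F n in sequentially. x (Suc n) = (1 - \<delta> n) * x n + \<delta> n * L n"
    and \<delta>: "\<forall>\<^sub>F n in sequentially. 0 \<le> \<delta> n \<and> \<delta> n \<le> 1" and div: "\<not> summable \<delta>"
    and L: "L \<longlonglongrightarrow> l"
  shows "x \<longlonglongrightarrow> l"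
proof (rule LIM_zero_cancel, rule tendsto_zero_if_arbitrarily_small_bounds)
  fix e :: real assume "0 < e"
  then have e: "0 < e / 2" by simp
  have "\<forall>\<^sub>F n in sequentially. \<bar>L n - l\<bar> < e / 2"
    using tendstoD[OF L e] by (simp add: dist_real_def)
  from eventually_conj[OF rec eventually_conj[OF \<delta> this]]
  obtain m where m: "\<And>n. m \<le> n \<Longrightarrow> x (Suc n) = (1 - \<delta> n) * x n + \<delta> n * L n"
      "\<And>n. m \<le> n \<Longrightarrow> 0 \<le> \<delta> n" "\<And>n. m \<le> n \<Longrightarrow> \<delta> n \<le> 1" "\<And>n. m \<le> n \<Longrightarrow> \<bar>L n - l\<bar> < e / 2"
    unfolding eventually_sequentially by blast
  \<comment> \<open>The excess of the distance over \<open>e / 2\<close>, cut off at 0: it satisfies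
    the pure contraction inequality, while the distance itself carries the extra term with
    \<open>L\<close>.\<close>
  define z where "z i = max 0 (\<bar>x (i + m) - l\<bar> - e / 2)" for i
  have "z \<longlonglongrightarrow> 0"
  proof (rule robbins_monro_contraction[where \<delta> = "\<lambda>i. \<delta> (i + m)"])
    fix i
    let ?n = "i + m"
    have "x (Suc ?n) - l = (1 - \<delta> ?n) * (x ?n - l) + \<delta> ?n * (L ?n - l)"
      using m(1)[of ?n] by (simp add: algebra_simps)
    then have "\<bar>x (Suc ?n) - l\<bar> \<le> (1 - \<delta> ?n) * \<bar>x ?n - l\<bar> + \<delta> ?n * \<bar>L ?n - l\<bar>"
      using abs_triangle_ineq[of "(1 - \<delta> ?n) * (x ?n - l)" "\<delta> ?n * (L ?n - l)"] m(2,3)[of ?n]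
      by (simp add: abs_mult)
    also have "\<dots> \<le> (1 - \<delta> ?n) * (z i + e / 2) + \<delta> ?n * (e / 2)"
      using m(2,3,4)[of ?n] by (intro add_mono mult_left_mono) (auto simp: z_def)
    finally have "\<bar>x (Suc ?n) - l\<bar> - e / 2 \<le> (1 - \<delta> ?n) * z i"
      by (simp add: algebra_simps)
    moreover have "0 \<le> (1 - \<delta> ?n) * z i"
      using m(3)[of ?n] by (simp add: z_def)
    ultimately show "z (Suc i) \<le> (1 - \<delta> ?n) * z i"
      by (simp add: z_def)
  qed (use m div in \<open>auto simp: z_def summable_iff_shift\<close>)
  then have "(\<lambda>n. z (n - m)) \<longlonglongrightarrow> 0"
    using LIMSEQ_offset[of "\<lambda>n. z (n - m)" m] by simp
  then have "(\<lambda>n. z (n - m) + e / 2) \<longlonglongrightarrow> 0 + e / 2" by (intro tendsto_intros)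
  moreover have "norm (x n - l) \<le> z (n - m) + e / 2" if "m \<le> n" for n
    using that by (simp add: z_def)
  then have "\<forall>\<^sub>F n in sequentially. norm (x n - l) \<le> z (n - m) + e / 2"
    unfolding eventually_sequentially by blast
  ultimately show "\<exists>h d. (\<forall>\<^sub>F n in sequentially. norm (x n - l) \<le> h n) \<and> h \<longlonglongrightarrow> d \<and> d < e"
    using \<open>0 < e\<close> by (intro exI[of _ "\<lambda>n. z (n - m) + e / 2"] exI[of _ "0 + e / 2"]) auto
qed

text \<open>A Stolz-Cesaro argument for tails: the inequality
  \<open>\<bar>f k - L * g k\<bar> \<le> e * g k\<close> holds for all late k and is summed over the
  tail.\<close>

lemma tail_sum_ratio_limit:
  fixes f g :: "nat \<Rightarrow> real"
  assumes g: "\<forall>\<^sub>F k in sequentially. 0 < g k" "summable g"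
    and lim: "(\<lambda>k. f k / g k) \<longlonglongrightarrow> L"
  shows "summable f" "(\<lambda>n. (\<Sum>k. f (k + n)) / (\<Sum>k. g (k + n))) \<longlonglongrightarrow> L"
proof -
  have near: "\<forall>\<^sub>F n in sequentially. \<forall>k\<ge>n. 0 < g k \<and> \<bar>f k - L * g k\<bar> \<le> e * g k" if "0 < e" for e
  proof -
    have "\<forall>\<^sub>F k in sequentially. \<bar>f k / g k - L\<bar> < e"
      using tendstoD[OF lim that] by (simp add: dist_real_def)
    then have "\<forall>\<^sub>F k in sequentially. 0 < g k \<and> \<bar>f k - L * g k\<bar> \<le> e * g k"
      using g(1)
    proof eventually_elim
      case (elim k)
      then have "\<bar>f k - L * g k\<bar> = \<bar>f k / g k - L\<bar> * g k" by (simp add: abs_mult_pos' field_simps)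
      then show ?case using elim by simp
    qed
    then show ?thesis by (rule eventually_all_ge_at_top)
  qed
  have sd: "summable (\<lambda>k. f k - L * g k)"
  proof (rule summable_comparison_test_ev)
    show "\<forall>\<^sub>F k in sequentially. norm (f k - L * g k) \<le> 1 * g k"
      using near[of 1] by (auto elim!: eventually_mono)
  qed (use g in simp)
  have "summable (\<lambda>k. (f k - L * g k) + L * g k)"
    by (intro summable_add sd summable_mult g)
  then show sf: "summable f" by simp
  have sh: "summable (\<lambda>k. g (k + n))" "summable (\<lambda>k. f (k + n))" "summable (\<lambda>k. f (k + n) - L * g (k + n))" for n
    using g(2) sf sd by (simp_all add: summable_iff_shift[where f = g] summable_iff_shift[where f = f]
        summable_iff_shift[where f = "\<lambda>k. f k - L * g k"])
  have ratio: "dist (x / y) L = \<bar>x - L * y\<bar> / y" if "0 < y" for x y :: real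
  proof -
    have "x / y - L = (x - L * y) / y" using that by (simp add: diff_divide_distrib)
    then show ?thesis using that by (simp add: dist_real_def)
  qed
  show "(\<lambda>n. (\<Sum>k. f (k + n)) / (\<Sum>k. g (k + n))) \<longlonglongrightarrow> L"
  proof (rule tendstoI)
    fix e :: real assume "0 < e"
    then have "0 < e / 2" by simp
    from near[OF this] show "\<forall>\<^sub>F n in sequentially. dist ((\<Sum>k. f (k + n)) / (\<Sum>k. g (k + n))) L < e"
    proof eventually_elim
      case (elim n)
      have pos: "0 < (\<Sum>k. g (k + n))"
        using elim sh by (intro suminf_pos) auto
      have "(\<Sum>k. f (k + n)) - L * (\<Sum>k. g (k + n)) = (\<Sum>k. f (k + n) - L * g (k + n))"
        using suminf_diff[OF sh(2) summable_mult[OF sh(1)]] suminf_mult[OF sh(1)] by simp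
      moreover have "\<bar>\<Sum>k. f (k + n) - L * g (k + n)\<bar> \<le> (\<Sum>k. e / 2 * g (k + n))"
        using elim sh by (intro norm_suminf_le[where 'a = real, unfolded real_norm_def] summable_mult) auto
      moreover have "(\<Sum>k. e / 2 * g (k + n)) = e / 2 * (\<Sum>k. g (k + n))"
        using sh by (intro suminf_mult)
      moreover have "dist ((\<Sum>k. f (k + n)) / (\<Sum>k. g (k + n))) L
          = \<bar>(\<Sum>k. f (k + n)) - L * (\<Sum>k. g (k + n))\<bar> / (\<Sum>k. g (k + n))"
        by (rule ratio[OF pos])
      ultimately have "dist ((\<Sum>k. f (k + n)) / (\<Sum>k. g (k + n))) L \<le> e / 2"
        using pos by (simp add: divide_le_eq)
      then show ?case using \<open>0 < e\<close> by simp
    qed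
  qed
qed

lemma Suc_ratio_powr_limit: "(\<lambda>n. real (Suc n) * ((real (Suc n) / real n) powr p - 1)) \<longlonglongrightarrow> p"
  by real_asymp

lemma ratio_Suc_powr_limit: "(\<lambda>n. real (Suc n) * ((real n / real (Suc n)) powr p - 1)) \<longlonglongrightarrow> - p"
  by real_asymp

lemma powr_nonpos_limit:
  assumes "p \<le> 0"
  shows "(\<lambda>n. real (Suc n) powr p) \<longlonglongrightarrow> (if p = 0 then 1 else 0)"
proof (cases "p = 0")
  case False
  then have "p < 0" using assms by simp
  then have "(\<lambda>n. real (Suc n) powr p) \<longlonglongrightarrow> 0" by real_asymp
  then show ?thesis using False by simp
qed simp

text \<open>Multiplication by n^p turns the remainder into O(n^(-p)), which vanishes. The conclusion
  at \<open>Suc n\<close> keeps the base of the power positive and absorbs the index shift in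
  \<open>r (n - 1)\<close>.\<close>

lemma tendsto_of_bigo_remainder:
  fixes f :: "nat \<Rightarrow> real"
  assumes "(\<lambda>n. f n - k * real n powr (- p)) \<in> O(\<lambda>n. real n powr (- 2 * p))" "0 < p"
  shows "(\<lambda>n. real (Suc n) powr p * f (Suc n)) \<longlonglongrightarrow> k"
proof -
  obtain B where B: "\<forall>\<^sub>F n in sequentially. norm (f n - k * real n powr (- p)) \<le> B * norm (real n powr (- 2 * p))"
    using assms(1) by (auto elim: landau_o.bigE)
  have "(\<lambda>n. real n powr p * (f n - k * real n powr (- p))) \<longlonglongrightarrow> 0"
  proof (rule Lim_null_comparison)
    have "(\<lambda>n. B * real n powr (- p)) \<longlonglongrightarrow> B * 0"
      using assms(2) by (intro tendsto_intros tendsto_neg_powr filterlim_real_sequentially) auto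
    then show "(\<lambda>n. B * real n powr (- p)) \<longlonglongrightarrow> 0" by simp
    show "\<forall>\<^sub>F n in sequentially. norm (real n powr p * (f n - k * real n powr (- p))) \<le> B * real n powr (- p)"
      using B
    proof eventually_elim
      case (elim n)
      have "norm (real n powr p * (f n - k * real n powr (- p))) \<le> real n powr p * (B * real n powr (- 2 * p))"
        using elim by (simp add: abs_mult mult_left_mono)
      also have "\<dots> = B * real n powr (- p)"
        by (simp add: powr_add[symmetric] mult.left_commute)
      finally show ?case .
    qed
  qed
  then have "(\<lambda>n. real (Suc n) powr p * (f (Suc n) - k * real (Suc n) powr (- p)) + k) \<longlonglongrightarrow> 0 + k"
    by (intro tendsto_intros LIMSEQ_Suc)
  also have "(\<lambda>n. real (Suc n) powr p * (f (Suc n) - k * real (Suc n) powr (- p)) + k)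
      = (\<lambda>n. real (Suc n) powr p * f (Suc n))"
    by (simp add: fun_eq_iff algebra_simps powr_minus del: of_nat_Suc)
  finally show ?thesis by simp
qed

lemma powr_minus_mult_cancel: "0 < x \<Longrightarrow> x powr (- p) * (x powr p * y) = y" for x y p :: real
  by (simp add: powr_minus)

lemma powr_diff_one_mult: "0 < x \<Longrightarrow> x powr (p - 1) * (x * y) = x powr p * y" for x y p :: real
  by (simp add: powr_diff)

lemma powr_power_eq: "0 < x \<Longrightarrow> (x powr p) ^ n = x powr (real n * p)" for x p :: real
  by (simp add: powr_power mult.commute)

lemma powr_power_mult_eq:
  "0 < x \<Longrightarrow> (x powr p) ^ n * x powr p' = x powr (real n * p + p')"
  "0 < x \<Longrightarrow> x powr p' * (x powr p) ^ n = x powr (real n * p + p')" for x p p' :: real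
  by (simp_all add: powr_power_eq powr_add)

section \<open>Rows of weights and the limits of their sums of squares and cubes\<close>

locale step_sizes =
  fixes r a :: "nat \<Rightarrow> real" and c q \<gamma> \<nu> \<rho> :: real
  assumes r_range: "\<And>n. 0 < r n \<and> r n < 1"
    and a_pos: "\<And>k. 1 \<le> k \<Longrightarrow> 0 < a k"
    and exponents: "1/2 < \<gamma>" "\<gamma> \<le> 1" "1/2 < \<nu>" "\<nu> \<le> 1" "0 < \<rho>" "\<rho> \<le> \<nu>" "\<rho> \<le> 2 * \<gamma> - 1"
    and q_pos: "0 < q" and q_half: "\<nu> = 1 \<Longrightarrow> 1/2 < q"
    and r_asymp: "(\<lambda>n. real (Suc n) powr \<gamma> * r n) \<longlonglongrightarrow> c"
    and q_asymp: "(\<lambda>n. real (Suc n) powr \<nu> * emp_weight a (Suc n) (Suc n)) \<longlonglongrightarrow> q"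
begin

definition total :: "nat \<Rightarrow> real" where
  "total n = (\<Sum>l=1..n. a l)"

text \<open>The free exponent \<rho> lets one analysis serve all regimes; it will be \<nu> or 2
  \<gamma> - 1. The bounds \<rho> \<le> \<nu> and \<rho> \<le> 2 \<gamma> - 1 make the sums of
  squares over the head and over the tail of a row converge.\<close>

definition rate :: "nat \<Rightarrow> real" where
  "rate n = real n powr (\<rho> / 2)"

text \<open>
  Weights of the martingale differences in the rescaled error: those with \<open>k < n\<close> come from the
  recursion for the empirical mean minus the weighted average of the inclinations, those with
  \<open>k \<ge> n\<close> from the tail of the martingale formed by that average.
\<close>

definition coef :: "nat \<Rightarrow> nat \<Rightarrow> real" where
  "coef n k = rate n * (if k < n then total (Suc k) / total n * (emp_weight a (Suc k) (Suc k) - r k) else - r k)"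

text \<open>The limit in \<open>ratio_asymp\<close>. The averaging weights contribute
  \<open>q\<close>; the growth of \<open>rate\<close> acts on the scale 1/n and is visible only if
  \<nu> = 1.\<close>

definition decay :: real where
  "decay = q - (if \<nu> = 1 then \<rho> / 2 else 0)"

text \<open>The limit in \<open>increment_asymp\<close>. On the scale n^((\<nu> + \<rho>)/2) the
  averaging weight, of order n^(-\<nu>), survives only if \<rho> = \<nu>, and the step size, of
  order n^(-\<gamma>), only if (\<nu> + \<rho>)/2 = \<gamma>.\<close>

definition head_limit :: real where
  "head_limit = q * (if \<rho> = \<nu> then 1 else 0) - c * (if (\<nu> + \<rho>) / 2 = \<gamma> then 1 else 0)"

definition tail_limit :: real where
  "tail_limit = (if \<rho> = 2 * \<gamma> - 1 then c\<^sup>2 / (2 * \<gamma> - 1) else 0)"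

abbreviation weight :: "nat \<Rightarrow> real" where
  "weight n \<equiv> emp_weight a (Suc n) (Suc n)"

lemma total_pos: "0 < n \<Longrightarrow> 0 < total n"
  unfolding total_def by (intro sum_pos) (auto intro: a_pos)

lemma total_Suc: "total (Suc n) = total n + a (Suc n)"
  by (simp add: total_def)

lemma one_minus_weight: "1 - weight n = total n / total (Suc n)"
proof -
  have "weight n = a (Suc n) / total (Suc n)" by (simp add: emp_weight_def total_def)
  then show ?thesis
    using total_pos[of "Suc n"] by (simp add: total_Suc field_simps)
qed

text \<open>For \<nu> = 1 this rests on q > 1/2 and \<rho> \<le> 1.\<close>

lemma decay_pos: "0 < decay"
  using q_pos q_half exponents by (auto simp: decay_def)

lemma powr_ratio: "0 < n \<Longrightarrow> rate (Suc n) / rate n = (real (Suc n) / real n) powr (\<rho> / 2)"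
  by (simp add: rate_def powr_divide)

lemma rate_pos: "0 < n \<Longrightarrow> 0 < rate n"
  by (simp add: rate_def)

text \<open>The common factor by which the entries \<open>coef n k\<close> with k < n are multiplied
  on passing to row \<open>Suc n\<close>.\<close>

definition ratio :: "nat \<Rightarrow> real" where
  "ratio n = rate (Suc n) / rate n * (total n / total (Suc n))"

lemma weight_tendsto_0: "weight \<longlonglongrightarrow> 0"
proof -
  have "(\<lambda>n. real (Suc n) powr (- \<nu>)) \<longlonglongrightarrow> 0"
    using powr_nonpos_limit[of "- \<nu>"] exponents by auto
  from tendsto_mult[OF this q_asymp] show ?thesis
    by (simp only: powr_minus_mult_cancel of_nat_0_less_iff zero_less_Suc mult_zero_left)
qed

lemma ratio_asymp: "(\<lambda>n. real (Suc n) powr \<nu> * (1 - ratio n)) \<longlonglongrightarrow> decay"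
proof -
  define h where "h n = (real (Suc n) / real n) powr (\<rho> / 2)" for n
  have "(\<lambda>n. real (Suc n) powr (\<nu> - 1) * (real (Suc n) * (h n - 1))) \<longlonglongrightarrow> (if \<nu> - 1 = 0 then 1 else 0) * (\<rho> / 2)"
    unfolding h_def using exponents by (intro tendsto_mult powr_nonpos_limit Suc_ratio_powr_limit) auto
  moreover have "real (Suc n) powr (\<nu> - 1) * (real (Suc n) * (h n - 1)) = real (Suc n) powr \<nu> * (h n - 1)" for n
    by (rule powr_diff_one_mult) simp
  ultimately have "(\<lambda>n. real (Suc n) powr \<nu> * (h n - 1)) \<longlonglongrightarrow> (if \<nu> - 1 = 0 then 1 else 0) * (\<rho> / 2)"
    by (simp only:)
  then have h: "(\<lambda>n. real (Suc n) powr \<nu> * (h n - 1)) \<longlonglongrightarrow> (if \<nu> = 1 then \<rho> / 2 else 0)"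
    by (auto split: if_splits)
  \<comment> \<open>From \<open>ratio n = h n * (1 - weight n)\<close> one gets
    \<open>1 - ratio n = weight n - (h n - 1) * (1 - weight n)\<close>, where \<open>h n - 1\<close>
    is asymptotically \<rho>/(2n).\<close>
  have "(\<lambda>n. real (Suc n) powr \<nu> * weight n - (real (Suc n) powr \<nu> * (h n - 1)) * (1 - weight n))
      \<longlonglongrightarrow> q - (if \<nu> = 1 then \<rho> / 2 else 0) * (1 - 0)"
    by (intro tendsto_intros q_asymp h weight_tendsto_0)
  then have "(\<lambda>n. real (Suc n) powr \<nu> * weight n - (real (Suc n) powr \<nu> * (h n - 1)) * (1 - weight n)) \<longlonglongrightarrow> decay"
    by (simp add: decay_def)
  then show ?thesis
  proof (rule Lim_transform_eventually)
    show "\<forall>\<^sub>F n in sequentially. real (Suc n) powr \<nu> * weight n - (real (Suc n) powr \<nu> * (h n - 1)) * (1 - weight n)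
        = real (Suc n) powr \<nu> * (1 - ratio n)"
      using eventually_gt_at_top[of 0]
    proof eventually_elim
      case (elim n)
      have ratio: "ratio n = h n * (1 - weight n)"
        unfolding ratio_def powr_ratio[OF elim] one_minus_weight h_def ..
      show ?case unfolding ratio by (simp add: algebra_simps)
    qed
  qed
qed

lemma ratio_tendsto_1: "ratio \<longlonglongrightarrow> 1"
proof -
  have "(\<lambda>n. real (Suc n) powr (- \<nu>)) \<longlonglongrightarrow> 0"
    using powr_nonpos_limit[of "- \<nu>"] exponents by auto
  from tendsto_mult[OF this ratio_asymp] have "(\<lambda>n. 1 - ratio n) \<longlonglongrightarrow> 0"
    by (simp only: powr_minus_mult_cancel of_nat_0_less_iff zero_less_Suc mult_zero_left)
  from tendsto_diff[OF tendsto_const[of 1] this] show ?thesis by simp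
qed

lemma ratio_power_asymp: "(\<lambda>n. real (Suc n) powr \<nu> * (1 - ratio n ^ p)) \<longlonglongrightarrow> real p * decay"
proof -
  have "(\<lambda>n. (real (Suc n) powr \<nu> * (1 - ratio n)) * (\<Sum>i<p. ratio n ^ i)) \<longlonglongrightarrow> decay * (\<Sum>i<p. 1 ^ i)"
    by (intro tendsto_intros ratio_asymp ratio_tendsto_1)
  then show ?thesis
    by (simp add: one_diff_power_eq mult_ac)
qed

lemma ratio_nonneg: "0 \<le> ratio n"
  by (cases n) (auto simp: ratio_def rate_def total_pos less_imp_le)

text \<open>The head of row \<open>Suc n\<close> is \<open>ratio n\<close> times that of row
  \<open>n\<close> plus one new entry, so the sum of p-th powers follows a Robbins-Monro recursion
  with step \<open>1 - ratio n ^ p\<close>. The limit is that of the p-th power of the new entry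
  divided by the step.\<close>

lemma head_power_limit:
  assumes p: "0 < p"
    and lim: "(\<lambda>n. real (Suc n) powr \<nu> * \<bar>rate (Suc n) * (weight n - r n)\<bar> ^ p) \<longlonglongrightarrow> l"
  shows "(\<lambda>n. \<Sum>k<n. \<bar>coef n k\<bar> ^ p) \<longlonglongrightarrow> l / (real p * decay)"
proof (rule robbins_monro_limit)
  let ?\<delta> = "\<lambda>n. 1 - ratio n ^ p"
  let ?L = "\<lambda>n. \<bar>rate (Suc n) * (weight n - r n)\<bar> ^ p / ?\<delta> n"
  have pd: "0 < real p * decay" using p decay_pos by simp
  have \<delta>_pos: "\<forall>\<^sub>F n in sequentially. 0 < ?\<delta> n \<and> ?\<delta> n \<le> 1"
    using order_tendstoD(1)[OF ratio_power_asymp pd]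
    by eventually_elim (use ratio_nonneg in \<open>auto simp: zero_less_mult_iff simp del: of_nat_Suc\<close>)
  then show "\<forall>\<^sub>F n in sequentially. 0 \<le> ?\<delta> n \<and> ?\<delta> n \<le> 1"
    by eventually_elim auto
  show "\<not> summable ?\<delta>"
  proof
    assume sum: "summable ?\<delta>"
    \<comment> \<open>The step is of order n^(-\<nu>) with \<nu> \<le> 1, so its summability would
      make the harmonic series converge.\<close>
    have "\<forall>\<^sub>F n in sequentially. real p * decay / 2 < real (Suc n) powr \<nu> * ?\<delta> n"
      by (rule order_tendstoD(1)[OF ratio_power_asymp]) (use pd in linarith)
    then have "\<forall>\<^sub>F n in sequentially. norm (inverse (real (Suc n))) \<le> 2 / (real p * decay) * ?\<delta> n"
      using \<delta>_pos
    proof eventually_elim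
      case (elim n)
      have "real (Suc n) powr \<nu> \<le> real (Suc n) powr 1"
        using exponents by (intro powr_mono) auto
      then have "real (Suc n) powr \<nu> * ?\<delta> n \<le> real (Suc n) * ?\<delta> n"
        using elim by (intro mult_right_mono) auto
      then have "real p * decay / 2 < real (Suc n) * ?\<delta> n" using elim(1) by linarith
      then show ?case using pd p decay_pos by (simp add: field_simps)
    qed
    then have "summable (\<lambda>n. inverse (real (Suc n)))"
      by (rule summable_comparison_test_ev) (intro summable_mult sum)
    then have "summable (\<lambda>n. inverse (real n))" by (simp only: summable_Suc_iff[of "\<lambda>n. inverse (real n)"])
    then show False using not_summable_harmonic[where 'a = real] by simp
  qed
  have "(\<lambda>n. (real (Suc n) powr \<nu> * \<bar>rate (Suc n) * (weight n - r n)\<bar> ^ p) / (real (Suc n) powr \<nu> * ?\<delta> n))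
      \<longlonglongrightarrow> l / (real p * decay)"
    using pd by (intro tendsto_divide lim ratio_power_asymp) linarith
  then show "?L \<longlonglongrightarrow> l / (real p * decay)"
    by (simp del: of_nat_Suc)
  show "\<forall>\<^sub>F n in sequentially. (\<Sum>k<Suc n. \<bar>coef (Suc n) k\<bar> ^ p) = (1 - ?\<delta> n) * (\<Sum>k<n. \<bar>coef n k\<bar> ^ p) + ?\<delta> n * ?L n"
    using eventually_gt_at_top[of 0] \<delta>_pos
  proof eventually_elim
    case (elim n)
    have "coef (Suc n) k = ratio n * coef n k" if "k < n" for k
      using that elim(1) rate_pos[of n] total_pos[of n] by (simp add: coef_def ratio_def)
    moreover have "coef (Suc n) n = rate (Suc n) * (weight n - r n)"
      using total_pos[of "Suc n"] by (simp add: coef_def)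
    ultimately show ?case
      using elim(2) by (simp add: abs_mult power_mult_distrib sum_distrib_left ratio_nonneg)
  qed
qed

lemma increment_asymp:
  "(\<lambda>n. real (Suc n) powr ((\<nu> + \<rho>) / 2) * (weight n - r n)) \<longlonglongrightarrow> head_limit"
proof -
  \<comment> \<open>The second inequality combines \<nu> \<le> 1 with \<rho> \<le> 2 \<gamma> -
    1.\<close>
  have e1: "(\<rho> - \<nu>) / 2 \<le> 0" and e2: "(\<nu> + \<rho>) / 2 - \<gamma> \<le> 0"
    using exponents by auto
  have "(\<lambda>n. (real (Suc n) powr \<nu> * weight n) * real (Suc n) powr ((\<rho> - \<nu>) / 2)
        - (real (Suc n) powr \<gamma> * r n) * real (Suc n) powr ((\<nu> + \<rho>) / 2 - \<gamma>))
      \<longlonglongrightarrow> q * (if (\<rho> - \<nu>) / 2 = 0 then 1 else 0) - c * (if (\<nu> + \<rho>) / 2 - \<gamma> = 0 then 1 else 0)"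
    by (intro tendsto_intros q_asymp r_asymp powr_nonpos_limit e1 e2)
  moreover have "(real (Suc n) powr \<nu> * weight n) * real (Suc n) powr ((\<rho> - \<nu>) / 2)
        - (real (Suc n) powr \<gamma> * r n) * real (Suc n) powr ((\<nu> + \<rho>) / 2 - \<gamma>)
      = real (Suc n) powr ((\<nu> + \<rho>) / 2) * (weight n - r n)" for n
  proof -
    have 1: "real (Suc n) powr \<nu> * real (Suc n) powr ((\<rho> - \<nu>) / 2) = real (Suc n) powr ((\<nu> + \<rho>) / 2)"
      unfolding powr_add[symmetric] by (simp add: field_simps)
    have 2: "real (Suc n) powr \<gamma> * real (Suc n) powr ((\<nu> + \<rho>) / 2 - \<gamma>) = real (Suc n) powr ((\<nu> + \<rho>) / 2)"
      unfolding powr_add[symmetric] by simp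
    have gen: "(x1 * w) * y1 - (x2 * z) * y2 = t * (w - z)" if "x1 * y1 = t" "x2 * y2 = t"
      for x1 x2 y1 y2 w z t :: real
    proof -
      have "(x1 * w) * y1 = (x1 * y1) * w" "(x2 * z) * y2 = (x2 * y2) * z" by simp_all
      then show ?thesis by (simp only: that right_diff_distrib)
    qed
    show ?thesis by (rule gen[OF 1 2])
  qed
  ultimately show ?thesis by (simp add: head_limit_def)
qed

lemma head_square_limit: "(\<lambda>n. \<Sum>k<n. (coef n k)\<^sup>2) \<longlonglongrightarrow> head_limit\<^sup>2 / (2 * decay)"
proof -
  have "(\<lambda>n. (real (Suc n) powr ((\<nu> + \<rho>) / 2) * (weight n - r n))\<^sup>2) \<longlonglongrightarrow> head_limit\<^sup>2"
    by (intro tendsto_intros increment_asymp)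
  also have "(\<lambda>n. (real (Suc n) powr ((\<nu> + \<rho>) / 2) * (weight n - r n))\<^sup>2)
      = (\<lambda>n. real (Suc n) powr \<nu> * \<bar>rate (Suc n) * (weight n - r n)\<bar>\<^sup>2)"
  proof
    fix n
    have "(real (Suc n) powr ((\<nu> + \<rho>) / 2))\<^sup>2 = real (Suc n) powr \<nu> * (rate (Suc n))\<^sup>2"
    proof -
      have "real 2 * ((\<nu> + \<rho>) / 2) = real 2 * (\<rho> / 2) + \<nu>" by simp
      then show ?thesis
        unfolding rate_def by (subst powr_power_mult_eq(2), simp, subst powr_power_eq, simp, simp only:)
    qed
    then show "(real (Suc n) powr ((\<nu> + \<rho>) / 2) * (weight n - r n))\<^sup>2
        = real (Suc n) powr \<nu> * \<bar>rate (Suc n) * (weight n - r n)\<bar>\<^sup>2"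
      by (simp add: power_mult_distrib)
  qed
  finally show ?thesis
    using head_power_limit[of 2] by simp
qed

text \<open>The cube of the new entry, multiplied by n^\<nu>, is the cube of the convergent sequence
  in \<open>increment_asymp\<close> times n^(-\<nu>/2), and therefore vanishes.\<close>

lemma head_cube_limit: "(\<lambda>n. \<Sum>k<n. \<bar>coef n k\<bar> ^ 3) \<longlonglongrightarrow> 0"
proof -
  have "(\<lambda>n. \<bar>real (Suc n) powr ((\<nu> + \<rho>) / 2) * (weight n - r n)\<bar> ^ 3 * real (Suc n) powr (- \<nu> / 2))
      \<longlonglongrightarrow> \<bar>head_limit\<bar> ^ 3 * (if - \<nu> / 2 = 0 then 1 else 0)"
    using exponents by (intro tendsto_intros increment_asymp powr_nonpos_limit) auto
  also have "(\<lambda>n. \<bar>real (Suc n) powr ((\<nu> + \<rho>) / 2) * (weight n - r n)\<bar> ^ 3 * real (Suc n) powr (- \<nu> / 2))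
      = (\<lambda>n. real (Suc n) powr \<nu> * \<bar>rate (Suc n) * (weight n - r n)\<bar> ^ 3)"
  proof
    fix n
    have "(real (Suc n) powr ((\<nu> + \<rho>) / 2)) ^ 3 * real (Suc n) powr (- \<nu> / 2) = real (Suc n) powr \<nu> * (rate (Suc n)) ^ 3"
    proof -
      have "real 3 * ((\<nu> + \<rho>) / 2) + - \<nu> / 2 = real 3 * (\<rho> / 2) + \<nu>" by (simp add: field_simps)
      then show ?thesis
        by (simp only: rate_def powr_power_mult_eq of_nat_0_less_iff zero_less_Suc)
    qed
    then show "\<bar>real (Suc n) powr ((\<nu> + \<rho>) / 2) * (weight n - r n)\<bar> ^ 3 * real (Suc n) powr (- \<nu> / 2)
        = real (Suc n) powr \<nu> * \<bar>rate (Suc n) * (weight n - r n)\<bar> ^ 3"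
      using rate_pos[of "Suc n"] by (simp add: power_mult_distrib abs_mult mult_ac del: of_nat_Suc)
  qed
  finally show ?thesis
    using head_power_limit[of 3 0] exponents by simp
qed

text \<open>The squares of \<open>r\<close> are compared with the differences of k^(-s), where s = 2
  \<gamma> - 1. These behave like s k^(-2 \<gamma>), and their tail sums telescope to
  n^(-s).\<close>

lemma r_square_summable: "summable (\<lambda>k. (r k)\<^sup>2)"
  and tail_r_square: "(\<lambda>n. real n powr (2 * \<gamma> - 1) * (\<Sum>k. (r (k + n))\<^sup>2)) \<longlonglongrightarrow> c\<^sup>2 / (2 * \<gamma> - 1)"
proof -
  define s where "s = 2 * \<gamma> - 1"
  have s: "0 < s" using exponents by (simp add: s_def)
  \<comment> \<open>As \<open>0 powr (- s)\<close> is 0, the difference \<open>g 0\<close> is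
    negative, and positivity of \<open>g\<close> is available only eventually.\<close>
  define f where "f k = real k powr (- s)" for k
  define g where "g k = f k - f (Suc k)" for k
  have f0: "f \<longlonglongrightarrow> 0"
    unfolding f_def using s by (intro tendsto_neg_powr filterlim_real_sequentially) auto
  have g_sums: "(\<lambda>k. g (k + n)) sums f n" for n
    using telescope_sums'[OF LIMSEQ_ignore_initial_segment[OF f0, of n]] by (simp add: g_def)
  have g_lim: "(\<lambda>k. real (Suc k) powr (2 * \<gamma>) * g k) \<longlonglongrightarrow> s"
  proof (rule Lim_transform_eventually)
    show "(\<lambda>k. real (Suc k) * ((real k / real (Suc k)) powr (- s) - 1)) \<longlonglongrightarrow> s"
      using ratio_Suc_powr_limit[of "- s"] by simp
    show "\<forall>\<^sub>F k in sequentially. real (Suc k) * ((real k / real (Suc k)) powr (- s) - 1) = real (Suc k) powr (2 * \<gamma>) * g k"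
      using eventually_gt_at_top[of 0]
    proof eventually_elim
      case (elim k)
      have "x * ((y / x) powr (- s) - 1) = x powr (2 * \<gamma>) * (y powr (- s) - x powr (- s))"
        if "0 < x" "0 < y" for x y :: real
      proof -
        have xy: "(y / x) powr (- s) = y powr (- s) * x powr s"
          using that by (simp add: powr_divide powr_minus inverse_eq_divide)
        have "x powr (2 * \<gamma>) = x * x powr s" using that by (simp add: s_def powr_diff)
        then show ?thesis
          unfolding xy using that by (simp add: powr_minus right_diff_distrib)
      qed
      from this[of "real (Suc k)" "real k"] show ?case
        using elim by (simp add: g_def f_def del: of_nat_Suc)
    qed
  qed
  have g_pos: "\<forall>\<^sub>F k in sequentially. 0 < g k"
    using order_tendstoD(1)[OF g_lim s]
    by eventually_elim (auto simp: zero_less_mult_iff simp del: of_nat_Suc)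
  have "(\<lambda>k. (real (Suc k) powr \<gamma> * r k)\<^sup>2 / (real (Suc k) powr (2 * \<gamma>) * g k)) \<longlonglongrightarrow> c\<^sup>2 / s"
    using s by (intro tendsto_intros r_asymp g_lim) auto
  moreover have "(real (Suc k) powr \<gamma>)\<^sup>2 = real (Suc k) powr (2 * \<gamma>)" for k
    by (simp add: power2_eq_square flip: powr_add del: of_nat_Suc)
  ultimately have lim: "(\<lambda>k. (r k)\<^sup>2 / g k) \<longlonglongrightarrow> c\<^sup>2 / s"
    by (simp add: power_mult_distrib del: of_nat_Suc)
  have g_summable: "summable g"
    using sums_summable[OF g_sums[of 0]] by simp
  show "summable (\<lambda>k. (r k)\<^sup>2)"
    by (rule tail_sum_ratio_limit(1)[OF g_pos g_summable lim])
  have "(\<lambda>n. (\<Sum>k. (r (k + n))\<^sup>2) / f n) \<longlonglongrightarrow> c\<^sup>2 / s"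
    using tail_sum_ratio_limit(2)[OF g_pos g_summable lim] g_sums[THEN sums_unique] by simp
  then show "(\<lambda>n. real n powr (2 * \<gamma> - 1) * (\<Sum>k. (r (k + n))\<^sup>2)) \<longlonglongrightarrow> c\<^sup>2 / (2 * \<gamma> - 1)"
    unfolding s_def[symmetric] by (simp add: f_def powr_minus divide_inverse mult.commute)
qed

lemma r_square_summable_shift: "summable (\<lambda>k. (r (k + n))\<^sup>2)"
  using r_square_summable by (simp add: summable_iff_shift[where f = "\<lambda>k. (r k)\<^sup>2"])

lemma coef_square_tail: "(\<Sum>k. (coef n (k + n))\<^sup>2) = (rate n)\<^sup>2 * (\<Sum>k. (r (k + n))\<^sup>2)"
  by (simp add: coef_def power_mult_distrib suminf_mult[OF r_square_summable_shift])

lemma coef_square_summable: "summable (\<lambda>k. (coef n k)\<^sup>2)"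
proof -
  have "summable (\<lambda>k. (coef n (k + n))\<^sup>2)"
    using r_square_summable_shift[of n] by (simp add: coef_def power_mult_distrib summable_mult)
  then show ?thesis by (simp only: summable_iff_shift[where f = "\<lambda>k. (coef n k)\<^sup>2"])
qed

text \<open>The factor \<open>(rate n)\<^sup>2\<close> is n^\<rho>. It balances the tail sum, of
  order n^(1 - 2 \<gamma>), if \<rho> = 2 \<gamma> - 1; for smaller \<rho> the product
  vanishes.\<close>

lemma tail_square_limit: "(\<lambda>n. \<Sum>k. (coef n (k + n))\<^sup>2) \<longlonglongrightarrow> tail_limit"
proof (rule LIMSEQ_imp_Suc)
  have "(\<lambda>n. real (Suc n) powr (\<rho> - (2 * \<gamma> - 1)) * (real (Suc n) powr (2 * \<gamma> - 1) * (\<Sum>k. (r (k + Suc n))\<^sup>2)))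
      \<longlonglongrightarrow> (if \<rho> - (2 * \<gamma> - 1) = 0 then 1 else 0) * (c\<^sup>2 / (2 * \<gamma> - 1))"
    using exponents by (intro tendsto_mult powr_nonpos_limit LIMSEQ_Suc[OF tail_r_square]) auto
  moreover have "real (Suc n) powr (\<rho> - (2 * \<gamma> - 1)) * (real (Suc n) powr (2 * \<gamma> - 1) * x) = (rate (Suc n))\<^sup>2 * x" for n x
    unfolding rate_def power2_eq_square powr_add[symmetric] mult.assoc[symmetric] by simp
  ultimately show "(\<lambda>n. \<Sum>k. (coef (Suc n) (k + Suc n))\<^sup>2) \<longlonglongrightarrow> tail_limit"
    by (simp only: coef_square_tail) (auto simp: tail_limit_def split: if_splits)
qed

lemma coef_square_limit: "(\<lambda>n. \<Sum>k. (coef n k)\<^sup>2) \<longlonglongrightarrow> head_limit\<^sup>2 / (2 * decay) + tail_limit"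
proof -
  have "(\<Sum>k. (coef n k)\<^sup>2) = (\<Sum>k<n. (coef n k)\<^sup>2) + (\<Sum>k. (coef n (k + n))\<^sup>2)" for n
    using suminf_split_initial_segment[OF coef_square_summable, of n n] by (simp add: add.commute)
  then show ?thesis
    using tendsto_add[OF head_square_limit tail_square_limit] by simp
qed

text \<open>The head is \<open>head_cube_limit\<close>. In the tail the entries of row n are
  uniformly of order n^(\<rho>/2 - \<gamma>), a negative power, so the sum of cubes is at most such
  a bound times the convergent sum of squares.\<close>

lemma coef_cube_summable: "summable (\<lambda>k. \<bar>coef n k\<bar> ^ 3)"
  and coef_cube_limit: "(\<lambda>n. \<Sum>k. \<bar>coef n k\<bar> ^ 3) \<longlonglongrightarrow> 0"
proof -
  obtain B where B: "\<And>n. \<bar>real (Suc n) powr \<gamma> * r n\<bar> \<le> B"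
    using convergent_imp_Bseq[OF convergentI[OF r_asymp]] by (auto simp: Bseq_def)
  have B0: "0 \<le> B" using B[of 0] by linarith
  have coef_le: "\<bar>coef n (k + n)\<bar> \<le> B * real n powr (\<rho> / 2 - \<gamma>)" for n k
  \<comment> \<open>Row 0 is identically 0, because \<open>rate 0\<close> is 0.\<close>
  proof (cases "n = 0")
    case False
    have "r (k + n) = real (Suc (k + n)) powr (- \<gamma>) * (real (Suc (k + n)) powr \<gamma> * r (k + n))"
      by (simp add: powr_minus del: of_nat_Suc)
    also have "\<dots> \<le> real n powr (- \<gamma>) * B"
    proof (intro mult_mono)
      show "real (Suc (k + n)) powr (- \<gamma>) \<le> real n powr (- \<gamma>)"
        using False exponents by (intro powr_mono2') auto
      show "real (Suc (k + n)) powr \<gamma> * r (k + n) \<le> B"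
        using B[of "k + n"] by linarith
    qed (use r_range[of "k + n"] in auto)
    finally have "rate n * r (k + n) \<le> rate n * (real n powr (- \<gamma>) * B)"
      by (intro mult_left_mono) (auto simp: rate_def)
    also have "\<dots> = B * real n powr (\<rho> / 2 - \<gamma>)"
      by (simp add: rate_def diff_conv_add_uminus powr_add del: add_uminus_conv_diff)
    finally show ?thesis
      using r_range[of "k + n"] by (simp add: coef_def abs_mult rate_def)
  qed (simp add: coef_def rate_def)
  have cube_le: "\<bar>coef n (k + n)\<bar> ^ 3 \<le> B * real n powr (\<rho> / 2 - \<gamma>) * (coef n (k + n))\<^sup>2" for n k
    using mult_right_mono[OF coef_le, of "(coef n (k + n))\<^sup>2" n k] by (simp add: power3_eq_cube power2_eq_square)
  have sq: "summable (\<lambda>k. (coef n (k + n))\<^sup>2)" for n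
    using coef_square_summable[of n] by (simp only: summable_iff_shift[where f = "\<lambda>k. (coef n k)\<^sup>2"])
  have cu: "summable (\<lambda>k. \<bar>coef n (k + n)\<bar> ^ 3)" for n
    by (rule summable_comparison_test'[OF summable_mult[OF sq, of "B * real n powr (\<rho> / 2 - \<gamma>)"], where N = 0])
       (use cube_le in auto)
  then show all: "summable (\<lambda>k. \<bar>coef n k\<bar> ^ 3)" for n
    using summable_iff_shift[where f = "\<lambda>k. \<bar>coef n k\<bar> ^ 3" and k = n] by blast
  have tail: "(\<lambda>n. \<Sum>k. \<bar>coef n (k + n)\<bar> ^ 3) \<longlonglongrightarrow> 0"
  proof (rule tendsto_sandwich[OF _ _ tendsto_const])
    show "\<forall>\<^sub>F n in sequentially. 0 \<le> (\<Sum>k. \<bar>coef n (k + n)\<bar> ^ 3)"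
      by (intro always_eventually allI suminf_nonneg cu) auto
    show "\<forall>\<^sub>F n in sequentially. (\<Sum>k. \<bar>coef n (k + n)\<bar> ^ 3)
        \<le> B * real n powr (\<rho> / 2 - \<gamma>) * (\<Sum>k. (coef n (k + n))\<^sup>2)"
      unfolding suminf_mult[OF sq, symmetric]
      by (intro always_eventually allI suminf_le cube_le cu summable_mult sq)
    have "(\<lambda>n. B * real n powr (\<rho> / 2 - \<gamma>) * (\<Sum>k. (coef n (k + n))\<^sup>2)) \<longlonglongrightarrow> B * 0 * tail_limit"
      using exponents
      by (intro tendsto_intros tail_square_limit tendsto_neg_powr filterlim_real_sequentially) auto
    then show "(\<lambda>n. B * real n powr (\<rho> / 2 - \<gamma>) * (\<Sum>k. (coef n (k + n))\<^sup>2)) \<longlonglongrightarrow> 0" by simp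
  qed
  have "(\<Sum>k. \<bar>coef n k\<bar> ^ 3) = (\<Sum>k<n. \<bar>coef n k\<bar> ^ 3) + (\<Sum>k. \<bar>coef n (k + n)\<bar> ^ 3)" for n
    using suminf_split_initial_segment[OF all, of n n] by (simp add: add.commute)
  then show "(\<lambda>n. \<Sum>k. \<bar>coef n k\<bar> ^ 3) \<longlonglongrightarrow> 0"
    using tendsto_add[OF head_cube_limit tail] by simp
qed

end

subsection \<open>The interacting system\<close>

context finite_measure_subalgebra
begin

text \<open>Integrability is bundled with the almost sure identity, so that the closure rules below
  compose without separate integrability conditions.\<close>

definition has_cond_exp :: "('a \<Rightarrow> real) \<Rightarrow> ('a \<Rightarrow> real) \<Rightarrow> bool" where
  "has_cond_exp f g \<longleftrightarrow> integrable M f \<and> (AE x in M. real_cond_exp M F f x = g x)"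

lemma has_cond_exp_cong:
  assumes "has_cond_exp f g" "\<And>x. x \<in> space M \<Longrightarrow> f x = f' x" "\<And>x. x \<in> space M \<Longrightarrow> g x = g' x"
  shows "has_cond_exp f' g'"
proof -
  have int: "integrable M f" using assms(1) by (simp add: has_cond_exp_def)
  then have int': "integrable M f'"
    using assms(2) by (simp cong: Bochner_Integration.integrable_cong)
  have "AE x in M. real_cond_exp M F f x = real_cond_exp M F f' x"
    using int int' assms(2) by (intro real_cond_exp_cong) auto
  then have "AE x in M. real_cond_exp M F f' x = g' x"
    using assms(1)[unfolded has_cond_exp_def, THEN conjunct2] AE_space
    by eventually_elim (simp add: assms(3))
  then show ?thesis using int' by (simp add: has_cond_exp_def)
qed

lemma has_cond_exp_measurable:
  "integrable M f \<Longrightarrow> f \<in> borel_measurable F \<Longrightarrow> has_cond_exp f f"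
  by (simp add: has_cond_exp_def)

lemma has_cond_exp_add:
  assumes "has_cond_exp f g" "has_cond_exp f' g'"
  shows "has_cond_exp (\<lambda>x. f x + f' x) (\<lambda>x. g x + g' x)"
proof -
  have i: "integrable M f" "integrable M f'" using assms by (simp_all add: has_cond_exp_def)
  have "AE x in M. real_cond_exp M F (\<lambda>x. f x + f' x) x = g x + g' x"
    using real_cond_exp_add[OF i] assms[unfolded has_cond_exp_def, THEN conjunct2]
    by eventually_elim simp
  then show ?thesis using i by (simp add: has_cond_exp_def)
qed

lemma has_cond_exp_diff:
  assumes "has_cond_exp f g" "has_cond_exp f' g'"
  shows "has_cond_exp (\<lambda>x. f x - f' x) (\<lambda>x. g x - g' x)"
proof -
  have i: "integrable M f" "integrable M f'" using assms by (simp_all add: has_cond_exp_def)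
  have "AE x in M. real_cond_exp M F (\<lambda>x. f x - f' x) x = g x - g' x"
    using real_cond_exp_diff[OF i] assms[unfolded has_cond_exp_def, THEN conjunct2]
    by eventually_elim simp
  then show ?thesis using i by (simp add: has_cond_exp_def)
qed

lemma has_cond_exp_mult:
  assumes "has_cond_exp f g" and p: "p \<in> borel_measurable F" "\<And>x. x \<in> space M \<Longrightarrow> \<bar>p x\<bar> \<le> B"
  shows "has_cond_exp (\<lambda>x. p x * f x) (\<lambda>x. p x * g x)"
proof -
  have i: "integrable M f" using assms(1) by (simp add: has_cond_exp_def)
  have [measurable]: "p \<in> borel_measurable M" by (rule measurable_from_subalg[OF subalg p(1)])
  have ip: "integrable M (\<lambda>x. p x * f x)"
  proof (rule Bochner_Integration.integrable_bound[where f = "\<lambda>x. B * f x"])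
    show "AE x in M. norm (p x * f x) \<le> norm (B * f x)"
      using p(2) by (intro AE_I2) (auto simp: abs_mult intro!: mult_right_mono order_trans[OF p(2)])
  qed (use i in auto)
  have "AE x in M. real_cond_exp M F (\<lambda>x. p x * f x) x = p x * g x"
    using real_cond_exp_mult[OF p(1) borel_measurable_integrable[OF i] ip]
      assms(1)[unfolded has_cond_exp_def, THEN conjunct2]
    by eventually_elim simp
  then show ?thesis using ip by (simp add: has_cond_exp_def)
qed

lemma has_cond_exp_cmult: "has_cond_exp f g \<Longrightarrow> has_cond_exp (\<lambda>x. k * f x) (\<lambda>x. k * g x)"
  by (rule has_cond_exp_mult[where B = "\<bar>k\<bar>"]) auto

lemma has_cond_exp_sum:
  assumes "\<And>i. i \<in> I \<Longrightarrow> has_cond_exp (f i) (g i)"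
  shows "has_cond_exp (\<lambda>x. \<Sum>i\<in>I. f i x) (\<lambda>x. \<Sum>i\<in>I. g i x)"
proof -
  have zero: "has_cond_exp (\<lambda>_. 0) (\<lambda>_. 0)"
    by (rule has_cond_exp_measurable) auto
  from assms show ?thesis
    by (induction I rule: infinite_finite_induct) (use zero in \<open>auto intro: has_cond_exp_add\<close>)
qed

end

section \<open>The system as a source of bounded martingale differences\<close>

lemma sum_mult_le_one:
  fixes W z :: "nat \<Rightarrow> real"
  assumes "\<And>h. h < N \<Longrightarrow> 0 \<le> W h" "(\<Sum>h<N. W h) = 1" "\<And>h. h < N \<Longrightarrow> z h \<in> {0..1}"
  shows "(\<Sum>h<N. W h * z h) \<in> {0..1}"
proof -
  have "(\<Sum>h<N. W h * z h) \<le> (\<Sum>h<N. W h * 1)"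
    using assms by (intro sum_mono mult_left_mono) auto
  moreover have "0 \<le> (\<Sum>h<N. W h * z h)"
    using assms by (intro sum_nonneg mult_nonneg_nonneg) auto
  ultimately show ?thesis using assms(2) by simp
qed

locale reinforced_system = prob_space M for M :: "'a measure" +
  fixes N :: nat and W :: "real mat" and v :: "real Matrix.vec" and r a :: "nat \<Rightarrow> real"
    and X Z :: "nat \<Rightarrow> nat \<Rightarrow> 'a \<Rightarrow> real" and Z_inf :: "'a \<Rightarrow> real"
  assumes W_nonneg: "\<And>h j. h < N \<Longrightarrow> j < N \<Longrightarrow> 0 \<le> W $$ (h, j)"
    and W_columns: "\<And>j. j < N \<Longrightarrow> (\<Sum>h<N. W $$ (h, j)) = 1"
    and r_range: "\<And>n. 0 < r n \<and> r n < 1"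
    and a_pos: "\<And>k. 1 \<le> k \<Longrightarrow> 0 < a k"
    and Z0_meas: "\<And>j. j < N \<Longrightarrow> Z 0 j \<in> borel_measurable M"
    and Z0_range: "\<And>j \<omega>. j < N \<Longrightarrow> \<omega> \<in> space M \<Longrightarrow> Z 0 j \<omega> \<in> {0..1}"
    and X_meas: "\<And>n j. 1 \<le> n \<Longrightarrow> j < N \<Longrightarrow> X n j \<in> borel_measurable M"
    and X_range: "\<And>n j \<omega>. 1 \<le> n \<Longrightarrow> j < N \<Longrightarrow> \<omega> \<in> space M \<Longrightarrow> X n j \<omega> \<in> {0, 1}"
    and Z_rec: "\<And>n h \<omega>. 1 \<le> n \<Longrightarrow> h < N \<Longrightarrow> \<omega> \<in> space M \<Longrightarrow>
        Z n h \<omega> = (1 - r (n - 1)) * Z (n - 1) h \<omega> + r (n - 1) * X n h \<omega>"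
    and X_cond_indep: "\<And>n. cond_indep_vars M (rsp_filtration M N (Z 0) X n) (X (n + 1)) {..<N}"
    and X_cond_prob: "\<And>n j. j < N \<Longrightarrow>
        AE \<omega> in M. sigma_cond_prob M (rsp_filtration M N (Z 0) X n)
          {\<omega> \<in> space M. X (n + 1) j \<omega> = 1} \<omega> = (\<Sum>h<N. W $$ (h, j) * Z n h \<omega>)"
    and eigen: "\<And>h. h < N \<Longrightarrow> (\<Sum>j<N. W $$ (h, j) * v $ j) = v $ h"
    and normalized: "(\<Sum>j<N. v $ j) / sqrt (real N) = 1"
    and Zinf_meas [measurable]: "Z_inf \<in> borel_measurable M"
    and Zinf_range: "\<And>\<omega>. \<omega> \<in> space M \<Longrightarrow> Z_inf \<omega> \<in> {0..1}"
    and Zinf_limit: "AE \<omega> in M. \<forall>j<N. (\<lambda>n. Z n j \<omega>) \<longlonglongrightarrow> Z_inf \<omega>"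
begin

abbreviation \<F> :: "nat \<Rightarrow> 'a measure" where
  "\<F> n \<equiv> rsp_filtration M N (Z 0) X n"

definition w :: "nat \<Rightarrow> real" where
  "w j = v $ j / sqrt (real N)"

definition P :: "nat \<Rightarrow> nat \<Rightarrow> 'a \<Rightarrow> real" where
  "P n j \<omega> = (\<Sum>h<N. W $$ (h, j) * Z n h \<omega>)"

definition Zt :: "nat \<Rightarrow> 'a \<Rightarrow> real" where
  "Zt n \<omega> = (\<Sum>j<N. w j * Z n j \<omega>)"

definition D :: "nat \<Rightarrow> 'a \<Rightarrow> real" where
  "D n \<omega> = (\<Sum>j<N. w j * (X (Suc n) j \<omega> - P n j \<omega>))"

definition V :: "nat \<Rightarrow> 'a \<Rightarrow> real" where
  "V n \<omega> = (\<Sum>j<N. (w j)\<^sup>2 * (P n j \<omega> * (1 - P n j \<omega>)))"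

abbreviation V_lim :: "'a \<Rightarrow> real" where
  "V_lim \<omega> \<equiv> (\<Sum>j<N. (w j)\<^sup>2) * (Z_inf \<omega> * (1 - Z_inf \<omega>))"

lemma sum_w: "(\<Sum>j<N. w j) = 1"
  using normalized by (simp add: w_def sum_divide_distrib)

lemma eigen_w: "h < N \<Longrightarrow> (\<Sum>j<N. W $$ (h, j) * w j) = w h"
  using eigen[of h] by (simp add: w_def flip: sum_divide_distrib)

lemma space_F [simp]: "space (\<F> n) = space M"
  by (simp add: rsp_filtration_def space_measure_of_conv)

lemma sets_F: "sets (\<F> n) = sigma_sets (space M)
     ({Z 0 h -` B \<inter> space M | h B. h < N \<and> B \<in> sets borel} \<union>
      {X k j -` B \<inter> space M | k j B. 1 \<le> k \<and> k \<le> n \<and> j < N \<and> B \<in> sets borel})"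
  unfolding rsp_filtration_def by (rule sets_measure_of) auto

lemma F_Suc: "sets (\<F> n) \<subseteq> sets (\<F> (Suc n))"
  unfolding sets_F by (intro sigma_sets_mono' Un_mono subset_refl) (blast intro: le_SucI)

lemma subalg: "subalgebra M (\<F> n)"
proof -
  have "Z 0 h -` B \<inter> space M \<in> sets M" if "h < N" "B \<in> sets borel" for h B
    using measurable_sets[OF Z0_meas[OF that(1)] that(2)] .
  moreover have "X k j -` B \<inter> space M \<in> sets M" if "1 \<le> k" "j < N" "B \<in> sets borel" for k j B
    using measurable_sets[OF X_meas[OF that(1,2)] that(3)] .
  ultimately have "sets (\<F> n) \<subseteq> sets M"
    unfolding sets_F by (intro sets.sigma_sets_subset) blast
  then show ?thesis by (simp add: subalgebra_def)
qed

lemma Z0_measurable_F: "h < N \<Longrightarrow> Z 0 h \<in> borel_measurable (\<F> n)"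
  by (rule measurableI) (auto simp: sets_F intro!: sigma_sets.Basic)

lemma X_measurable_F: "1 \<le> k \<Longrightarrow> k \<le> n \<Longrightarrow> j < N \<Longrightarrow> X k j \<in> borel_measurable (\<F> n)"
  by (rule measurableI) (auto simp: sets_F intro!: sigma_sets.Basic)

lemma Z_Suc: "h < N \<Longrightarrow> \<omega> \<in> space M \<Longrightarrow>
    Z (Suc n) h \<omega> = (1 - r n) * Z n h \<omega> + r n * X (Suc n) h \<omega>"
  using Z_rec[of "Suc n" h \<omega>] by simp

lemma Z_measurable_F: "h < N \<Longrightarrow> k \<le> n \<Longrightarrow> Z k h \<in> borel_measurable (\<F> n)"
proof (induction k)
  case 0
  then show ?case by (intro Z0_measurable_F)
next
  case (Suc k)
  have [measurable]: "Z k h \<in> borel_measurable (\<F> n)" "X (Suc k) h \<in> borel_measurable (\<F> n)"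
    using Suc by (auto intro!: X_measurable_F)
  have "(\<lambda>\<omega>. (1 - r k) * Z k h \<omega> + r k * X (Suc k) h \<omega>) \<in> borel_measurable (\<F> n)"
    by measurable
  also have "?this \<longleftrightarrow> ?case"
    using Suc.prems by (intro measurable_cong) (simp add: Z_Suc)
  finally show ?case .
qed

lemma Z_range: "h < N \<Longrightarrow> \<omega> \<in> space M \<Longrightarrow> Z n h \<omega> \<in> {0..1}"
proof (induction n)
  case (Suc n)
  then have Z: "Z n h \<omega> \<in> {0..1}" and X: "X (Suc n) h \<omega> \<in> {0, 1}"
    using X_range[of "Suc n" h \<omega>] by auto
  have "(1 - r n) * Z n h \<omega> + r n * X (Suc n) h \<omega> \<le> (1 - r n) * 1 + r n * 1"
    using Z X r_range[of n] by (intro add_mono mult_left_mono) auto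
  moreover have "0 \<le> (1 - r n) * Z n h \<omega> + r n * X (Suc n) h \<omega>"
    using Z X r_range[of n] by (intro add_nonneg_nonneg mult_nonneg_nonneg) auto
  ultimately show ?case using Suc.prems by (simp add: Z_Suc)
qed (use Z0_range in auto)

lemma P_measurable_F: "j < N \<Longrightarrow> P n j \<in> borel_measurable (\<F> n)"
  unfolding P_def by (intro borel_measurable_sum borel_measurable_times borel_measurable_const Z_measurable_F) auto

lemma P_range: "j < N \<Longrightarrow> \<omega> \<in> space M \<Longrightarrow> P n j \<omega> \<in> {0..1}"
  unfolding P_def using W_nonneg W_columns Z_range by (intro sum_mult_le_one) auto

lemma measurable_F_M: "f \<in> borel_measurable (\<F> n) \<Longrightarrow> f \<in> borel_measurable M"
  by (rule measurable_from_subalg[OF subalg])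

text \<open>The \<open>X (Suc n) j\<close> take only the values 0 and 1, so they and their products
  coincide with indicators of the events \<open>E J\<close>, whose conditional probabilities are
  prescribed. On the diagonal the square of an indicator is the indicator itself.\<close>

lemma conditional_moments:
  assumes ij: "i < N" "j < N"
  shows "finite_measure_subalgebra.has_cond_exp M (\<F> n) (X (Suc n) i) (P n i)"
    and "finite_measure_subalgebra.has_cond_exp M (\<F> n)
       (\<lambda>\<omega>. (X (Suc n) i \<omega> - P n i \<omega>) * (X (Suc n) j \<omega> - P n j \<omega>))
       (\<lambda>\<omega>. if i = j then P n i \<omega> * (1 - P n i \<omega>) else 0)"
proof -
  interpret F: finite_measure_subalgebra M "\<F> n"
    by unfold_locales (rule subalg)
  have Xm: "X (Suc n) j \<in> borel_measurable M" if "j < N" for j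
    using that X_meas[of "Suc n"] by simp
  have X01: "X (Suc n) j \<omega> \<in> {0, 1}" if "j < N" "\<omega> \<in> space M" for j \<omega>
    using that X_range[of "Suc n"] by simp
  define E where "E J = {\<omega> \<in> space M. \<forall>j\<in>J. X (Suc n) j \<omega> = 1}" for J
  have E_meas: "E J \<in> sets M" if "J \<subseteq> {..<N}" for J
  proof -
    have "finite J" using that finite_subset by blast
    have "{\<omega> \<in> space M. X (Suc n) j \<omega> = 1} \<in> sets M" if "j \<in> J" for j
      using Xm[of j] that \<open>J \<subseteq> {..<N}\<close> by (auto intro!: borel_measurable_eq)
    then show ?thesis
      unfolding E_def using \<open>finite J\<close> by (intro sets.sets_Collect_finite_All) auto
  qed
  have E1: "F.has_cond_exp (indicator (E {j})) (P n j)" if "j < N" for j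
    using X_cond_prob[OF \<open>j < N\<close>, of n] E_meas[of "{j}"] that
    by (simp add: F.has_cond_exp_def sigma_cond_prob_def E_def P_def emeasure_eq_measure)
  have X1: "F.has_cond_exp (X (Suc n) j) (P n j)" if "j < N" for j
    by (rule F.has_cond_exp_cong[OF E1[OF that]]) (use X01[OF that] in \<open>auto simp: E_def indicator_def\<close>)
  then show "F.has_cond_exp (X (Suc n) i) (P n i)" using ij by blast
  have X2: "F.has_cond_exp (\<lambda>\<omega>. X (Suc n) i \<omega> * X (Suc n) j \<omega>) (\<lambda>\<omega>. if i = j then P n i \<omega> else P n i \<omega> * P n j \<omega>)"
  proof (cases "i = j")
    case True
    show ?thesis
      by (rule F.has_cond_exp_cong[OF X1[OF ij(1)]]) (use X01[OF ij(1)] True in auto)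
  next
    case False
    \<comment> \<open>Conditional independence enters only here: for two distinct vertices, with the
      event that both variables equal 1.\<close>
    have "AE \<omega> in M. sigma_cond_prob M (\<F> n) {\<omega> \<in> space M. \<forall>k\<in>{i, j}. X (n + 1) k \<omega> \<in> {1}} \<omega> =
           (\<Prod>k\<in>{i, j}. sigma_cond_prob M (\<F> n) {\<omega> \<in> space M. X (n + 1) k \<omega> \<in> {1}} \<omega>)"
      using X_cond_indep[of n, unfolded cond_indep_vars_def, rule_format, of "{i, j}" "\<lambda>_. {1}"] ij by auto
    then have "AE \<omega> in M. real_cond_exp M (\<F> n) (indicator (E {i, j})) \<omega> = P n i \<omega> * P n j \<omega>"
      using X_cond_prob[OF ij(1), of n] X_cond_prob[OF ij(2), of n]
    proof eventually_elim
      case (elim \<omega>)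
      then show ?case using False by (simp add: sigma_cond_prob_def E_def P_def)
    qed
    then have "F.has_cond_exp (indicator (E {i, j})) (\<lambda>\<omega>. P n i \<omega> * P n j \<omega>)"
      using E_meas[of "{i, j}"] ij by (simp add: F.has_cond_exp_def emeasure_eq_measure)
    then show ?thesis
      by (rule F.has_cond_exp_cong)
         (use X01[OF ij(1)] X01[OF ij(2)] False in \<open>auto simp: E_def indicator_def\<close>)
  qed
  have Pb: "\<bar>P n k \<omega>\<bar> \<le> 1" if "k < N" "\<omega> \<in> space M" for k \<omega>
    using P_range[OF that, of n] by auto
  have PX: "F.has_cond_exp (\<lambda>\<omega>. P n k \<omega> * X (Suc n) l \<omega>) (\<lambda>\<omega>. P n k \<omega> * P n l \<omega>)" if "k < N" "l < N" for k l
    by (rule F.has_cond_exp_mult[OF X1[OF that(2)] P_measurable_F[OF that(1)] Pb[OF that(1)]])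
  have PP: "F.has_cond_exp (\<lambda>\<omega>. P n i \<omega> * P n j \<omega>) (\<lambda>\<omega>. P n i \<omega> * P n j \<omega>)"
  proof (rule F.has_cond_exp_measurable)
    show m: "(\<lambda>\<omega>. P n i \<omega> * P n j \<omega>) \<in> borel_measurable (\<F> n)"
      using ij by (intro borel_measurable_times P_measurable_F)
    show "integrable M (\<lambda>\<omega>. P n i \<omega> * P n j \<omega>)"
    proof (rule integrable_bounded[where B = 1, OF measurable_F_M[OF m]])
      fix \<omega> assume "\<omega> \<in> space M"
      from mult_mono[OF Pb[OF ij(1) this] Pb[OF ij(2) this]]
      show "norm (P n i \<omega> * P n j \<omega>) \<le> 1" by (simp add: abs_mult)
    qed
  qed
  \<comment> \<open>The product is expanded into four terms, in each of which the factors
    \<open>P\<close> are known at time \<open>n\<close>.\<close>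
  show "F.has_cond_exp (\<lambda>\<omega>. (X (Suc n) i \<omega> - P n i \<omega>) * (X (Suc n) j \<omega> - P n j \<omega>))
       (\<lambda>\<omega>. if i = j then P n i \<omega> * (1 - P n i \<omega>) else 0)"
    by (rule F.has_cond_exp_cong[OF F.has_cond_exp_add[OF F.has_cond_exp_diff[OF F.has_cond_exp_diff[OF X2 PX[OF ij]] PX[OF ij(2,1)]] PP]])
       (auto simp: algebra_simps)
qed

text \<open>Conditional covariances of distinct vertices vanish, so only the diagonal of the squared
  sum contributes to \<open>V\<close>. The square of the constant dominates \<open>V\<close> because
  the L2 norm of \<open>w\<close> is at most its L1 norm.\<close>

sublocale bounded_martingale_differences M \<F> D V "\<Sum>j<N. \<bar>w j\<bar>"
proof unfold_locales
  show "subalgebra M (\<F> n)" for n by (rule subalg)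
  show "sets (\<F> n) \<subseteq> sets (\<F> (Suc n))" for n by (rule F_Suc)
  have P_Suc: "P n j \<in> borel_measurable (\<F> (Suc n))" if "j < N" for n j
    using P_measurable_F[OF that, of n] F_Suc[of n] by (auto simp: measurable_def)
  show "D n \<in> borel_measurable (\<F> (Suc n))" for n
    unfolding D_def
    by (intro borel_measurable_sum borel_measurable_times borel_measurable_diff borel_measurable_const X_measurable_F P_Suc) auto
  show "V n \<in> borel_measurable (\<F> n)" for n
    unfolding V_def
    by (intro borel_measurable_sum borel_measurable_times borel_measurable_diff borel_measurable_const P_measurable_F) auto
  fix n \<omega>
  assume \<omega>: "\<omega> \<in> space M"
  have P: "P n j \<omega> \<in> {0..1}" if "j < N" for j using P_range[OF that \<omega>] .
  have "\<bar>X (Suc n) j \<omega> - P n j \<omega>\<bar> \<le> 1" if "j < N" for j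
    using P[OF that] X_range[of "Suc n" j \<omega>] that \<omega> by auto
  then have "\<bar>w j * (X (Suc n) j \<omega> - P n j \<omega>)\<bar> \<le> \<bar>w j\<bar>" if "j < N" for j
    using mult_left_mono[of "\<bar>X (Suc n) j \<omega> - P n j \<omega>\<bar>" 1 "\<bar>w j\<bar>"] that by (simp add: abs_mult)
  then show "\<bar>D n \<omega>\<bar> \<le> (\<Sum>j<N. \<bar>w j\<bar>)"
    unfolding D_def by (intro order_trans[OF sum_abs] sum_mono) auto
  have "0 \<le> V n \<omega>"
    unfolding V_def using P by (intro sum_nonneg mult_nonneg_nonneg) auto
  moreover have "V n \<omega> \<le> (\<Sum>j<N. \<bar>w j\<bar>)\<^sup>2"
  proof -
    have "V n \<omega> \<le> (\<Sum>j<N. (w j)\<^sup>2 * (1 * 1))"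
      unfolding V_def using P by (intro sum_mono mult_left_mono mult_mono) auto
    also have "\<dots> = (L2_set (\<lambda>j. \<bar>w j\<bar>) {..<N})\<^sup>2"
      by (simp add: L2_set_def sum_nonneg)
    also have "\<dots> \<le> (\<Sum>j<N. \<bar>w j\<bar>)\<^sup>2"
      by (intro power_mono L2_set_le_sum) (auto simp: L2_set_nonneg)
    finally show ?thesis .
  qed
  ultimately show "0 \<le> V n \<omega> \<and> V n \<omega> \<le> (\<Sum>j<N. \<bar>w j\<bar>)\<^sup>2" ..
next
  fix n
  interpret F: finite_measure_subalgebra M "\<F> n"
    by unfold_locales (rule subalg)
  have PP: "F.has_cond_exp (P n j) (P n j)" if "j < N" for j
  proof (rule F.has_cond_exp_measurable)
    show "integrable M (P n j)"
      by (rule integrable_bounded[where B = 1, OF measurable_F_M[OF P_measurable_F[OF that]]])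
         (use P_range[OF that, of _ n] in auto)
  qed (rule P_measurable_F[OF that])
  have "F.has_cond_exp (D n) (\<lambda>\<omega>. \<Sum>j<N. w j * (P n j \<omega> - P n j \<omega>))"
    unfolding D_def
    by (intro F.has_cond_exp_sum F.has_cond_exp_cmult F.has_cond_exp_diff PP conditional_moments) auto
  then show "AE \<omega> in M. real_cond_exp M (\<F> n) (D n) \<omega> = 0"
    by (simp add: F.has_cond_exp_def)
  let ?Y = "\<lambda>j \<omega>. X (Suc n) j \<omega> - P n j \<omega>"
  have "F.has_cond_exp (\<lambda>\<omega>. \<Sum>i<N. \<Sum>j<N. w i * w j * (?Y i \<omega> * ?Y j \<omega>))
     (\<lambda>\<omega>. \<Sum>i<N. \<Sum>j<N. w i * w j * (if i = j then P n i \<omega> * (1 - P n i \<omega>) else 0))"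
    by (intro F.has_cond_exp_sum F.has_cond_exp_cmult conditional_moments) auto
  then have "F.has_cond_exp (\<lambda>\<omega>. (D n \<omega>)\<^sup>2) (V n)"
  proof (rule F.has_cond_exp_cong)
    show "(\<Sum>i<N. \<Sum>j<N. w i * w j * (?Y i \<omega> * ?Y j \<omega>)) = (D n \<omega>)\<^sup>2" for \<omega>
      unfolding D_def power2_eq_square sum_product by (intro sum.cong refl) (simp add: mult_ac)
    show "(\<Sum>i<N. \<Sum>j<N. w i * w j * (if i = j then P n i \<omega> * (1 - P n i \<omega>) else 0)) = V n \<omega>" for \<omega>
      unfolding V_def by (intro sum.cong refl) (simp add: if_distrib power2_eq_square cong: if_cong)
  qed
  then show "AE \<omega> in M. real_cond_exp M (\<F> n) (\<lambda>\<omega>. (D n \<omega>)\<^sup>2) \<omega> = V n \<omega>"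
    by (simp add: F.has_cond_exp_def)
qed

text \<open>After exchanging the sums, the eigenvector equation turns the weighted average of the
  \<open>P n j\<close> into \<open>Zt n\<close> itself. This makes \<open>Zt\<close> a martingale
  with increments \<open>r n * D n\<close>.\<close>

lemma Zt_Suc:
  assumes "\<omega> \<in> space M"
  shows "Zt (Suc n) \<omega> = Zt n \<omega> + r n * D n \<omega>"
    and "D n \<omega> = (\<Sum>j<N. w j * X (Suc n) j \<omega>) - Zt n \<omega>"
proof -
  have "(\<Sum>j<N. w j * P n j \<omega>) = (\<Sum>j<N. \<Sum>h<N. (W $$ (h, j) * w j) * Z n h \<omega>)"
    by (simp add: P_def sum_distrib_left mult_ac)
  also have "\<dots> = (\<Sum>h<N. (\<Sum>j<N. W $$ (h, j) * w j) * Z n h \<omega>)"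
    by (subst sum.swap) (simp add: sum_distrib_right)
  also have "\<dots> = Zt n \<omega>"
    by (simp add: eigen_w Zt_def)
  finally show D: "D n \<omega> = (\<Sum>j<N. w j * X (Suc n) j \<omega>) - Zt n \<omega>"
    by (simp add: D_def right_diff_distrib sum_subtractf)
  show "Zt (Suc n) \<omega> = Zt n \<omega> + r n * D n \<omega>"
    unfolding D using assms
    by (simp add: Zt_def Z_Suc algebra_simps sum.distrib sum_subtractf sum_distrib_left)
qed

lemma Zt_tendsto: "AE \<omega> in M. (\<lambda>n. Zt n \<omega>) \<longlonglongrightarrow> Z_inf \<omega>"
  using Zinf_limit
proof eventually_elim
  case (elim \<omega>)
  then have "(\<lambda>n. Zt n \<omega>) \<longlonglongrightarrow> (\<Sum>j<N. w j * Z_inf \<omega>)"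
    unfolding Zt_def by (intro tendsto_intros) auto
  then show ?case by (simp add: sum_w flip: sum_distrib_right)
qed

lemma V_tendsto: "AE \<omega> in M. (\<lambda>n. V n \<omega>) \<longlonglongrightarrow> V_lim \<omega>"
  using Zinf_limit
proof eventually_elim
  case (elim \<omega>)
  have "(\<lambda>n. P n j \<omega>) \<longlonglongrightarrow> Z_inf \<omega>" if "j < N" for j
  proof -
    have "(\<lambda>n. P n j \<omega>) \<longlonglongrightarrow> (\<Sum>h<N. W $$ (h, j) * Z_inf \<omega>)"
      unfolding P_def using elim by (intro tendsto_intros) auto
    then show ?thesis using W_columns[OF that] by (simp flip: sum_distrib_right)
  qed
  then have "(\<lambda>n. V n \<omega>) \<longlonglongrightarrow> (\<Sum>j<N. (w j)\<^sup>2 * (Z_inf \<omega> * (1 - Z_inf \<omega>)))"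
    unfolding V_def by (intro tendsto_intros) auto
  then show ?case by (simp add: sum_distrib_right)
qed

lemma emp_mean_tilde_eq:
  "emp_mean_tilde N v a X n \<omega> = (\<Sum>k<n. a (Suc k) * (\<Sum>j<N. w j * X (Suc k) j \<omega>)) / (\<Sum>l=1..n. a l)"
proof -
  have "emp_mean_tilde N v a X n \<omega> = (\<Sum>j<N. w j * (\<Sum>k=1..n. a k * X k j \<omega>)) / (\<Sum>l=1..n. a l)"
    by (simp add: emp_mean_tilde_def emp_mean_def emp_weight_def w_def sum_divide_distrib sum_distrib_left
        field_simps)
  also have "(\<Sum>j<N. w j * (\<Sum>k=1..n. a k * X k j \<omega>)) = (\<Sum>k=1..n. a k * (\<Sum>j<N. w j * X k j \<omega>))"
    unfolding sum_distrib_left by (subst sum.swap) (simp add: mult_ac)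
  also have "\<dots> = (\<Sum>k<n. a (Suc k) * (\<Sum>j<N. w j * X (Suc k) j \<omega>))"
    by (simp only: One_nat_def sum.atLeast1_atMost_eq)
  finally show ?thesis .
qed

lemma measurable_emp_mean_tilde [measurable]: "emp_mean_tilde N v a X n \<in> borel_measurable M"
  unfolding emp_mean_tilde_eq[abs_def]
  by (intro borel_measurable_divide borel_measurable_sum borel_measurable_times borel_measurable_const X_meas) auto

end

section \<open>The rescaled error as a weighted series of martingale differences\<close>

locale reinforced_system_asymptotics = reinforced_system + step_sizes
begin

text \<open>Multiplication by \<open>total n\<close> clears the denominators of the averages. The
  step to \<open>Suc n\<close> then adds \<open>a (Suc n) * D n \<omega>\<close> for the new
  observation and subtracts \<open>total (Suc n) * r n * D n \<omega>\<close> for the motion of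
  \<open>Zt\<close>.\<close>

lemma head_identity:
  assumes \<omega>: "\<omega> \<in> space M"
  shows "total n * (emp_mean_tilde N v a X n \<omega> - Zt n \<omega>) = (\<Sum>k<n. total (Suc k) * (weight k - r k) * D k \<omega>)"
proof (cases "n = 0")
  case False
  have "(\<Sum>k<n. a (Suc k) * (\<Sum>j<N. w j * X (Suc k) j \<omega>)) - total n * Zt n \<omega>
      = (\<Sum>k<n. total (Suc k) * (weight k - r k) * D k \<omega>)"
  proof (induction n)
    case 0
    then show ?case by (simp add: total_def)
  next
    case (Suc n)
    have "total (Suc n) * weight n = a (Suc n)"
      using total_pos[of "Suc n"] by (simp add: emp_weight_def total_def)
    then have "total (Suc n) * (weight n - r n) * D n \<omega> = a (Suc n) * D n \<omega> - total (Suc n) * r n * D n \<omega>"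
      by (simp add: algebra_simps)
    moreover have "(\<Sum>j<N. w j * X (Suc n) j \<omega>) = D n \<omega> + Zt n \<omega>"
      using Zt_Suc(2)[OF \<omega>, of n] by simp
    ultimately show ?case
      using Suc by (simp add: Zt_Suc(1)[OF \<omega>] total_Suc algebra_simps)
  qed
  then show ?thesis
    unfolding emp_mean_tilde_eq total_def[symmetric]
    using total_pos[of n] False by (simp add: right_diff_distrib)
qed (simp add: total_def)

text \<open>The terms with k < n are given by \<open>head_identity\<close>. Each later term is minus
  \<open>rate n\<close> times one increment of \<open>Zt\<close>, so it only moves the reference
  point from \<open>Zt n\<close> towards \<open>Zt K\<close>.\<close>

lemma partial_sum:
  assumes \<omega>: "\<omega> \<in> space M" and "n \<le> K"
  shows "(\<Sum>k<K. coef n k * D k \<omega>) = rate n * (emp_mean_tilde N v a X n \<omega> - Zt K \<omega>)"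
proof (cases "n = 0")
  case True
  then show ?thesis by (simp add: coef_def rate_def)
next
  case False
  have "(\<Sum>k<n. coef n k * D k \<omega>) = rate n / total n * (\<Sum>k<n. total (Suc k) * (weight k - r k) * D k \<omega>)"
    unfolding sum_distrib_left by (intro sum.cong) (auto simp: coef_def)
  also have "\<dots> = rate n * (emp_mean_tilde N v a X n \<omega> - Zt n \<omega>)"
    using total_pos[of n] False unfolding head_identity[OF \<omega>, symmetric] by simp
  finally have head: "(\<Sum>k<n. coef n k * D k \<omega>) = rate n * (emp_mean_tilde N v a X n \<omega> - Zt n \<omega>)" .
  show ?thesis
    using \<open>n \<le> K\<close>
  proof (induction K rule: dec_induct)
    case base
    show ?case by (rule head)
  next
    case (step K)
    then show ?case by (simp add: coef_def Zt_Suc(1)[OF \<omega>] algebra_simps)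
  qed
qed

lemma coef_sums:
  "AE \<omega> in M. (\<lambda>k. coef n k * D k \<omega>) sums (rate n * (emp_mean_tilde N v a X n \<omega> - Z_inf \<omega>))"
  using Zt_tendsto AE_space
proof eventually_elim
  case (elim \<omega>)
  have "(\<lambda>K. rate n * (emp_mean_tilde N v a X n \<omega> - Zt K \<omega>)) \<longlonglongrightarrow> rate n * (emp_mean_tilde N v a X n \<omega> - Z_inf \<omega>)"
    using elim by (intro tendsto_intros)
  then show ?case
    unfolding sums_def
    by (rule Lim_transform_eventually)
       (use eventually_ge_at_top[of n] in \<open>eventually_elim, simp add: partial_sum elim\<close>)
qed

lemma stable_conv_rate:
  "stable_conv M (\<lambda>n \<omega>. rate n * (emp_mean_tilde N v a X n \<omega> - Z_inf \<omega>))
     (\<lambda>\<omega>. centred_normal ((head_limit\<^sup>2 / (2 * decay) + tail_limit) * V_lim \<omega>))"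
proof -
  interpret S: weighted_martingale_series M \<F> D V "\<Sum>j<N. \<bar>w j\<bar>" coef
    "head_limit\<^sup>2 / (2 * decay) + tail_limit"
    "\<lambda>n \<omega>. rate n * (emp_mean_tilde N v a X n \<omega> - Z_inf \<omega>)" V_lim
    by unfold_locales
       (use coef_square_summable coef_cube_summable coef_square_limit coef_cube_limit coef_sums V_tendsto in auto)
  show ?thesis
  proof (rule stable_conv_centred_normalI)
    fix \<omega> assume "\<omega> \<in> space M"
    then have "0 \<le> V_lim \<omega>"
      using Zinf_range[of \<omega>] by (intro mult_nonneg_nonneg sum_nonneg) auto
    then show "0 \<le> (head_limit\<^sup>2 / (2 * decay) + tail_limit) * V_lim \<omega>"
      using S.s_nonneg by (rule mult_nonneg_nonneg[rotated])
  next
    show "(\<lambda>n. \<integral>\<omega>. indicator H \<omega> *\<^sub>R iexp (u * (rate n * (emp_mean_tilde N v a X n \<omega> - Z_inf \<omega>))) \<partial>M)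
      \<longlonglongrightarrow> (\<integral>\<omega>. indicator H \<omega> *\<^sub>R
        complex_of_real (exp (- (u\<^sup>2 * ((head_limit\<^sup>2 / (2 * decay) + tail_limit) * V_lim \<omega>) / 2))) \<partial>M)"
      if "H \<in> sets M" for u H
      using S.stable_limit[OF that, of u] by (simp only: mult.assoc)
  qed measurable
qed

end

section \<open>Matching the regimes with the limit variances\<close>

theorem theorem4p1:
  fixes N :: nat and W :: "real mat" and M :: "'a measure"
    and r a :: "nat \<Rightarrow> real" and X Z :: "nat \<Rightarrow> nat \<Rightarrow> 'a \<Rightarrow> real" and Z_inf :: "'a \<Rightarrow> real"
    and v\<^sub>1 :: "real Matrix.vec" and lam :: "nat \<Rightarrow> complex" and lam_star :: complex
    and \<gamma> \<nu> c q :: real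
  assumes N: "N \<ge> 2"
    and W_carrier: "W \<in> carrier_mat N N"
    and W_nonneg: "\<And>h j. h < N \<Longrightarrow> j < N \<Longrightarrow> W $$ (h, j) \<ge> 0"
    and W_columns: "\<And>j. j < N \<Longrightarrow> (\<Sum>h<N. W $$ (h, j)) = 1"
    and r_range: "\<And>n. 0 < r n \<and> r n < 1"
    and a_pos: "\<And>k. k \<ge> 1 \<Longrightarrow> a k > 0"
    and prob: "prob_space M"
    and Z0_meas: "\<And>j. j < N \<Longrightarrow> Z 0 j \<in> borel_measurable M"
    and Z0_range: "\<And>j \<omega>. j < N \<Longrightarrow> \<omega> \<in> space M \<Longrightarrow> Z 0 j \<omega> \<in> {0..1}"
    and X_meas: "\<And>n j. n \<ge> 1 \<Longrightarrow> j < N \<Longrightarrow> X n j \<in> borel_measurable M"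
    and X_range: "\<And>n j \<omega>. n \<ge> 1 \<Longrightarrow> j < N \<Longrightarrow> \<omega> \<in> space M \<Longrightarrow> X n j \<omega> \<in> {0, 1}"
    and Z_rec: "\<And>n h \<omega>. n \<ge> 1 \<Longrightarrow> h < N \<Longrightarrow> \<omega> \<in> space M \<Longrightarrow>
        Z n h \<omega> = (1 - r (n - 1)) * Z (n - 1) h \<omega> + r (n - 1) * X n h \<omega>"
    and X_cond_indep: "\<And>n. cond_indep_vars M (rsp_filtration M N (Z 0) X n) (X (n + 1)) {..<N}"
    and X_cond_prob: "\<And>n j. j < N \<Longrightarrow>
        AE \<omega> in M. sigma_cond_prob M (rsp_filtration M N (Z 0) X n)
          {\<omega> \<in> space M. X (n + 1) j \<omega> = 1} \<omega> = (\<Sum>h<N. W $$ (h, j) * Z n h \<omega>)"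
    and A1: "irreducible_mat W" "diagonalizable_mat (complex_mat W)"
    and A2_ranges: "1/2 < \<gamma>" "\<gamma> \<le> 1" "1/2 < \<nu>" "\<nu> \<le> 1" "c > 0" "q > 0"
    and A2_r: "(\<lambda>n. r (n - 1) - c * real n powr (-\<gamma>)) \<in> O(\<lambda>n. real n powr (-2 * \<gamma>))"
    and A2_q: "(\<lambda>n. emp_weight a n n - q * real n powr (-\<nu>)) \<in> O(\<lambda>n. real n powr (-2 * \<nu>))"
    and lam_star: "eigenvalue (complex_mat W) lam_star" "lam_star \<noteq> 1"
        "\<And>\<mu>. eigenvalue (complex_mat W) \<mu> \<Longrightarrow> \<mu> \<noteq> 1 \<Longrightarrow> Re \<mu> \<le> Re lam_star"
    and A3: "\<gamma> = 1 \<Longrightarrow> c > 1 / (2 * (1 - Re lam_star))" "\<nu> = 1 \<Longrightarrow> q > 1/2"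
    and lam: "char_poly (complex_mat W) = (\<Prod>j<N. [:- lam j, 1:])" "lam 0 = 1"
    and A4: "\<And>j. \<nu> = \<gamma> \<Longrightarrow> 1 \<le> j \<Longrightarrow> j < N \<Longrightarrow>
        complex_of_real q \<noteq> complex_of_real c * (1 - lam j)"
    and v1: "eigenvector W v\<^sub>1 1" "(\<Sum>j<N. v\<^sub>1 $ j) / sqrt (real N) = 1"
    and Zinf_meas: "Z_inf \<in> borel_measurable M"
    and Zinf_range: "\<And>\<omega>. \<omega> \<in> space M \<Longrightarrow> Z_inf \<omega> \<in> {0..1}"
    and Zinf_limit: "AE \<omega> in M. \<forall>j<N. (\<lambda>n. Z n j \<omega>) \<longlonglongrightarrow> Z_inf \<omega>"
  shows
    "(\<nu> < gamma0 \<gamma> \<longrightarrow>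
        stable_conv M
          (\<lambda>n \<omega>. real n powr (\<nu> / 2) * (emp_mean_tilde N v\<^sub>1 a X n \<omega> - Z_inf \<omega>))
          (\<lambda>\<omega>. centred_normal (Z_inf \<omega> * (1 - Z_inf \<omega>) * sigma2 N v\<^sub>1 c q \<gamma> \<nu>))) \<and>
     (gamma0 \<gamma> < \<nu> \<and> \<nu> < 1 \<longrightarrow>
        stable_conv M
          (\<lambda>n \<omega>. real n powr (\<gamma> - 1/2) * (emp_mean_tilde N v\<^sub>1 a X n \<omega> - Z_inf \<omega>))
          (\<lambda>\<omega>. centred_normal (Z_inf \<omega> * (1 - Z_inf \<omega>) * sigma2_gamma N v\<^sub>1 c \<gamma>))) \<and>
     (\<nu> = gamma0 \<gamma> \<or> \<nu> = 1 \<longrightarrow>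
        stable_conv M
          (\<lambda>n \<omega>. real n powr (\<gamma> - 1/2) * (emp_mean_tilde N v\<^sub>1 a X n \<omega> - Z_inf \<omega>))
          (\<lambda>\<omega>. centred_normal (Z_inf \<omega> * (1 - Z_inf \<omega>) *
                 (sigma2_gamma N v\<^sub>1 c \<gamma> + sigma2 N v\<^sub>1 c q \<gamma> \<nu>))))"
proof -
  interpret prob_space M by (rule prob)
  have dims: "dim_row W = N" "dim_col W = N" and v1_dim: "dim_vec v\<^sub>1 = N"
    using W_carrier v1(1) by (auto simp: eigenvector_def)
  have eigen: "(\<Sum>j<N. W $$ (h, j) * v\<^sub>1 $ j) = v\<^sub>1 $ h" if "h < N" for h
  proof -
    have "(W *\<^sub>v v\<^sub>1) $ h = v\<^sub>1 $ h"
      using v1(1) that v1_dim by (simp add: eigenvector_def)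
    then show ?thesis
      using that dims v1_dim by (simp add: scalar_prod_def lessThan_atLeast0)
  qed
  interpret reinforced_system M N W v\<^sub>1 r a X Z Z_inf
    by unfold_locales (fact W_nonneg W_columns r_range a_pos Z0_meas Z0_range X_meas X_range Z_rec
        X_cond_indep X_cond_prob eigen v1(2) Zinf_meas Zinf_range Zinf_limit)+
  let ?K = "(L2_set (($) v\<^sub>1) {..<N})\<^sup>2 / real N"
  have K: "(\<Sum>j<N. (w j)\<^sup>2) = ?K"
    by (simp add: w_def L2_set_def power_divide sum_nonneg flip: sum_divide_distrib)
  have r_asymp: "(\<lambda>n. real (Suc n) powr \<gamma> * r n) \<longlonglongrightarrow> c"
    using tendsto_of_bigo_remainder[OF A2_r] A2_ranges by simp
  have q_asymp: "(\<lambda>n. real (Suc n) powr \<nu> * emp_weight a (Suc n) (Suc n)) \<longlonglongrightarrow> q"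
    using tendsto_of_bigo_remainder[OF A2_q] A2_ranges by simp
  \<comment> \<open>One statement for all regimes: \<rho> = \<nu> in the first, \<rho> = 2 \<gamma>
    - 1 in the other two. The value of \<open>s\<close> adds the head and the tail contribution, so
    each regime only has to decide the conditions inside it.\<close>
  have main: "stable_conv M (\<lambda>n \<omega>. real n powr (\<rho> / 2) * (emp_mean_tilde N v\<^sub>1 a X n \<omega> - Z_inf \<omega>))
      (\<lambda>\<omega>. centred_normal (Z_inf \<omega> * (1 - Z_inf \<omega>) * s))"
    if \<rho>: "0 < \<rho>" "\<rho> \<le> \<nu>" "\<rho> \<le> 2 * \<gamma> - 1"
      and s: "s = ?K * ((q * (if \<rho> = \<nu> then 1 else 0) - c * (if (\<nu> + \<rho>) / 2 = \<gamma> then 1 else 0))\<^sup>2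
          / (2 * (q - (if \<nu> = 1 then \<rho> / 2 else 0)))
        + (if \<rho> = 2 * \<gamma> - 1 then c\<^sup>2 / (2 * \<gamma> - 1) else 0))" for \<rho> s
  proof -
    interpret A: reinforced_system_asymptotics M N W v\<^sub>1 r a X Z Z_inf c q \<gamma> \<nu> \<rho>
      by unfold_locales (fact r_range a_pos A2_ranges \<rho> A3(2) r_asymp q_asymp)+
    have "(A.head_limit\<^sup>2 / (2 * A.decay) + A.tail_limit) * V_lim \<omega> = Z_inf \<omega> * (1 - Z_inf \<omega>) * s" for \<omega>
      by (simp only: A.head_limit_def A.decay_def A.tail_limit_def K s mult_ac)
    then show ?thesis
      using A.stable_conv_rate by (simp only: A.rate_def)
  qed
  have half: "(2 * \<gamma> - 1) / 2 = \<gamma> - 1 / 2" by (simp add: field_simps)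
  have pos: "0 < 2 * \<gamma> - 1" using A2_ranges by simp
  \<comment> \<open>Since \<nu> > 1/2, the maximum defining \<open>gamma0\<close> exceeds 1/2
    here.\<close>
  have gamma0: "gamma0 \<gamma> = 2 * \<gamma> - 1" if "\<nu> \<le> gamma0 \<gamma>"
    using that A2_ranges by (auto simp: gamma0_def max_def split: if_splits)
  have gamma0_ge: "2 * \<gamma> - 1 \<le> gamma0 \<gamma>" by (simp add: gamma0_def)
  show ?thesis
  proof (intro conjI impI)
    assume a: "\<nu> < gamma0 \<gamma>"
    show "stable_conv M (\<lambda>n \<omega>. real n powr (\<nu> / 2) * (emp_mean_tilde N v\<^sub>1 a X n \<omega> - Z_inf \<omega>))
          (\<lambda>\<omega>. centred_normal (Z_inf \<omega> * (1 - Z_inf \<omega>) * sigma2 N v\<^sub>1 c q \<gamma> \<nu>))"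
    proof (rule main)
      show "\<nu> \<le> 2 * \<gamma> - 1" using a gamma0 by simp
      \<comment> \<open>Here \<nu> < 2 \<gamma> - 1 \<le> \<gamma> \<le> 1, so the step sizes drop
        out of the head, the tail vanishes, and the head yields
        \<open>q\<^sup>2 / (2 * q)\<close>.\<close>
      show "sigma2 N v\<^sub>1 c q \<gamma> \<nu> = ?K * ((q * (if \<nu> = \<nu> then 1 else 0) - c * (if (\<nu> + \<nu>) / 2 = \<gamma> then 1 else 0))\<^sup>2
          / (2 * (q - (if \<nu> = 1 then \<nu> / 2 else 0)))
        + (if \<nu> = 2 * \<gamma> - 1 then c\<^sup>2 / (2 * \<gamma> - 1) else 0))"
        using a gamma0 A2_ranges by (simp add: sigma2_def power2_eq_square)
    qed (use A2_ranges in auto)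
  next
    assume b: "gamma0 \<gamma> < \<nu> \<and> \<nu> < 1"
    have "sigma2_gamma N v\<^sub>1 c \<gamma> = ?K * ((q * (if 2 * \<gamma> - 1 = \<nu> then 1 else 0)
          - c * (if (\<nu> + (2 * \<gamma> - 1)) / 2 = \<gamma> then 1 else 0))\<^sup>2
          / (2 * (q - (if \<nu> = 1 then (2 * \<gamma> - 1) / 2 else 0)))
        + (if 2 * \<gamma> - 1 = 2 * \<gamma> - 1 then c\<^sup>2 / (2 * \<gamma> - 1) else 0))"
    proof -
      \<comment> \<open>With 2 \<gamma> - 1 < \<nu> < 1 neither term of the head survives; the
        variance comes from the tail alone.\<close>
      have "2 * \<gamma> - 1 \<noteq> \<nu>" "(\<nu> + (2 * \<gamma> - 1)) / 2 \<noteq> \<gamma>"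
        using b gamma0_ge by (auto simp: field_simps)
      then show ?thesis by (simp add: sigma2_gamma_def)
    qed
    from main[OF _ _ _ this] show "stable_conv M (\<lambda>n \<omega>. real n powr (\<gamma> - 1/2) * (emp_mean_tilde N v\<^sub>1 a X n \<omega> - Z_inf \<omega>))
          (\<lambda>\<omega>. centred_normal (Z_inf \<omega> * (1 - Z_inf \<omega>) * sigma2_gamma N v\<^sub>1 c \<gamma>))"
      using b gamma0_ge pos unfolding half by simp
  next
    assume c: "\<nu> = gamma0 \<gamma> \<or> \<nu> = 1"
    have le: "2 * \<gamma> - 1 \<le> \<nu>" using c gamma0_ge A2_ranges by auto
    have g: "sigma2_gamma N v\<^sub>1 c \<gamma> = ?K * (c\<^sup>2 / (2 * \<gamma> - 1))"
      by (simp add: sigma2_gamma_def)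
    have "sigma2 N v\<^sub>1 c q \<gamma> \<nu> = ?K * ((q * (if 2 * \<gamma> - 1 = \<nu> then 1 else 0)
          - c * (if (\<nu> + (2 * \<gamma> - 1)) / 2 = \<gamma> then 1 else 0))\<^sup>2
          / (2 * (q - (if \<nu> = 1 then (2 * \<gamma> - 1) / 2 else 0))))"
    proof -
      \<comment> \<open>In the first case only \<open>q\<close> survives in the head, in the second
        both \<open>q\<close> and \<open>c\<close> with denominator 2 q - 1, and in the third only
        \<open>c\<close>, since (\<nu> + 2 \<gamma> - 1)/2 = \<gamma> for \<nu> = 1.\<close>
      consider "\<nu> = 2 * \<gamma> - 1" "gamma0 \<gamma> = \<nu>" "\<nu> < 1" | "\<nu> = 1" "\<gamma> = 1" | "\<nu> = 1" "\<gamma> < 1"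
        using c gamma0 A2_ranges by force
      then show ?thesis
      proof cases
        case 1
        then show ?thesis using A2_ranges by (simp add: sigma2_def power2_eq_square)
      next
        case 2
        then have "gamma0 \<gamma> = 1" by (simp add: gamma0_def)
        with 2 show ?thesis by (simp add: sigma2_def algebra_simps)
      next
        case 3
        then have "gamma0 \<gamma> < 1" by (simp add: gamma0_def)
        moreover have "2 * (q - (2 * \<gamma> - 1) / 2) = 2 * q - (2 * \<gamma> - 1)" by (simp add: field_simps)
        ultimately show ?thesis using 3 by (simp add: sigma2_def)
      qed
    qed
    with g have "sigma2_gamma N v\<^sub>1 c \<gamma> + sigma2 N v\<^sub>1 c q \<gamma> \<nu> = ?K * ((q * (if 2 * \<gamma> - 1 = \<nu> then 1 else 0)
          - c * (if (\<nu> + (2 * \<gamma> - 1)) / 2 = \<gamma> then 1 else 0))\<^sup>2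
          / (2 * (q - (if \<nu> = 1 then (2 * \<gamma> - 1) / 2 else 0)))
        + (if 2 * \<gamma> - 1 = 2 * \<gamma> - 1 then c\<^sup>2 / (2 * \<gamma> - 1) else 0))"
      by (simp only: distrib_left add.commute if_True refl)
    from main[OF pos le order_refl this]
    show "stable_conv M (\<lambda>n \<omega>. real n powr (\<gamma> - 1/2) * (emp_mean_tilde N v\<^sub>1 a X n \<omega> - Z_inf \<omega>))
          (\<lambda>\<omega>. centred_normal (Z_inf \<omega> * (1 - Z_inf \<omega>) *
                 (sigma2_gamma N v\<^sub>1 c \<gamma> + sigma2 N v\<^sub>1 c q \<gamma> \<nu>)))"
      unfolding half .
  qed
qed

end
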